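(* Let $n\ge 1$ and $d\ge 0$ be integers. The space $\mathbb{P}\mathrm{L}^d_n$ of all Lorentzian polynomials $f\in \mathrm{H}^d_n$ with $f(1,1,\ldots,1)=1$, equipped with the Euclidean topology on coefficients, is homeomorphic to a closed Euclidean ball.
   Context: $\mathrm{H}^d_n$ denotes the real vector space of homogeneous polynomials of degree $d$ in $\mathbb{R}[w_1,\ldots,w_n]$ together with the zero polynomial, topologized as a Euclidean space via coefficients. For $d\ge 2$, $f\in \mathrm{H}^d_n$ is strictly Lorentzian if all its coefficients (of all degree-$d$ monomials) are positive and for all $1\le i_1,\ldots,i_{d-2}\le n$ the quadratic form $\partial_{i_1}\cdots\partial_{i_{d-2}} f$ (where $\partial_j=\partial/\partial w_j$) has signature $(+,-,\ldots,-)$ (one positive eigenvalue and $n-1$ negative ones). For $d\in\{0,1\}$, $f$ is strictly Lorentzian if all its coefficients are positive. A polynomial in $\mathrm{H}^d_n$ is Lorentzian if it is a limit in $\mathrm{H}^d_n$ of strictly Lorentzian polynomials. A closed Euclidean ball of dimension $0$ is a point. *)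

theory Defs
  imports "HOL-Analysis.Analysis" "HOL-Library.Poly_Mapping" "Jordan_Normal_Form.Char_Poly"
begin

text \<open>
  A multivariate real polynomial is a finitely supported map from exponent vectors to
  coefficients, with the convolution ring structure of \<open>Poly_Mapping\<close>. The variables are
  indexed from 0, so a polynomial in \<open>n\<close> variables involves \<open>w\<^sub>i\<close> for \<open>i < n\<close> only.
\<close>

type_synonym expvec = "nat \<Rightarrow>\<^sub>0 nat"
type_synonym real_mpoly = "(nat \<Rightarrow>\<^sub>0 nat) \<Rightarrow>\<^sub>0 real"

definition mdeg :: "expvec \<Rightarrow> nat" where
  "mdeg m = (\<Sum>i\<in>Poly_Mapping.keys m. Poly_Mapping.lookup m i)"

definition monoms :: "nat \<Rightarrow> nat \<Rightarrow> expvec set" where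
  "monoms n d = {m. Poly_Mapping.keys m \<subseteq> {..<n} \<and> mdeg m = d}"

lemma mdeg_alt:
  assumes "Poly_Mapping.keys m \<subseteq> {..<n}"
  shows "mdeg m = (\<Sum>i<n. Poly_Mapping.lookup m i)"
  unfolding mdeg_def by (rule sum.mono_neutral_left) (use assms in \<open>auto simp: in_keys_iff\<close>)

lemma finite_monoms: "finite (monoms n d)"
proof -
  have "finite {x :: nat \<Rightarrow> nat. x \<in> {..<n} \<rightarrow> {..d} \<and> (\<forall>a. a \<notin> {..<n} \<longrightarrow> x a = 0)}"
    using finite_set_of_finite_funs[of "{..<n}" "{..d}" 0] by (auto simp: Pi_def elim: rev_finite_subset)
  moreover have "Poly_Mapping.lookup ` monoms n d \<subseteq>
     {x :: nat \<Rightarrow> nat. x \<in> {..<n} \<rightarrow> {..d} \<and> (\<forall>a. a \<notin> {..<n} \<longrightarrow> x a = 0)}"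
  proof
    fix g assume "g \<in> Poly_Mapping.lookup ` monoms n d"
    then obtain m where g: "g = Poly_Mapping.lookup m" and m: "m \<in> monoms n d" by blast
    have "g i \<le> d" if "i < n" for i
      using m that member_le_sum[of i "{..<n}" g] by (auto simp: g monoms_def mdeg_alt)
    moreover have "g i = 0" if "\<not> i < n" for i
      using m that by (auto simp: g monoms_def in_keys_iff subset_iff)
    ultimately show "g \<in> {x :: nat \<Rightarrow> nat. x \<in> {..<n} \<rightarrow> {..d} \<and> (\<forall>a. a \<notin> {..<n} \<longrightarrow> x a = 0)}"
      by auto
  qed
  ultimately have "finite (Poly_Mapping.lookup ` monoms n d)" by (rule rev_finite_subset)
  then show ?thesis by (rule finite_imageD) (simp add: inj_on_def lookup_inject)
qed

definition Hpoly :: "nat \<Rightarrow> nat \<Rightarrow> real_mpoly set" where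
  "Hpoly n d = {f. Poly_Mapping.keys f \<subseteq> monoms n d}"

text \<open>
  Since \<open>monoms n d\<close> is finite, the product topology is the Euclidean topology
  on the space of coefficient vectors.
\<close>

definition Htop :: "nat \<Rightarrow> nat \<Rightarrow> real_mpoly topology" where
  "Htop n d = pullback_topology (Hpoly n d)
     (\<lambda>f. restrict (Poly_Mapping.lookup f) (monoms n d)) (powertop_real (monoms n d))"

lemma topspace_Htop: "topspace (Htop n d) = Hpoly n d"
  by (auto simp: Htop_def topspace_pullback_topology)

definition mpeval :: "real_mpoly \<Rightarrow> (nat \<Rightarrow> real) \<Rightarrow> real" where
  "mpeval f x = (\<Sum>m\<in>Poly_Mapping.keys f. Poly_Mapping.lookup f m *
     (\<Prod>i\<in>Poly_Mapping.keys m. x i ^ Poly_Mapping.lookup m i))"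

text \<open>
  Subtraction of exponent vectors is truncated, but it only truncates in terms whose
  coefficient vanishes.
\<close>

definition mpdiff :: "nat \<Rightarrow> real_mpoly \<Rightarrow> real_mpoly" where
  "mpdiff i f = (\<Sum>m\<in>Poly_Mapping.keys f.
     Poly_Mapping.single (m - Poly_Mapping.single i 1)
       (real (Poly_Mapping.lookup m i) * Poly_Mapping.lookup f m))"

lemma lookup_mpdiff:
  "Poly_Mapping.lookup (mpdiff i f) m =
     real (Poly_Mapping.lookup m i + 1) * Poly_Mapping.lookup f (m + Poly_Mapping.single i 1)"
proof -
  let ?e = "Poly_Mapping.single i 1 :: expvec"
  have eq: "(real (Poly_Mapping.lookup k i) * Poly_Mapping.lookup f k when k - ?e = m) = 
    (if k = m + ?e then real (Poly_Mapping.lookup k i) * Poly_Mapping.lookup f k else 0)" for k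
  proof (cases "Poly_Mapping.lookup k i = 0")
    case True
    then show ?thesis by (auto simp: when_def)
  next
    case False
    then have "k - ?e + ?e = k"
      by (intro poly_mapping_eqI) (auto simp: lookup_add lookup_minus lookup_single when_def)
    then show ?thesis by (auto simp: when_def)
  qed
  have "Poly_Mapping.lookup (mpdiff i f) m = 
    (\<Sum>k\<in>Poly_Mapping.keys f. if k = m + ?e then real (Poly_Mapping.lookup k i) * Poly_Mapping.lookup f k else 0)"
    unfolding mpdiff_def lookup_sum lookup_single eq ..
  also have "\<dots> = real (Poly_Mapping.lookup m i + 1) * Poly_Mapping.lookup f (m + ?e)"
    by (simp add: sum.delta' in_keys_iff lookup_add)
  finally show ?thesis .
qed

text \<open>The symmetric matrix \<open>A\<close> with \<open>q(w) = w\<^sup>T A w\<close>, for \<open>q\<close> in \<open>Hpoly n 2\<close>.\<close>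

definition qf_mat :: "nat \<Rightarrow> real_mpoly \<Rightarrow> real mat" where
  "qf_mat n q = Matrix.mat n n (\<lambda>(i, j).
     Poly_Mapping.lookup q (Poly_Mapping.single i 1 + Poly_Mapping.single j 1) *
       (if i = j then 1 else 1 / 2))"

text \<open>
  Eigenvalues are counted with their multiplicity in the characteristic polynomial; the set
  summed over is finite for every square matrix.
\<close>

definition num_eigenvalues :: "real mat \<Rightarrow> real set \<Rightarrow> nat" where
  "num_eigenvalues A S = (\<Sum>x\<in>{x\<in>S. eigenvalue A x}. Polynomial.order x (char_poly A))"

definition lorentz_signature :: "nat \<Rightarrow> real_mpoly \<Rightarrow> bool" where
  "lorentz_signature n q \<longleftrightarrow>
     num_eigenvalues (qf_mat n q) {0<..} = 1 \<and> num_eigenvalues (qf_mat n q) {..<0} = n - 1"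

definition strictly_lorentzian :: "nat \<Rightarrow> nat \<Rightarrow> real_mpoly \<Rightarrow> bool" where
  "strictly_lorentzian n d f \<longleftrightarrow> f \<in> Hpoly n d \<and>
     (\<forall>m\<in>monoms n d. Poly_Mapping.lookup f m > 0) \<and>
     (d \<ge> 2 \<longrightarrow> (\<forall>is. length is = d - 2 \<and> set is \<subseteq> {..<n} \<longrightarrow>
        lorentz_signature n (foldr mpdiff is f)))"

definition lorentzian :: "nat \<Rightarrow> nat \<Rightarrow> real_mpoly \<Rightarrow> bool" where
  "lorentzian n d f \<longleftrightarrow>
     (\<exists>F. (\<forall>k. strictly_lorentzian n d (F k)) \<and> limitin (Htop n d) F f sequentially)"

definition PL :: "nat \<Rightarrow> nat \<Rightarrow> real_mpoly set" where
  "PL n d = {f \<in> Hpoly n d. lorentzian n d f \<and> mpeval f (\<lambda>_. 1) = 1}"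

definition closed_ball_space :: "nat \<Rightarrow> (nat \<Rightarrow> real) topology" where
  "closed_ball_space k = subtopology (Euclidean_space k) {x. (\<Sum>i<k. (x i)\<^sup>2) \<le> 1}"

end

theory Submission
  imports Defs
begin

text \<open>
  Let \<open>K\<close> be the compact set of Lorentzian polynomials \<open>f\<close> with \<open>f(1,\<dots>,1) = 1\<close>. The generator of the
  symmetric exclusion process with capacity \<open>d\<close> at each of the \<open>n\<close> sites acts linearly on the
  coefficients of \<open>f\<close>: a monomial \<open>w\<^sup>m\<close> jumps to \<open>w\<^sup>m w\<^sub>j / w\<^sub>i\<close> at rate \<open>m\<^sub>i (d - m\<^sub>j)\<close>. The chain is
  reversible and irreducible, so by the spectral theorem the flow is \<open>x\<^sub>i \<mapsto> exp (-\<mu>\<^sub>i t) x\<^sub>i\<close> with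
  all \<open>\<mu>\<^sub>i > 0\<close>, in coordinates centred at the stationary polynomial.

  The flow moves \<open>K\<close> into the strictly Lorentzian polynomials at every positive time. Suppose a
  trajectory of weakly Lorentzian polynomials reaches an \<open>f\<close> such that the form \<open>q\<^sub>I\<close> of \<open>\<partial>\<^sup>I f\<close>, \<open>|I| = d - 2\<close>,
  has a kernel vector \<open>x\<close>. Modulo terms that vanish on the kernel, the derivative of \<open>q\<^sub>I(x,x)\<close> along the flow
  is a nonnegative combination of the numbers \<open>q\<^bsub>I-i+j\<^esub>(x,x)\<close> minus \<open>\<Sum>\<^sub>i\<^sub>j (x\<^sub>i - x\<^sub>j)\<^sup>2 \<partial>\<^sub>i \<partial>\<^sub>j \<partial>\<^sup>I f\<close>.
  As \<open>q\<^sub>I x = 0\<close>, the vector \<open>x\<close> is orthogonal to the \<open>i\<close>-th unit vector under \<open>q\<^bsub>I-i+j\<^esub>\<close>, and the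
  reversed Cauchy-Schwarz inequality gives \<open>q\<^bsub>I-i+j\<^esub>(x,x) \<le> 0\<close>. So the derivative is negative and \<open>q\<^sub>I\<close> had
  a second positive direction shortly before, a contradiction.

  Every trajectory other than the fixed point therefore enters \<open>K\<close> at exactly one time, which
  depends continuously on the trajectory. The same is true of the unit ball, and matching the two
  entry times along each trajectory is a homeomorphism.
\<close>

section \<open>The spectral theorem for real symmetric matrices\<close>

text \<open>Tychonoff's theorem. Vectors are functions on a whole type, so a bounded set of vectors
  over a finite index set is enclosed in a box whose remaining sides are \<open>{0}\<close>.\<close>

lemma compact_box_fun:
  fixes B :: "'a \<Rightarrow> real set"
  assumes "\<And>a. compact (B a)"
  shows "compact {x. \<forall>a. x a \<in> B a}"
proof -
  have "compactin (product_topology (\<lambda>a. euclidean) UNIV) (PiE UNIV B)"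
    by (subst compactin_PiE) (use assms in auto)
  moreover have "PiE UNIV B = {x. \<forall>a. x a \<in> B a}"
    by (auto simp: PiE_iff)
  ultimately show ?thesis
    by (simp add: euclidean_product_topology)
qed

lemma continuous_on_coordinate [continuous_intros]:
  "continuous_on S (\<lambda>x :: 'a \<Rightarrow> real. x a)"
  by (rule continuous_on_subset[OF continuous_on_product_coordinates]) simp

text \<open>The first-order optimality condition: near \<open>t = 0\<close> the linear term would
  dominate for one of the two signs of \<open>t\<close>.\<close>

lemma linear_quadratic_bound_imp_zero:
  fixes b c :: real
  assumes "\<And>t. 2 * t * b \<le> t\<^sup>2 * c"
  shows "b = 0"
proof (rule ccontr)
  assume b: "b \<noteq> 0"
  \<comment> \<open>The test value \<open>t = b / k\<close> turns the bound into
    \<open>2 * k * b\<^sup>2 \<le> c * b\<^sup>2\<close>, and \<open>k\<close> is large enough for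
    \<open>c < 2 * k\<close>.\<close>
  define k where "k = \<bar>c\<bar> + 1"
  have k: "k > 0" "c < 2 * k" unfolding k_def by auto
  have "2 * (b / k) * b \<le> (b / k)\<^sup>2 * c" by (rule assms)
  then have "2 * (b / k) * b * k\<^sup>2 \<le> (b / k)\<^sup>2 * c * k\<^sup>2" by (intro mult_right_mono) auto
  then have "2 * k * b\<^sup>2 \<le> c * b\<^sup>2"
    using k by (simp add: field_simps power2_eq_square)
  then show False using b k by simp
qed

text \<open>By compactness the quadratic form has a maximiser on the unit sphere of the orthogonal
  complement of the \<open>v i\<close>. Its first-order condition makes it an eigenvector.\<close>

lemma eigenvector_orthogonal_to_eigenvectors:
  fixes A :: "'a \<Rightarrow> 'a \<Rightarrow> real" and v :: "nat \<Rightarrow> 'a \<Rightarrow> real"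
  assumes fin: "finite \<Omega>"
    and sym: "\<And>a b. a \<in> \<Omega> \<Longrightarrow> b \<in> \<Omega> \<Longrightarrow> A a b = A b a"
    and eig: "\<And>i a. i < m \<Longrightarrow> a \<in> \<Omega> \<Longrightarrow> (\<Sum>b\<in>\<Omega>. A a b * v i b) = ev i * v i a"
    and ex: "\<exists>z. (\<Sum>a\<in>\<Omega>. (z a)\<^sup>2) = 1 \<and> (\<forall>i<m. (\<Sum>a\<in>\<Omega>. v i a * z a) = 0)"
  shows "\<exists>x l. (\<Sum>a\<in>\<Omega>. (x a)\<^sup>2) = 1 \<and> (\<forall>i<m. (\<Sum>a\<in>\<Omega>. v i a * x a) = 0) \<and>
    (\<forall>a\<in>\<Omega>. (\<Sum>b\<in>\<Omega>. A a b * x b) = l * x a)"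
proof -
  define ip where "ip x y = (\<Sum>a\<in>\<Omega>. x a * y a)" for x y :: "'a \<Rightarrow> real"
  define L where "L x = (\<lambda>a. if a \<in> \<Omega> then \<Sum>b\<in>\<Omega>. A a b * x b else 0)" for x
  define B where "B = (\<lambda>a. if a \<in> \<Omega> then {-1..1::real} else {0})"
  define U where "U = {x. \<forall>a. x a \<in> B a} \<inter> ({x. ip x x = 1} \<inter> (\<Inter>i\<in>{..<m}. {x. ip (v i) x = 0}))"
  have ip_add: "ip (\<lambda>a. x a + t * y a) z = ip x z + t * ip y z" for x y z t
    by (simp add: ip_def sum_distrib_left sum.distrib algebra_simps)
  have ip_com: "ip x y = ip y x" for x y by (simp add: ip_def mult.commute)
  have ip_add2: "ip z (\<lambda>a. x a + t * y a) = ip z x + t * ip z y" for x y z t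
    using ip_add[of x t y z] by (simp add: ip_com)
  have L_add: "L (\<lambda>a. x a + t * y a) = (\<lambda>a. L x a + t * L y a)" for x y t
    by (auto simp: L_def sum_distrib_left sum.distrib algebra_simps fun_eq_iff)
  have L_sym: "ip (L x) y = ip x (L y)" for x y
  proof -
    have "ip (L x) y = (\<Sum>a\<in>\<Omega>. \<Sum>b\<in>\<Omega>. A a b * x b * y a)"
      by (simp add: ip_def L_def sum_distrib_right)
    also have "\<dots> = (\<Sum>b\<in>\<Omega>. \<Sum>a\<in>\<Omega>. A a b * x b * y a)" by (rule sum.swap)
    also have "\<dots> = (\<Sum>b\<in>\<Omega>. \<Sum>a\<in>\<Omega>. A b a * x b * y a)"
      by (intro sum.cong refl) (simp add: sym)
    also have "\<dots> = ip x (L y)"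
      by (simp add: ip_def L_def sum_distrib_left mult_ac)
    finally show ?thesis .
  qed
  have ip_pos: "ip x x \<ge> 0" for x by (auto simp: ip_def intro: sum_nonneg)
  have cont: "continuous_on UNIV (\<lambda>x. ip (f x) (g x))"
    if "\<And>a. continuous_on UNIV (\<lambda>x::'a\<Rightarrow>real. f x a)" "\<And>a. continuous_on UNIV (\<lambda>x. g x a)" for f g
    unfolding ip_def by (intro continuous_intros that)
  have contL: "continuous_on UNIV (\<lambda>x::'a\<Rightarrow>real. L x a)" for a
    by (cases "a \<in> \<Omega>") (auto simp: L_def intro!: continuous_intros)
  have contIP: "continuous_on U (\<lambda>x. ip (L x) x)"
    by (rule continuous_on_subset[OF cont]) (auto intro: contL continuous_on_coordinate)
  have "compact U"
    unfolding U_def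
    by (intro compact_Int_closed compact_box_fun closed_Int closed_INT ballI closed_Collect_eq cont)
       (auto simp: B_def intro!: continuous_intros)
  moreover have "U \<noteq> {}"
  proof -
    from ex obtain z where z: "ip z z = 1" "\<forall>i<m. ip (v i) z = 0"
      by (auto simp: ip_def power2_eq_square)
    define y where "y = (\<lambda>a. if a \<in> \<Omega> then z a else 0)"
    have ipy: "ip w y = ip w z" for w by (auto simp: ip_def y_def intro: sum.cong)
    have "\<bar>y a\<bar> \<le> 1" if "a \<in> \<Omega>" for a
    proof -
      have "(z a)\<^sup>2 \<le> ip z z"
        unfolding ip_def power2_eq_square by (rule member_le_sum[OF that]) (use fin in auto)
      with z that show ?thesis by (simp add: y_def abs_square_le_1)
    qed
    then have "y \<in> U"
      using z by (auto simp: U_def B_def ipy ip_com[of y z] abs_le_iff) (auto simp: y_def minus_le_iff)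
    then show ?thesis by blast
  qed
  ultimately obtain x where x: "x \<in> U" and max: "\<And>y. y \<in> U \<Longrightarrow> ip (L y) y \<le> ip (L x) x"
    using continuous_attains_sup[of U "\<lambda>x. ip (L x) x"] contIP by blast
  define l where "l = ip (L x) x"
  have xx: "ip x x = 1" and xv: "\<And>i. i < m \<Longrightarrow> ip (v i) x = 0"
    using x by (auto simp: U_def)
  have bound: "ip (L y) y \<le> l * ip y y" if yv: "\<And>i. i < m \<Longrightarrow> ip (v i) y = 0" for y
  proof (cases "ip y y = 0")
    case True
    then have "\<forall>a\<in>\<Omega>. y a = 0"
      unfolding ip_def using fin by (subst (asm) sum_nonneg_eq_0_iff) auto
    then show ?thesis by (simp add: ip_def)
  next
    case False
    define c where "c = 1 / sqrt (ip y y)"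
    have c2: "c * c * ip y y = 1" using False ip_pos[of y] by (simp add: c_def field_simps)
    define z where "z = (\<lambda>a. if a \<in> \<Omega> then c * y a else 0)"
    have ipz: "ip w z = c * ip w y" for w
      by (auto simp: ip_def z_def sum_distrib_left intro!: sum.cong)
    have zz: "ip z z = 1" using c2 by (simp add: ipz ip_com[of z y] mult_ac)
    have "\<bar>z a\<bar> \<le> 1" if "a \<in> \<Omega>" for a
    proof -
      have "(z a)\<^sup>2 \<le> ip z z"
        unfolding ip_def power2_eq_square by (rule member_le_sum[OF that]) (use fin in auto)
      with zz show ?thesis by (simp add: abs_square_le_1)
    qed
    then have "z \<in> U"
      using yv zz by (auto simp: U_def B_def ipz abs_le_iff) (auto simp: z_def minus_le_iff)
    from max[OF this] have "ip (L z) z \<le> l" by (simp add: l_def)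
    also have "L z = (\<lambda>a. 0 + c * L y a)"
      by (auto simp: L_def z_def fun_eq_iff sum_distrib_left mult_ac intro!: sum.cong)
    also have "ip \<dots> z = c * c * ip (L y) y"
      by (subst ip_add) (simp only: ipz, simp add: ip_def[of "\<lambda>_. 0"])
    finally have "c * c * ip (L y) y * ip y y \<le> l * ip y y"
      by (rule mult_right_mono) (rule ip_pos)
    moreover have "c * c * ip (L y) y * ip y y = c * c * ip y y * ip (L y) y" by simp
    ultimately show ?thesis using c2 by simp
  qed
  \<comment> \<open>The residual \<open>L x - l x\<close> is orthogonal to every \<open>v i\<close>,
    so moving from \<open>x\<close> along \<open>w\<close> stays in the complement. The bound then
    forces \<open>ip (L x) w = 0\<close>, and since \<open>w\<close> is also orthogonal to
    \<open>x\<close>, \<open>ip w w = 0\<close>.\<close>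
  define w where "w = (\<lambda>a. L x a + (- l) * x a)"
  have Lv: "ip (L x) (v i) = 0" if "i < m" for i
  proof -
    have "ip (L x) (v i) = ip x (L (v i))" by (rule L_sym)
    also have "\<dots> = ev i * ip (v i) x"
      unfolding ip_def L_def by (simp add: eig that sum_distrib_left mult_ac)
    finally show ?thesis by (simp add: xv that)
  qed
  have wv: "ip (v i) w = 0" if "i < m" for i
    unfolding w_def using that by (simp only: ip_add2 ip_com[of _ "L x"] Lv xv)
  have wx: "ip w x = 0"
    unfolding w_def ip_add by (simp add: l_def xx)
  have "ip (L x) w = 0"
  proof (rule linear_quadratic_bound_imp_zero[of _ "l * ip w w - ip (L w) w"])
    fix t :: real
    have "ip (L (\<lambda>a. x a + t * w a)) (\<lambda>a. x a + t * w a) \<le> l * ip (\<lambda>a. x a + t * w a) (\<lambda>a. x a + t * w a)"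
      by (rule bound) (simp add: ip_add2 xv wv)
    also have "ip (L (\<lambda>a. x a + t * w a)) (\<lambda>a. x a + t * w a)
        = l + 2 * t * ip (L x) w + t\<^sup>2 * ip (L w) w"
      unfolding L_add ip_add ip_add2 L_sym[of w x] ip_com[of w "L x"]
      by (simp add: l_def power2_eq_square algebra_simps)
    also have "ip (\<lambda>a. x a + t * w a) (\<lambda>a. x a + t * w a) = 1 + t\<^sup>2 * ip w w"
      unfolding ip_add ip_add2 xx ip_com[of x w] wx by (simp add: power2_eq_square)
    finally show "2 * t * ip (L x) w \<le> t\<^sup>2 * (l * ip w w - ip (L w) w)"
      by (simp add: algebra_simps)
  qed
  then have "ip w w = 0"
    using wx ip_add[of "L x" "- l" x w] unfolding w_def[symmetric] ip_com[of x w] by simp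
  then have "\<forall>a\<in>\<Omega>. w a = 0"
    unfolding ip_def using fin by (subst (asm) sum_nonneg_eq_0_iff) auto
  then have "\<forall>a\<in>\<Omega>. (\<Sum>b\<in>\<Omega>. A a b * x b) = l * x a"
    by (simp add: w_def L_def)
  then show ?thesis
    using xx xv by (intro exI[of _ x] exI[of _ l]) (auto simp: ip_def power2_eq_square)
qed

text \<open>\<open>z\<close> is the unit vector at \<open>a\<close> minus its projection onto the
  span of the \<open>v i\<close>; its length follows from Pythagoras. It supplies a new direction
  while the \<open>v i\<close> are too few, and yields completeness once there are
  \<open>card \<Omega>\<close> of them.\<close>

lemma orthonormal_residual:
  fixes v :: "nat \<Rightarrow> 'a \<Rightarrow> real"
  assumes fin: "finite \<Omega>"
    and on: "\<And>i j. i < m \<Longrightarrow> j < m \<Longrightarrow> (\<Sum>a\<in>\<Omega>. v i a * v j a) = (if i = j then 1 else 0)"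
    and a: "a \<in> \<Omega>"
  defines "z \<equiv> \<lambda>b. (if b = a then 1 else 0) - (\<Sum>i<m. v i a * v i b)"
  shows "\<And>i. i < m \<Longrightarrow> (\<Sum>b\<in>\<Omega>. v i b * z b) = 0"
    and "(\<Sum>b\<in>\<Omega>. (z b)\<^sup>2) = 1 - (\<Sum>i<m. (v i a)\<^sup>2)"
proof -
  show orth: "(\<Sum>b\<in>\<Omega>. v i b * z b) = 0" if "i < m" for i
  proof -
    have "(\<Sum>b\<in>\<Omega>. v i b * (\<Sum>j<m. v j a * v j b)) = (\<Sum>j<m. v j a * (\<Sum>b\<in>\<Omega>. v i b * v j b))"
      by (subst sum_distrib_left, subst sum.swap) (simp add: sum_distrib_left mult_ac)
    also have "\<dots> = (\<Sum>j<m. if i = j then v j a else 0)"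
      by (intro sum.cong refl) (auto simp: on that)
    also have "\<dots> = v i a" using that by simp
    finally show ?thesis
      using fin a by (simp add: z_def right_diff_distrib sum_subtractf if_distrib[of "\<lambda>x. _ * x"] cong: if_cong)
  qed
  have "(\<Sum>b\<in>\<Omega>. (z b)\<^sup>2) = (\<Sum>b\<in>\<Omega>. (if b = a then z b else 0)) - (\<Sum>b\<in>\<Omega>. (\<Sum>i<m. v i a * v i b) * z b)"
    unfolding sum_subtractf[symmetric]
    by (intro sum.cong refl) (auto simp: z_def power2_eq_square algebra_simps)
  also have "(\<Sum>b\<in>\<Omega>. (\<Sum>i<m. v i a * v i b) * z b) = (\<Sum>i<m. v i a * (\<Sum>b\<in>\<Omega>. v i b * z b))"
    by (subst sum_distrib_right, subst sum.swap) (simp add: sum_distrib_left mult_ac)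
  also have "\<dots> = 0" using orth by simp
  also have "(\<Sum>b\<in>\<Omega>. (if b = a then z b else 0)) = 1 - (\<Sum>i<m. (v i a)\<^sup>2)"
    using fin a by (simp add: z_def power2_eq_square)
  finally show "(\<Sum>b\<in>\<Omega>. (z b)\<^sup>2) = 1 - (\<Sum>i<m. (v i a)\<^sup>2)" by simp
qed

text \<open>The trace of the sum of the \<open>m\<close> rank-one matrices
  \<open>v i a * v i b\<close>, each of trace 1.\<close>

lemma sum_square_orthonormal:
  fixes v :: "nat \<Rightarrow> 'a \<Rightarrow> real"
  assumes on: "\<And>i. i < m \<Longrightarrow> (\<Sum>a\<in>\<Omega>. v i a * v i a) = 1"
  shows "(\<Sum>a\<in>\<Omega>. \<Sum>i<m. (v i a)\<^sup>2) = real m"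
  by (subst sum.swap) (simp add: power2_eq_square on)

theorem real_spectral_theorem:
  fixes A :: "'a \<Rightarrow> 'a \<Rightarrow> real"
  assumes fin: "finite \<Omega>"
    and sym: "\<And>a b. a \<in> \<Omega> \<Longrightarrow> b \<in> \<Omega> \<Longrightarrow> A a b = A b a"
  obtains v :: "nat \<Rightarrow> 'a \<Rightarrow> real" and ev :: "nat \<Rightarrow> real" where
    "\<And>i j. i < card \<Omega> \<Longrightarrow> j < card \<Omega> \<Longrightarrow> (\<Sum>a\<in>\<Omega>. v i a * v j a) = (if i = j then 1 else 0)"
    "\<And>a b. a \<in> \<Omega> \<Longrightarrow> b \<in> \<Omega> \<Longrightarrow> (\<Sum>i<card \<Omega>. v i a * v i b) = (if a = b then 1 else 0)"
    "\<And>i a. i < card \<Omega> \<Longrightarrow> a \<in> \<Omega> \<Longrightarrow> (\<Sum>b\<in>\<Omega>. A a b * v i b) = ev i * v i a"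
proof -
  have "\<exists>v ev. (\<forall>i<m. \<forall>j<m. (\<Sum>a\<in>\<Omega>. v i a * v j a) = (if i = j then 1 else 0)) \<and>
    (\<forall>i<m. \<forall>a\<in>\<Omega>. (\<Sum>b\<in>\<Omega>. A a b * v i b) = ev i * v i a)" if "m \<le> card \<Omega>" for m
    using that
  proof (induction m)
    case 0
    then show ?case by simp
  next
    case (Suc m)
    then obtain v ev where *: "(\<forall>i<m. \<forall>j<m. (\<Sum>a\<in>\<Omega>. v i a * v j a) = (if i = j then 1 else 0)) \<and>
      (\<forall>i<m. \<forall>a\<in>\<Omega>. (\<Sum>b\<in>\<Omega>. A a b * v i b) = ev i * v i a)"
      by auto
    have
      on: "\<And>i j. i < m \<Longrightarrow> j < m \<Longrightarrow> (\<Sum>a\<in>\<Omega>. v i a * v j a) = (if i = j then 1 else 0)" and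
      eig: "\<And>i a. i < m \<Longrightarrow> a \<in> \<Omega> \<Longrightarrow> (\<Sum>b\<in>\<Omega>. A a b * v i b) = ev i * v i a"
      using * by auto
    \<comment> \<open>Some unit vector lies outside the span of the \<open>v i\<close>: otherwise
      summing over \<open>\<Omega>\<close> gives \<open>card \<Omega> \<le> m\<close>.\<close>
    have "\<exists>a\<in>\<Omega>. (\<Sum>i<m. (v i a)\<^sup>2) < 1"
    proof (rule ccontr)
      assume "\<not> ?thesis"
      then have "(\<Sum>a\<in>\<Omega>. 1) \<le> (\<Sum>a\<in>\<Omega>. \<Sum>i<m. (v i a)\<^sup>2)"
        by (intro sum_mono) (auto simp: not_less)
      also have "\<dots> = real m" by (rule sum_square_orthonormal) (simp add: on)
      finally show False using Suc.prems by simp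
    qed
    then obtain a where a: "a \<in> \<Omega>" "(\<Sum>i<m. (v i a)\<^sup>2) < 1" by blast
    define z where "z = (\<lambda>b. (if b = a then 1 else 0) - (\<Sum>i<m. v i a * v i b))"
    define s where "s = (\<Sum>b\<in>\<Omega>. (z b)\<^sup>2)"
    have s: "s > 0" and orth: "\<And>i. i < m \<Longrightarrow> (\<Sum>b\<in>\<Omega>. v i b * z b) = 0"
      using orthonormal_residual[OF fin on a(1)] a(2) unfolding s_def z_def by auto
    have 1: "\<exists>z. (\<Sum>a\<in>\<Omega>. (z a)\<^sup>2) = 1 \<and> (\<forall>i<m. (\<Sum>a\<in>\<Omega>. v i a * z a) = 0)"
      using s orth
      by (intro exI[of _ "\<lambda>b. z b / sqrt s"])
         (auto simp: power_divide sum_divide_distrib[symmetric] s_def[symmetric])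
    obtain x l where x: "(\<Sum>a\<in>\<Omega>. (x a)\<^sup>2) = 1" "\<And>i. i < m \<Longrightarrow> (\<Sum>a\<in>\<Omega>. v i a * x a) = 0"
      "\<And>a. a \<in> \<Omega> \<Longrightarrow> (\<Sum>b\<in>\<Omega>. A a b * x b) = l * x a"
      using eigenvector_orthogonal_to_eigenvectors[OF fin sym eig 1] by blast
    show ?case
      by (intro exI[of _ "v(m := x)"] exI[of _ "ev(m := l)"])
         (use x on eig in \<open>auto simp: less_Suc_eq power2_eq_square mult.commute\<close>)
  qed
  from this[OF order_refl] obtain v ev where *:
    "(\<forall>i<card \<Omega>. \<forall>j<card \<Omega>. (\<Sum>a\<in>\<Omega>. v i a * v j a) = (if i = j then 1 else 0)) \<and>
      (\<forall>i<card \<Omega>. \<forall>a\<in>\<Omega>. (\<Sum>b\<in>\<Omega>. A a b * v i b) = ev i * v i a)"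
    by auto
  have on: "\<And>i j. i < card \<Omega> \<Longrightarrow> j < card \<Omega> \<Longrightarrow> (\<Sum>a\<in>\<Omega>. v i a * v j a) = (if i = j then 1 else 0)" and
    eig: "\<And>i a. i < card \<Omega> \<Longrightarrow> a \<in> \<Omega> \<Longrightarrow> (\<Sum>b\<in>\<Omega>. A a b * v i b) = ev i * v i a"
    using * by auto
  \<comment> \<open>One minus this sum is the squared length of a residual, hence nonnegative. These
    defects add up to zero, so all residuals vanish, which is the completeness relation.\<close>
  have le: "(\<Sum>i<card \<Omega>. (v i a)\<^sup>2) \<le> 1" if "a \<in> \<Omega>" for a
  proof -
    have "0 \<le> (\<Sum>b\<in>\<Omega>. ((if b = a then 1 else 0) - (\<Sum>i<card \<Omega>. v i a * v i b))\<^sup>2)"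
      by (intro sum_nonneg) auto
    with orthonormal_residual(2)[OF fin on that] show ?thesis by simp
  qed
  have "(\<Sum>a\<in>\<Omega>. 1 - (\<Sum>i<card \<Omega>. (v i a)\<^sup>2)) = 0"
    using sum_square_orthonormal[of "card \<Omega>" v \<Omega>] on by (simp add: sum_subtractf)
  then have eq: "1 - (\<Sum>i<card \<Omega>. (v i a)\<^sup>2) = 0" if "a \<in> \<Omega>" for a
    using fin le that by (subst (asm) sum_nonneg_eq_0_iff) auto
  have "(\<Sum>i<card \<Omega>. v i a * v i b) = (if a = b then 1 else 0)" if "a \<in> \<Omega>" "b \<in> \<Omega>" for a b
  proof -
    have "(\<Sum>b\<in>\<Omega>. ((if b = a then 1 else 0) - (\<Sum>i<card \<Omega>. v i a * v i b))\<^sup>2) = 0"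
      using orthonormal_residual(2)[OF fin on that(1)] eq[OF that(1)] by simp
    then show ?thesis
      using fin that by (subst (asm) sum_nonneg_eq_0_iff) (auto split: if_splits)
  qed
  then show ?thesis using that[of v ev] on eig by blast
qed

section \<open>Signature of quadratic forms\<close>

lemma order_prod_list_linear:
  fixes es :: "real list"
  shows "Polynomial.order x (\<Prod>e\<leftarrow>es. [:- e, 1:]) = length (filter (\<lambda>e. e = x) es)"
proof (induction es)
  case Nil
  then show ?case by (simp add: order_0I)
next
  case (Cons e es)
  have ne: "(\<Prod>e\<leftarrow>es. [:- e, 1:]) \<noteq> 0"
    by (subst prod_list_zero_iff) auto
  have 1: "Polynomial.order x [:- e, 1:] = (if e = x then 1 else 0)"
    using order_power_n_n[of x 1] by (auto intro: order_0I)
  show ?case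
    using ne Cons by (simp add: order_mult 1 del: mult_pCons_left)
qed

text \<open>The basis vectors, as columns of \<open>V\<close> with inverse the transpose
  \<open>W\<close>, diagonalise the matrix. The characteristic polynomial splits into the linear
  factors of the \<open>ev i\<close>, so counting its roots with multiplicity amounts to counting
  indices.\<close>

lemma num_eigenvalues_orthonormal_eigenbasis:
  fixes A :: "nat \<Rightarrow> nat \<Rightarrow> real" and v :: "nat \<Rightarrow> nat \<Rightarrow> real"
  assumes on: "\<And>i j. i < n \<Longrightarrow> j < n \<Longrightarrow> (\<Sum>a<n. v i a * v j a) = (if i = j then 1 else 0)"
    and co: "\<And>a b. a < n \<Longrightarrow> b < n \<Longrightarrow> (\<Sum>i<n. v i a * v i b) = (if a = b then 1 else 0)"
    and eig: "\<And>i a. i < n \<Longrightarrow> a < n \<Longrightarrow> (\<Sum>b<n. A a b * v i b) = ev i * v i a"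
  shows "num_eigenvalues (Matrix.mat n n (\<lambda>(i, j). A i j)) S = card {i. i < n \<and> ev i \<in> S}"
proof -
  define M where "M = Matrix.mat n n (\<lambda>(i, j). A i j)"
  define V where "V = Matrix.mat n n (\<lambda>(a, i). v i a)"
  define W where "W = Matrix.mat n n (\<lambda>(i, a). v i a)"
  define D where "D = Matrix.mat n n (\<lambda>(i, j). if i = j then ev i else 0)"
  define es where "es = map ev [0..<n]"
  have car: "M \<in> carrier_mat n n" "V \<in> carrier_mat n n" "W \<in> carrier_mat n n" "D \<in> carrier_mat n n"
    by (auto simp: M_def V_def W_def D_def)
  have VW: "V * W = 1\<^sub>m n"
    by (rule eq_matI) (auto simp: V_def W_def scalar_prod_def lessThan_atLeast0[symmetric] co)
  have WV: "W * V = 1\<^sub>m n"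
    by (rule eq_matI) (auto simp: V_def W_def scalar_prod_def lessThan_atLeast0[symmetric] on)
  have MV: "M * V = V * D"
    by (rule eq_matI)
       (auto simp: V_def D_def M_def scalar_prod_def lessThan_atLeast0[symmetric] eig
          if_distrib[of "\<lambda>x. _ * x"] cong: if_cong)
  have "M = M * (V * W)" using car by (simp add: VW)
  also have "\<dots> = V * D * W" using car by (simp flip: assoc_mult_mat[of M n n V n W n] add: MV)
  finally have "similar_mat_wit M D V W"
    using car by (intro similar_mat_witI[of _ _ n]) (auto simp: VW WV)
  then have "char_poly M = char_poly D"
    by (intro char_poly_similar) (auto simp: similar_mat_def)
  also have "\<dots> = (\<Prod>e\<leftarrow>diag_mat D. [:- e, 1:])"
    by (rule char_poly_upper_triangular[OF car(4)]) (auto simp: D_def)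
  also have "diag_mat D = es"
    by (auto simp: diag_mat_def D_def es_def)
  finally have cp: "char_poly M = (\<Prod>e\<leftarrow>es. [:- e, 1:])" .
  have "num_eigenvalues M S = (\<Sum>x\<in>{x\<in>S. x \<in> ev ` {..<n}}. card {i. i < n \<and> ev i = x})"
    unfolding num_eigenvalues_def
  proof (rule sum.cong)
    show "{x \<in> S. eigenvalue M x} = {x \<in> S. x \<in> ev ` {..<n}}"
      unfolding eigenvalue_root_char_poly[OF car(1)] cp
      by (auto simp: poly_prod_list prod_list_zero_iff es_def o_def)
  next
    fix x
    have "{i. i < n \<and> ev i = x} = set (filter (\<lambda>i. ev i = x) [0..<n])" by auto
    also have "card \<dots> = length (filter (\<lambda>i. ev i = x) [0..<n])"
      by (rule distinct_card) simp
    finally show "Polynomial.order x (char_poly M) = card {i. i < n \<and> ev i = x}"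
      unfolding cp order_prod_list_linear es_def by (simp add: filter_map o_def)
  qed
  also have "\<dots> = card (\<Union>x\<in>{x\<in>S. x \<in> ev ` {..<n}}. {i. i < n \<and> ev i = x})"
    by (rule card_UN_disjoint[symmetric]) (auto intro: finite_subset[of _ "ev ` {..<n}"])
  also have "(\<Union>x\<in>{x\<in>S. x \<in> ev ` {..<n}}. {i. i < n \<and> ev i = x}) = {i. i < n \<and> ev i \<in> S}"
    by auto
  finally show ?thesis by (simp add: M_def)
qed

section \<open>Bilinear forms and a criterion for exactly one positive square\<close>

definition bform :: "nat \<Rightarrow> (nat \<Rightarrow> nat \<Rightarrow> real) \<Rightarrow> (nat \<Rightarrow> real) \<Rightarrow> (nat \<Rightarrow> real) \<Rightarrow> real" where
  "bform n A x y = (\<Sum>k<n. \<Sum>l<n. A k l * x k * y l)"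

lemma bform_add_left: "bform n A (\<lambda>k. x k + y k) z = bform n A x z + bform n A y z"
  by (simp add: bform_def distrib_left distrib_right sum.distrib)

lemma bform_add_right: "bform n A z (\<lambda>k. x k + y k) = bform n A z x + bform n A z y"
  by (simp add: bform_def distrib_left distrib_right sum.distrib)

lemma bform_scale_left: "bform n A (\<lambda>k. c * x k) z = c * bform n A x z"
  by (simp add: bform_def sum_distrib_left mult_ac)

lemma bform_scale_right: "bform n A z (\<lambda>k. c * x k) = c * bform n A z x"
  by (simp add: bform_def sum_distrib_left mult_ac)

lemmas bform_linear = bform_add_left bform_add_right bform_scale_left bform_scale_right

lemma bform_commute:
  assumes "\<And>k l. k < n \<Longrightarrow> l < n \<Longrightarrow> A k l = A l k"
  shows "bform n A x y = bform n A y x"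
  unfolding bform_def by (subst sum.swap) (auto intro!: sum.cong simp: assms)

lemma bform_cong:
  assumes "\<And>k l. k < n \<Longrightarrow> l < n \<Longrightarrow> A k l = B k l"
    "\<And>k. k < n \<Longrightarrow> x k = x' k" "\<And>k. k < n \<Longrightarrow> y k = y' k"
  shows "bform n A x y = bform n B x' y'"
  unfolding bform_def using assms by (intro sum.cong refl) auto

lemma bform_eq_sum: "bform n A x y = (\<Sum>k<n. x k * (\<Sum>l<n. A k l * y l))"
  by (simp add: bform_def sum_distrib_left mult_ac)

lemma bform_scale_matrix: "bform n (\<lambda>k l. c * A k l) x y = c * bform n A x y"
  by (simp add: bform_def sum_distrib_left mult_ac)

text \<open>A dimension count in both directions: the span of \<open>x\<close> and \<open>u\<close>
  meets the span of the negative eigenvectors, and the span of two eigenvectors with nonnegative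
  eigenvalues meets the orthogonal complement of \<open>u\<close>.\<close>

theorem one_positive_eigenvalue_iff:
  fixes A :: "nat \<Rightarrow> nat \<Rightarrow> real"
  assumes sym: "\<And>a b. a < n \<Longrightarrow> b < n \<Longrightarrow> A a b = A b a"
    and pos: "bform n A u u > 0"
  defines "M \<equiv> Matrix.mat n n (\<lambda>(i, j). A i j)"
  shows "num_eigenvalues M {0<..} = 1 \<and> num_eigenvalues M {..<0} = n - 1 \<longleftrightarrow>
    (\<forall>x. (\<exists>k<n. x k \<noteq> 0) \<and> bform n A x u = 0 \<longrightarrow> bform n A x x < 0)" (is "?L \<longleftrightarrow> ?R")
proof -
  obtain v :: "nat \<Rightarrow> nat \<Rightarrow> real" and ev where
    on: "\<And>i j. i < n \<Longrightarrow> j < n \<Longrightarrow> (\<Sum>a<n. v i a * v j a) = (if i = j then 1 else 0)" and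
    co: "\<And>a b. a < n \<Longrightarrow> b < n \<Longrightarrow> (\<Sum>i<n. v i a * v i b) = (if a = b then 1 else 0)" and
    eig: "\<And>i a. i < n \<Longrightarrow> a < n \<Longrightarrow> (\<Sum>b<n. A a b * v i b) = ev i * v i a"
    using real_spectral_theorem[of "{..<n}" A] sym by auto
  note num = num_eigenvalues_orthonormal_eigenbasis[OF on co eig, folded M_def]
  define c where "c x i = (\<Sum>a<n. x a * v i a)" for x i
  have expand: "x a = (\<Sum>i<n. c x i * v i a)" if "a < n" for x a
  proof -
    have "(\<Sum>i<n. c x i * v i a) = (\<Sum>b<n. x b * (\<Sum>i<n. v i b * v i a))"
      unfolding c_def sum_distrib_right sum_distrib_left
      by (subst sum.swap) (simp add: mult_ac)
    also have "\<dots> = (\<Sum>b<n. if b = a then x b else 0)"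
      by (intro sum.cong refl) (auto simp: co that)
    finally show ?thesis using that by simp
  qed
  have diag: "bform n A x y = (\<Sum>i<n. ev i * c x i * c y i)" for x y
  proof -
    have Ay: "(\<Sum>l<n. A k l * y l) = (\<Sum>i<n. c y i * (ev i * v i k))" if "k < n" for k
    proof -
      have "(\<Sum>l<n. A k l * y l) = (\<Sum>l<n. A k l * (\<Sum>i<n. c y i * v i l))"
        by (rule sum.cong) (auto simp: expand[of _ y])
      also have "\<dots> = (\<Sum>i<n. c y i * (\<Sum>l<n. A k l * v i l))"
        unfolding sum_distrib_left by (subst sum.swap) (simp add: mult_ac)
      finally show ?thesis using that by (simp add: eig)
    qed
    have "bform n A x y = (\<Sum>k<n. x k * (\<Sum>i<n. c y i * (ev i * v i k)))"
      unfolding bform_eq_sum by (rule sum.cong) (auto simp: Ay)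
    also have "\<dots> = (\<Sum>i<n. ev i * c x i * c y i)"
      unfolding c_def[of x] sum_distrib_left sum_distrib_right
      by (subst sum.swap) (simp add: mult_ac)
    finally show ?thesis .
  qed
  have c_lin: "c (\<lambda>k. s * x k + t * y k) i = s * c x i + t * c y i" for s t x y i
    by (simp add: c_def sum_distrib_left sum.distrib algebra_simps)
  have c_v: "c (v i) j = (if i = j then 1 else 0)" if "i < n" "j < n" for i j
    using on that by (simp add: c_def)
  have nz: "\<exists>i<n. c x i \<noteq> 0" if "k < n" "x k \<noteq> 0" for x k
    proof (rule ccontr)
    assume "\<not> ?thesis"
    then have "x k = 0" using expand[OF that(1), of x] by simp
    with that show False by simp
  qed
  have quad: "bform n A (\<lambda>k. s * x k + t * y k) (\<lambda>k. s * x k + t * y k) =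
    s\<^sup>2 * bform n A x x + 2 * s * t * bform n A x y + t\<^sup>2 * bform n A y y" for s t x y
    using bform_commute[of n A y x, OF sym]
    by (simp add: bform_linear power2_eq_square algebra_simps)
  show ?thesis
  proof
    assume L: ?L
    then have "card {i. i < n \<and> ev i \<in> {0<..}} = 1" "card {i. i < n \<and> ev i \<in> {..<0}} = n - 1"
      by (auto simp: num)
    then obtain p where p: "{i. i < n \<and> ev i \<in> {0<..}} = {p}" by (auto simp: card_1_singleton_iff)
    then have pn: "p < n" "ev p > 0" by blast+
    have "{i. i < n \<and> ev i \<in> {..<0}} = {..<n} - {p}"
    proof (rule card_subset_eq)
      show "{i. i < n \<and> ev i \<in> {..<0}} \<subseteq> {..<n} - {p}" using pn by auto
      show "card {i. i < n \<and> ev i \<in> {..<0}} = card ({..<n} - {p})"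
        using pn \<open>card {i. i < n \<and> ev i \<in> {..<0}} = n - 1\<close> by simp
    qed simp
    then have neg: "ev i < 0" if "i < n" "i \<noteq> p" for i using that by blast
    have neg_form: "bform n A z z < 0" if z: "c z p = 0" "k < n" "z k \<noteq> 0" for z k
    proof -
      obtain i where i: "i < n" "c z i \<noteq> 0" using nz[of k z] z by blast
      have "i \<noteq> p" using i z by auto
      have "(\<Sum>i<n. ev i * c z i * c z i) < (\<Sum>i<n. 0)"
      proof (rule sum_strict_mono_ex1)
        show "\<forall>x\<in>{..<n}. ev x * c z x * c z x \<le> 0"
        proof
          fix j assume "j \<in> {..<n}"
          then show "ev j * c z j * c z j \<le> 0"
            using neg[of j] z
            by (cases "j = p") (auto simp: mult.assoc intro!: mult_nonpos_nonneg less_imp_le[of "ev j"])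
        qed
        have "ev i * (c z i * c z i) < 0"
          using neg[OF i(1) \<open>i \<noteq> p\<close>] i by (intro mult_neg_pos) (auto simp: zero_less_mult_iff)
        then show "\<exists>a\<in>{..<n}. ev a * c z a * c z a < 0" using i by (auto simp: mult.assoc)
      qed simp
      then show ?thesis by (simp add: diag)
    qed
    show ?R
    proof (intro allI impI, rule ccontr)
      fix x assume x: "(\<exists>k<n. x k \<noteq> 0) \<and> bform n A x u = 0" and "\<not> bform n A x x < 0"
      then obtain k where k: "k < n" "x k \<noteq> 0" and xx: "bform n A x x \<ge> 0" and xu: "bform n A x u = 0"
        by auto
      \<comment> \<open>The combination of \<open>x\<close> and \<open>u\<close> without component
        along the positive eigenvector \<open>v p\<close>. The form is nonnegative at
        \<open>z\<close>, so \<open>z\<close> must vanish; then \<open>c x p = 0\<close>, and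
        \<open>x\<close> itself contradicts \<open>neg_form\<close>.\<close>
      define z where "z = (\<lambda>k. c u p * x k + (- c x p) * u k)"
      have zp: "c z p = 0" unfolding z_def c_lin by simp
      have zz: "bform n A z z = (c u p)\<^sup>2 * bform n A x x + (c x p)\<^sup>2 * bform n A u u"
        unfolding z_def quad using xu by simp
      have "bform n A z z \<ge> 0" unfolding zz using xx pos by simp
      then have z0: "z k = 0" if "k < n" for k using neg_form[OF zp that] by force
      have "bform n A z z = 0" using z0 by (simp add: bform_def)
      moreover have "0 \<le> (c u p)\<^sup>2 * bform n A x x" "0 \<le> (c x p)\<^sup>2 * bform n A u u"
        using xx pos by simp_all
      ultimately have "(c x p)\<^sup>2 * bform n A u u = 0" unfolding zz by linarith
      then have "c x p = 0" using pos by simp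
      then show False using neg_form[of x k] k xx by simp
    qed
  next
    assume R: ?R
    have uniq: "i = j" if ij: "i < n" "j < n" "ev i \<ge> 0" "ev j \<ge> 0" for i j
    proof (rule ccontr)
      assume "i \<noteq> j"
      \<comment> \<open>The coefficients make \<open>z\<close> orthogonal to \<open>u\<close>; the
        case distinction prevents both from vanishing.\<close>
      define s where "s = (if bform n A (v i) u = 0 then 1 else bform n A (v j) u)"
      define t where "t = (if bform n A (v i) u = 0 then 0 else - bform n A (v i) u)"
      define z where "z = (\<lambda>k. s * v i k + t * v j k)"
      have st: "s \<noteq> 0 \<or> t \<noteq> 0" by (auto simp: s_def t_def)
      have zu: "bform n A z u = 0"
        by (simp add: z_def bform_linear s_def t_def)
      have czi: "c z i = s" "c z j = t"
        unfolding z_def c_lin using ij \<open>i \<noteq> j\<close> by (simp_all add: c_v)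
      have "\<exists>k<n. z k \<noteq> 0"
      proof (rule ccontr)
        assume "\<not> ?thesis"
        then have "c z i = 0" "c z j = 0" by (simp_all add: c_def)
        with czi st show False by simp
      qed
      with R zu have "bform n A z z < 0" by blast
      moreover have "bform n A z z = (\<Sum>l<n. ev l * (c z l)\<^sup>2)"
        by (simp add: diag power2_eq_square mult.assoc)
      moreover have "(\<Sum>l<n. ev l * (c z l)\<^sup>2) \<ge> 0"
      proof (rule sum_nonneg)
        fix l assume "l \<in> {..<n}"
        then show "0 \<le> ev l * (c z l)\<^sup>2"
          using ij unfolding z_def c_lin by (cases "l = i"; cases "l = j") (auto simp: c_v)
      qed
      ultimately show False by simp
    qed
    have "\<exists>p<n. ev p > 0"
    proof (rule ccontr)
      assume *: "\<not> ?thesis"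
      have "(\<Sum>i<n. ev i * c u i * c u i) \<le> 0"
      proof (rule sum_nonpos)
        fix i assume "i \<in> {..<n}"
        then have "ev i \<le> 0" using * by (meson lessThan_iff not_less)
        then show "ev i * c u i * c u i \<le> 0" by (simp add: mult.assoc mult_nonpos_nonneg)
      qed
      with pos show False by (simp add: diag)
    qed
    then obtain p where p: "p < n" "ev p > 0" by blast
    have neg: "ev i < 0" if "i < n" "i \<noteq> p" for i
      using uniq[of i p] p that by (meson less_imp_le not_less)
    have "i = p" if "i < n" "0 < ev i" for i
      using neg[OF that(1)] that(2) by (meson less_asym)
    then have "{i. i < n \<and> ev i \<in> {0<..}} = {p}"
      using p unfolding greaterThan_iff by blast
    moreover have "{i. i < n \<and> ev i \<in> {..<0}} = {..<n} - {p}"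
      using p neg by (intro equalityI subsetI) auto
    ultimately show ?L using p by (simp add: num)
  qed
qed

section \<open>The discriminant of a form with one positive square\<close>

text \<open>
  With \<open>u = (1,\<dots>,1)\<close>, a form that is positive at \<open>u\<close> has exactly one positive square iff
  \<open>disc n A \<le> 0\<close> everywhere. Unlike the signature, \<open>disc\<close> is polynomial in the entries of \<open>A\<close>,
  hence differentiable along curves of forms.
\<close>

definition disc :: "nat \<Rightarrow> (nat \<Rightarrow> nat \<Rightarrow> real) \<Rightarrow> (nat \<Rightarrow> real) \<Rightarrow> real" where
  "disc n A x = bform n A x x * bform n A (\<lambda>_. 1) (\<lambda>_. 1) - (bform n A x (\<lambda>_. 1))\<^sup>2"

locale sym_form =
  fixes n :: nat and A :: "nat \<Rightarrow> nat \<Rightarrow> real"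
  assumes sym: "k < n \<Longrightarrow> l < n \<Longrightarrow> A k l = A l k"
    and pos: "bform n A (\<lambda>_. 1) (\<lambda>_. 1) > 0"
begin

lemma commute: "bform n A x y = bform n A y x"
  by (rule bform_commute) (rule sym)

text \<open>\<open>disc n A x\<close> is the Gram determinant of \<open>x\<close> and the all-ones
  vector, so adding a constant leaves it unchanged.\<close>

lemma disc_affine: "disc n A (\<lambda>k. s * x k + c) = s\<^sup>2 * disc n A x"
proof -
  have "(\<lambda>k. s * x k + c) = (\<lambda>k. s * x k + c * 1)" by simp
  then show ?thesis
    using commute[of "\<lambda>_. 1" x]
    by (simp only: disc_def bform_linear) (simp add: power2_eq_square algebra_simps)
qed

text \<open>The projection along the all-ones vector onto its orthogonal complement under the form.
  The factor \<open>1 *\<close> gives it the shape of \<open>disc_affine\<close>.\<close>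

definition proj :: "(nat \<Rightarrow> real) \<Rightarrow> nat \<Rightarrow> real" where
  "proj x = (\<lambda>k. 1 * x k + (- (bform n A x (\<lambda>_. 1) / bform n A (\<lambda>_. 1) (\<lambda>_. 1))))"

lemma proj_perp: "bform n A (proj x) (\<lambda>_. 1) = 0"
proof -
  have "proj x = (\<lambda>k. x k + (- (bform n A x (\<lambda>_. 1) / bform n A (\<lambda>_. 1) (\<lambda>_. 1))) * 1)"
    by (simp add: proj_def)
  then show ?thesis using pos by (simp only: bform_linear) simp
qed

lemma disc_proj: "disc n A x = bform n A (proj x) (proj x) * bform n A (\<lambda>_. 1) (\<lambda>_. 1)"
proof -
  have "disc n A x = disc n A (proj x)" unfolding proj_def by (subst disc_affine) simp
  then show ?thesis by (simp add: disc_def proj_perp)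
qed

text \<open>\<open>proj\<close> maps non-constant vectors to non-zero vectors orthogonal to the
  all-ones vector. Conversely such a vector is not constant, because the form is positive at the
  all-ones vector.\<close>

lemma perp_iff_nonconst:
  "(\<forall>x. (\<exists>k<n. x k \<noteq> 0) \<and> bform n A x (\<lambda>_. 1) = 0 \<longrightarrow> bform n A x x < 0) \<longleftrightarrow>
   (\<forall>x. (\<exists>k<n. \<exists>l<n. x k \<noteq> x l) \<longrightarrow> disc n A x < 0)" (is "?L \<longleftrightarrow> ?R")
proof
  assume L: ?L
  show ?R
  proof (intro allI impI)
    fix x :: "nat \<Rightarrow> real" assume "\<exists>k<n. \<exists>l<n. x k \<noteq> x l"
    then obtain k l where kl: "k < n" "l < n" "x k \<noteq> x l" by blast
    then have "proj x k \<noteq> 0 \<or> proj x l \<noteq> 0" by (auto simp: proj_def)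
    with L kl proj_perp have "bform n A (proj x) (proj x) < 0" by blast
    then show "disc n A x < 0" unfolding disc_proj using pos by (rule mult_neg_pos)
  qed
next
  assume R: ?R
  show ?L
  proof (intro allI impI, elim conjE exE)
    fix x k assume k: "k < n" "x k \<noteq> 0" and x: "bform n A x (\<lambda>_. 1) = 0"
    have "\<exists>l<n. x l \<noteq> x k"
    proof (rule ccontr)
      assume "\<not> ?thesis"
      then have "bform n A x (\<lambda>_. 1) = bform n A (\<lambda>l. x k * 1) (\<lambda>_. 1)"
        by (intro bform_cong) auto
      also have "\<dots> = x k * bform n A (\<lambda>_. 1) (\<lambda>_. 1)" by (rule bform_scale_left)
      finally show False using x pos k by simp
    qed
    with R k have "disc n A x < 0" by metis
    then show "bform n A x x < 0"
      using pos x by (simp add: disc_def mult_less_0_iff)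
  qed
qed

lemma weak_perp:
  assumes weak: "\<And>x. disc n A x \<le> 0" and x: "bform n A x (\<lambda>_. 1) = 0"
  shows "bform n A x x \<le> 0"
  using weak[of x] x pos by (simp add: disc_def mult_le_0_iff)

text \<open>The reversed Cauchy-Schwarz inequality. If the form were positive at \<open>x\<close> as
  well, it would be positive definite on the span of \<open>x\<close> and \<open>y\<close>, which
  meets the hyperplane orthogonal to the all-ones vector, where the form is nonpositive.\<close>

lemma weak_orthogonal_nonpos:
  assumes weak: "\<And>x. disc n A x \<le> 0" and y: "bform n A y y > 0" and xy: "bform n A x y = 0"
  shows "bform n A x x \<le> 0"
proof (rule ccontr)
  assume "\<not> ?thesis"
  then have xx: "bform n A x x > 0" by simp
  \<comment> \<open>With these coefficients the combination of \<open>x\<close> and \<open>y\<close>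
    is orthogonal to the all-ones vector. If both are zero, \<open>y\<close> already lies in that
    hyperplane.\<close>
  define a where "a = bform n A y (\<lambda>_. 1)"
  define b where "b = - bform n A x (\<lambda>_. 1)"
  show False
  proof (cases "a = 0 \<and> b = 0")
    case True
    then show False using weak_perp[OF weak, of y] y by (simp add: a_def)
  next
    case False
    have "bform n A (\<lambda>k. a * x k + b * y k) (\<lambda>_. 1) = 0"
      unfolding bform_linear by (simp add: a_def b_def)
    then have "bform n A (\<lambda>k. a * x k + b * y k) (\<lambda>k. a * x k + b * y k) \<le> 0"
      by (rule weak_perp[OF weak])
    also have "bform n A (\<lambda>k. a * x k + b * y k) (\<lambda>k. a * x k + b * y k) =
      a\<^sup>2 * bform n A x x + b\<^sup>2 * bform n A y y"
      using commute[of y x] xy by (simp add: bform_linear power2_eq_square)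
    finally have "a\<^sup>2 * bform n A x x + b\<^sup>2 * bform n A y y \<le> 0" .
    moreover have "a\<^sup>2 * bform n A x x \<ge> 0" "b\<^sup>2 * bform n A y y \<ge> 0" using xx y by simp_all
    ultimately have "a\<^sup>2 * bform n A x x = 0" "b\<^sup>2 * bform n A y y = 0" by linarith+
    with xx y False show False by simp
  qed
qed

text \<open>On the hyperplane orthogonal to the all-ones vector the form is nonpositive, so
  \<open>x\<close> is a maximiser there and the first-order condition applies. The all-ones
  direction is covered by the hypothesis on \<open>x\<close>.\<close>

lemma weak_isotropic_kernel:
  assumes weak: "\<And>x. disc n A x \<le> 0"
    and x: "bform n A x (\<lambda>_. 1) = 0" "bform n A x x = 0"
  shows "bform n A x y = 0"
proof -
  have perp: "bform n A x y = 0" if y: "bform n A y (\<lambda>_. 1) = 0" for y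
  proof (rule linear_quadratic_bound_imp_zero)
    fix t :: real
    have "bform n A (\<lambda>k. x k + t * y k) (\<lambda>_. 1) = 0"
      by (simp add: bform_linear x y)
    then have "bform n A (\<lambda>k. x k + t * y k) (\<lambda>k. x k + t * y k) \<le> 0"
      by (rule weak_perp[OF weak])
    also have "bform n A (\<lambda>k. x k + t * y k) (\<lambda>k. x k + t * y k) =
      2 * t * bform n A x y + t\<^sup>2 * bform n A y y"
      using commute[of y x] x by (simp add: bform_linear power2_eq_square algebra_simps)
    finally show "2 * t * bform n A x y \<le> t\<^sup>2 * (- bform n A y y)" by simp
  qed
  have "bform n A x (proj y) = 0" by (rule perp[OF proj_perp])
  moreover have "proj y = (\<lambda>k. y k + (- (bform n A y (\<lambda>_. 1) / bform n A (\<lambda>_. 1) (\<lambda>_. 1))) * 1)"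
    by (simp add: proj_def)
  ultimately show ?thesis using x(1) by (simp only: bform_linear)
qed

text \<open>A failure of strictness becomes a kernel vector, on which the derivative along the
  exclusion flow can be computed.\<close>

lemma weak_not_strict_kernel:
  assumes weak: "\<And>x. disc n A x \<le> 0"
    and x: "\<exists>k<n. \<exists>l<n. x k \<noteq> x l" "\<not> disc n A x < 0"
  obtains z where "\<exists>k<n. \<exists>l<n. z k \<noteq> z l" "\<And>y. bform n A z y = 0"
proof
  show "\<exists>k<n. \<exists>l<n. proj x k \<noteq> proj x l" using x(1) by (simp add: proj_def)
  have "disc n A x = 0" using weak[of x] x(2) by linarith
  then have "bform n A (proj x) (proj x) = 0" using pos by (simp add: disc_proj)
  then show "bform n A (proj x) y = 0" for y
    by (rule weak_isotropic_kernel[OF weak proj_perp])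
qed

end

text \<open>A compact set of representatives of the non-constant vectors modulo affine rescaling.\<close>

definition centred_sphere :: "nat \<Rightarrow> (nat \<Rightarrow> real) set" where
  "centred_sphere n = {x. (\<forall>k\<ge>n. x k = 0) \<and> (\<Sum>k<n. x k) = 0 \<and> (\<Sum>k<n. (x k)\<^sup>2) = 1}"

lemma compact_centred_sphere: "compact (centred_sphere n)"
proof -
  define B where "B = (\<lambda>k. if k < n then {-1..1::real} else {0})"
  have 1: "\<bar>x k\<bar> \<le> 1" if "(\<Sum>k<n. (x k)\<^sup>2) = 1" "k < n" for x :: "nat \<Rightarrow> real" and k
  proof -
    have "(x k)\<^sup>2 \<le> (\<Sum>k<n. (x k)\<^sup>2)" by (rule member_le_sum) (use that in auto)
    with that show ?thesis by (simp add: abs_square_le_1)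
  qed
  have "centred_sphere n = {x. \<forall>k. x k \<in> B k} \<inter> ({x. (\<Sum>k<n. x k) = 0} \<inter> {x. (\<Sum>k<n. (x k)\<^sup>2) = 1})"
    using 1 by (auto simp: centred_sphere_def B_def abs_le_iff minus_le_iff split: if_splits)
  also have "compact \<dots>"
    by (intro compact_Int_closed compact_box_fun closed_Int closed_Collect_eq continuous_intros)
       (auto simp: B_def)
  finally show ?thesis .
qed

text \<open>Centring and normalising a non-constant vector multiplies \<open>disc\<close> by a
  positive factor. Testing on a compact set is what makes strictness an open condition.\<close>

lemma (in sym_form) nonconst_iff_centred_sphere:
  "(\<forall>x. (\<exists>k<n. \<exists>l<n. x k \<noteq> x l) \<longrightarrow> disc n A x < 0) \<longleftrightarrow> (\<forall>x\<in>centred_sphere n. disc n A x < 0)"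
  (is "?L \<longleftrightarrow> ?R")
proof
  assume L: ?L
  show ?R
  proof
    fix x assume x: "x \<in> centred_sphere n"
    have "\<exists>k<n. \<exists>l<n. x k \<noteq> x l"
    proof (rule ccontr)
      assume *: "\<not> ?thesis"
      have "n \<noteq> 0" using x by (intro notI) (simp add: centred_sphere_def)
      then have "0 < n" by simp
      have const: "x k = x 0" if "k < n" for k
      proof (rule ccontr)
        assume "x k \<noteq> x 0"
        with that \<open>0 < n\<close> have "\<exists>k<n. \<exists>l<n. x k \<noteq> x l" by (intro exI[of _ k] exI[of _ 0] conjI)
        with * show False by contradiction
      qed
      have eq: "(\<Sum>k<n. g (x k)) = n * g (x 0)" for g :: "real \<Rightarrow> real"
      proof -
        have "g (x k) = g (x 0)" if "k \<in> {..<n}" for k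
          by (rule arg_cong[of _ _ g], rule const) (use that in simp)
        then have "(\<Sum>k<n. g (x k)) = (\<Sum>k<n. g (x 0))" by (rule sum.cong[OF refl])
        then show ?thesis by simp
      qed
      from eq[of "\<lambda>y. y"] x \<open>n \<noteq> 0\<close> have "x 0 = 0" by (simp add: centred_sphere_def)
      then have "(\<Sum>k<n. (x k)\<^sup>2) = 0" using eq[of "\<lambda>y. y\<^sup>2"] by simp
      with x show False by (simp add: centred_sphere_def)
    qed
    with L show "disc n A x < 0" by blast
  qed
next
  assume R: ?R
  show ?L
  proof (intro allI impI)
    fix x :: "nat \<Rightarrow> real" assume "\<exists>k<n. \<exists>l<n. x k \<noteq> x l"
    then obtain k l where kl: "k < n" "l < n" "x k \<noteq> x l" by blast
    define c where "c = - (\<Sum>k<n. x k) / n"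
    define S where "S = (\<Sum>k<n. (x k + c)\<^sup>2)"
    \<comment> \<open>Members of \<open>centred_sphere\<close> vanish from index \<open>n\<close>
      on, so the affine image of \<open>x\<close> is cut off there; \<open>disc\<close> does not see
      these entries.\<close>
    define y where "y = (\<lambda>k. if k < n then (1 / sqrt S) * x k + c / sqrt S else 0)"
    have "x k + c \<noteq> 0 \<or> x l + c \<noteq> 0" using kl by auto
    then have "\<exists>k<n. x k + c \<noteq> 0" using kl by blast
    then obtain i where "i < n" "x i + c \<noteq> 0" by blast
    then have S: "S > 0" unfolding S_def by (intro sum_pos2[of _ i]) auto
    have y_eq: "y k = (x k + c) / sqrt S" if "k < n" for k
      using that by (simp add: y_def add_divide_distrib)
    have "(\<Sum>k<n. y k) = (\<Sum>k<n. x k + c) / sqrt S"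
      by (simp add: y_eq sum_divide_distrib)
    also have "(\<Sum>k<n. x k + c) = 0" using kl by (simp add: sum.distrib) (simp add: c_def)
    finally have "(\<Sum>k<n. y k) = 0" by simp
    moreover have "(\<Sum>k<n. (y k)\<^sup>2) = S / S"
      using S by (simp add: y_eq power_divide S_def sum_divide_distrib[symmetric])
    ultimately have "y \<in> centred_sphere n"
      using S by (auto simp: centred_sphere_def y_def)
    with R have "disc n A y < 0" by blast
    also have "disc n A y = disc n A (\<lambda>k. (1 / sqrt S) * x k + c / sqrt S)"
      unfolding disc_def by (intro arg_cong2[of _ _ _ _ "(-)"] arg_cong2[of _ _ _ _ "(*)"]
        arg_cong[of _ _ "\<lambda>x. x\<^sup>2"] bform_cong refl) (auto simp: y_def)
    also have "\<dots> = (1 / sqrt S)\<^sup>2 * disc n A x" by (rule disc_affine)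
    finally show "disc n A x < 0" using S by (simp add: mult_less_0_iff divide_less_0_iff power_divide)
  qed
qed

section \<open>Derivatives and coefficients of polynomials\<close>

definition evar :: "nat \<Rightarrow> expvec" where
  "evar i = Poly_Mapping.single i 1"

lemma lookup_evar: "Poly_Mapping.lookup (evar i) j = (if i = j then 1 else 0)"
  by (simp add: evar_def lookup_single when_def)

lemma monoms_iff:
  "m \<in> monoms n d \<longleftrightarrow> Poly_Mapping.keys m \<subseteq> {..<n} \<and> (\<Sum>i<n. Poly_Mapping.lookup m i) = d"
  by (auto simp: monoms_def mdeg_alt)

lemma monoms_add: "a \<in> monoms n d \<Longrightarrow> b \<in> monoms n d' \<Longrightarrow> a + b \<in> monoms n (d + d')"
  using Poly_Mapping.keys_add[of a b] by (auto simp: monoms_iff lookup_add sum.distrib)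

lemma evar_in_monoms: "i < n \<Longrightarrow> evar i \<in> monoms n 1"
  by (auto simp: monoms_iff lookup_evar in_keys_iff split: if_splits)

lemma monoms_add_evar: "a \<in> monoms n d \<Longrightarrow> i < n \<Longrightarrow> a + evar i \<in> monoms n (Suc d)"
  using monoms_add[OF _ evar_in_monoms] by fastforce

lemma evar_cancel: "Poly_Mapping.lookup m i > 0 \<Longrightarrow> m - evar i + evar i = m"
  by (intro poly_mapping_eqI) (auto simp: lookup_add lookup_minus lookup_evar)

lemma monoms_diff_evar:
  assumes "m \<in> monoms n (Suc d)" "Poly_Mapping.lookup m i > 0"
  shows "m - evar i \<in> monoms n d"
proof -
  have "i < n" using assms by (auto simp: monoms_iff in_keys_iff subset_iff)
  have "(\<Sum>j<n. Poly_Mapping.lookup m j) = (\<Sum>j<n. Poly_Mapping.lookup (m - evar i) j) + 1"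
    by (subst evar_cancel[OF assms(2), symmetric])
       (use \<open>i < n\<close> in \<open>simp add: lookup_add sum.distrib lookup_evar\<close>)
  moreover have "Poly_Mapping.keys (m - evar i) \<subseteq> Poly_Mapping.keys m"
    by (auto simp: in_keys_iff lookup_minus)
  ultimately show ?thesis using assms(1) by (auto simp: monoms_iff)
qed

lemma monoms_Suc_has_var:
  assumes "m \<in> monoms n (Suc d)"
  obtains i where "i < n" "Poly_Mapping.lookup m i > 0"
proof -
  have "\<exists>i<n. Poly_Mapping.lookup m i > 0"
  proof (rule ccontr)
    assume "\<not> ?thesis"
    then have "(\<Sum>i<n. Poly_Mapping.lookup m i) = 0" by simp
    with assms show False by (simp add: monoms_iff)
  qed
  with that show ?thesis by blast
qed

definition lexp :: "nat list \<Rightarrow> expvec" where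
  "lexp is = (\<Sum>i\<leftarrow>is. evar i)"

text \<open>Strictly Lorentzian polynomials are defined through lists of derivatives; this replaces
  the lists by exponent vectors. A list for \<open>m\<close> is found by removing one variable at a
  time.\<close>

lemma monoms_eq_lexp:
  "monoms n d = lexp ` {is. length is = d \<and> set is \<subseteq> {..<n}}"
proof (intro equalityI subsetI)
  fix m assume "m \<in> monoms n d"
  then show "m \<in> lexp ` {is. length is = d \<and> set is \<subseteq> {..<n}}"
  proof (induction d arbitrary: m)
    case 0
    then have "\<forall>k\<in>Poly_Mapping.keys m. Poly_Mapping.lookup m k = 0" by (simp add: monoms_def mdeg_def)
    then have "m = 0" by (intro poly_mapping_eqI) (metis in_keys_iff lookup_zero)
    then show ?case by (auto simp: lexp_def)
  next
    case (Suc d)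
    obtain i where i: "i < n" "Poly_Mapping.lookup m i > 0" using monoms_Suc_has_var[OF Suc.prems] .
    from Suc.IH[OF monoms_diff_evar[OF Suc.prems i(2)]] obtain "is" where
      "is": "m - evar i = lexp is" "length is = d" "set is \<subseteq> {..<n}" by auto
    have "m = lexp (i # is)"
      using evar_cancel[OF i(2)] "is"(1) by (simp add: lexp_def add.commute)
    then show ?case using i "is" by (intro image_eqI[of _ _ "i # is"]) auto
  qed
next
  fix m assume "m \<in> lexp ` {is. length is = d \<and> set is \<subseteq> {..<n}}"
  then obtain "is" where "m = lexp is" "length is = d" "set is \<subseteq> {..<n}" by auto
  then show "m \<in> monoms n d"
  proof (induction "is" arbitrary: m d)
    case Nil
    then show ?case by (simp add: lexp_def monoms_iff)
  next
    case (Cons i "is")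
    then have "lexp is \<in> monoms n (length is)" by simp
    from monoms_add_evar[OF this, of i] Cons.prems show ?case
      by (auto simp: lexp_def add.commute)
  qed
qed

section \<open>Factorial normalisation of coefficients, and Hessians\<close>

definition mfact :: "nat \<Rightarrow> expvec \<Rightarrow> real" where
  "mfact n m = (\<Prod>i<n. fact (Poly_Mapping.lookup m i))"

lemma mfact_pos: "mfact n m > 0"
  unfolding mfact_def by (rule prod_pos) simp

lemma prod_update_evar:
  fixes g :: "nat \<Rightarrow> nat \<Rightarrow> real"
  assumes "i < n" "\<And>k. g i (Suc k) = c k * g i k"
  shows "(\<Prod>j<n. g j (Poly_Mapping.lookup (m + evar i) j)) =
    c (Poly_Mapping.lookup m i) * (\<Prod>j<n. g j (Poly_Mapping.lookup m j))"
  using assms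
  by (subst (1 2) prod.remove[of _ i]) (auto simp: lookup_add lookup_evar intro!: prod.cong)

lemma mfact_add_evar:
  "i < n \<Longrightarrow> mfact n (m + evar i) = real (Poly_Mapping.lookup m i + 1) * mfact n m"
  unfolding mfact_def by (rule prod_update_evar) auto

text \<open>For \<open>f\<close> homogeneous of the degree of \<open>m\<close>, this is the constant
  obtained by differentiating \<open>f\<close> according to \<open>m\<close>. In this normalisation
  differentiation is a mere shift of the index.\<close>

definition pcoef :: "nat \<Rightarrow> real_mpoly \<Rightarrow> expvec \<Rightarrow> real" where
  "pcoef n f m = mfact n m * Poly_Mapping.lookup f m"

lemma pcoef_mpdiff: "i < n \<Longrightarrow> pcoef n (mpdiff i f) m = pcoef n f (m + evar i)"
  unfolding pcoef_def lookup_mpdiff evar_def[symmetric] by (simp add: mfact_add_evar)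

lemma pcoef_foldr_mpdiff:
  "set is \<subseteq> {..<n} \<Longrightarrow> pcoef n (foldr mpdiff is f) m = pcoef n f (m + lexp is)"
  by (induction "is" arbitrary: m) (auto simp: lexp_def pcoef_mpdiff add_ac)

definition hess :: "(expvec \<Rightarrow> real) \<Rightarrow> expvec \<Rightarrow> nat \<Rightarrow> nat \<Rightarrow> real" where
  "hess p I k l = p (I + evar k + evar l)"

lemma hess_commute: "hess p I k l = hess p I l k"
  by (simp add: hess_def add_ac)

text \<open>The symmetric matrix of a quadratic form is half its Hessian: on the diagonal the
  factorial is 2, and off the diagonal \<open>qf_mat\<close> halves the coefficient.\<close>

lemma qf_mat_foldr_mpdiff:
  assumes "set is \<subseteq> {..<n}"
  shows "qf_mat n (foldr mpdiff is f) =
    Matrix.mat n n (\<lambda>(i, j). 1 / 2 * hess (pcoef n f) (lexp is) i j)"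
  unfolding qf_mat_def evar_def[symmetric]
proof (rule cong_mat)
  fix i j assume ij: "i < n" "j < n"
  have "mfact n (0 :: expvec) = 1" by (simp add: mfact_def)
  then have "mfact n (evar i + evar j) = (if i = j then 2 else 1)"
    using mfact_add_evar[OF ij(2), of "evar i"] mfact_add_evar[OF ij(1), of 0]
    by (simp add: lookup_evar)
  moreover have "hess (pcoef n f) (lexp is) i j = pcoef n (foldr mpdiff is f) (evar i + evar j)"
    using assms by (simp add: hess_def pcoef_foldr_mpdiff add_ac)
  ultimately show "(case (i, j) of (i, j) \<Rightarrow>
      Poly_Mapping.lookup (foldr mpdiff is f) (evar i + evar j) * (if i = j then 1 else 1 / 2)) =
    (case (i, j) of (i, j) \<Rightarrow> 1 / 2 * hess (pcoef n f) (lexp is) i j)"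
    by (simp add: pcoef_def)
qed simp_all

text \<open>A closed condition implied by \<open>strict_lor\<close>. No claim is made that it
  describes exactly the limits of strict points; it only has to persist in limits and to feed the
  derivative argument.\<close>

definition weak_lor :: "nat \<Rightarrow> nat \<Rightarrow> (expvec \<Rightarrow> real) \<Rightarrow> bool" where
  "weak_lor n d p \<longleftrightarrow> (\<forall>m\<in>monoms n d. p m \<ge> 0) \<and>
     (d \<ge> 2 \<longrightarrow> (\<forall>I\<in>monoms n (d - 2). \<forall>x. disc n (hess p I) x \<le> 0))"

definition strict_lor :: "nat \<Rightarrow> nat \<Rightarrow> (expvec \<Rightarrow> real) \<Rightarrow> bool" where
  "strict_lor n d p \<longleftrightarrow> (\<forall>m\<in>monoms n d. p m > 0) \<and>
     (d \<ge> 2 \<longrightarrow> (\<forall>I\<in>monoms n (d - 2). \<forall>x\<in>centred_sphere n. disc n (hess p I) x < 0))"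

lemma hess_in_monoms:
  assumes "I \<in> monoms n (d - 2)" "d \<ge> 2" "k < n" "l < n"
  shows "I + evar k + evar l \<in> monoms n d"
  using monoms_add_evar[OF monoms_add_evar[OF assms(1) assms(3)] assms(4)] assms(2) by (simp add: numeral_2_eq_2 Suc_diff_Suc)

lemma sym_form_hess:
  assumes "n \<ge> 1" "I \<in> monoms n (d - 2)" "d \<ge> 2" "\<forall>m\<in>monoms n d. p m > 0"
  shows "sym_form n (hess p I)"
proof
  show "bform n (hess p I) (\<lambda>_. 1) (\<lambda>_. 1) > 0"
    unfolding bform_def
    by (intro sum_pos) (use assms hess_in_monoms[OF assms(2,3)] in \<open>auto simp: hess_def lessThan_empty_iff\<close>)
qed (rule hess_commute)

text \<open>Positive coefficients make every Hessian form positive at the all-ones vector, so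
  \<open>one_positive_eigenvalue_iff\<close> applies with that vector and the signature becomes a
  sign of \<open>disc\<close>.\<close>

lemma strictly_lorentzian_iff:
  assumes "n \<ge> 1"
  shows "strictly_lorentzian n d f \<longleftrightarrow> f \<in> Hpoly n d \<and> strict_lor n d (pcoef n f)"
proof -
  let ?p = "pcoef n f"
  have pcoef_pos: "Poly_Mapping.lookup f m > 0 \<longleftrightarrow> ?p m > 0" for m
    using mfact_pos[of n m] by (simp add: pcoef_def zero_less_mult_iff)
  have key: "lorentz_signature n (foldr mpdiff is f) \<longleftrightarrow>
      (\<forall>x\<in>centred_sphere n. disc n (hess ?p (lexp is)) x < 0)"
    if d: "d \<ge> 2" and p: "\<forall>m\<in>monoms n d. ?p m > 0" and "is": "length is = d - 2" "set is \<subseteq> {..<n}" for "is"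
  proof -
    define A where "A = hess ?p (lexp is)"
    have "lexp is \<in> monoms n (d - 2)" using "is" by (auto simp: monoms_eq_lexp)
    then interpret sym_form n A
      unfolding A_def by (intro sym_form_hess[OF assms _ d p])
    have half: "bform n (\<lambda>k l. 1 / 2 * A k l) (\<lambda>_. 1) (\<lambda>_. 1) > 0"
      unfolding bform_scale_matrix using pos by simp
    have "lorentz_signature n (foldr mpdiff is f) \<longleftrightarrow>
      (\<forall>x. (\<exists>k<n. x k \<noteq> 0) \<and> bform n (\<lambda>k l. 1 / 2 * A k l) x (\<lambda>_. 1) = 0 \<longrightarrow>
         bform n (\<lambda>k l. 1 / 2 * A k l) x x < 0)"
      unfolding lorentz_signature_def qf_mat_foldr_mpdiff[OF "is"(2)] A_def[symmetric]
      by (rule one_positive_eigenvalue_iff[OF _ half]) (simp add: sym)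
    also have "\<dots> \<longleftrightarrow> (\<forall>x. (\<exists>k<n. x k \<noteq> 0) \<and> bform n A x (\<lambda>_. 1) = 0 \<longrightarrow> bform n A x x < 0)"
      unfolding bform_scale_matrix by simp
    also have "\<dots> \<longleftrightarrow> (\<forall>x\<in>centred_sphere n. disc n A x < 0)"
      unfolding perp_iff_nonconst by (rule nonconst_iff_centred_sphere)
    finally show ?thesis by (simp add: A_def)
  qed
  show ?thesis
    unfolding strictly_lorentzian_def strict_lor_def pcoef_pos monoms_eq_lexp[of n "d - 2"]
    using key by auto
qed

section \<open>The exclusion generator on kernels of Hessians\<close>

text \<open>A particle jumps from site \<open>i\<close> to site \<open>j\<close>. If site
  \<open>i\<close> is empty, truncated subtraction yields \<open>m + evar j\<close>, of the wrong
  degree; the generator multiplies this case by the occupation number 0.\<close>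

definition hop :: "expvec \<Rightarrow> nat \<Rightarrow> nat \<Rightarrow> expvec" where
  "hop m i j = m - evar i + evar j"

lemma lookup_hop:
  "Poly_Mapping.lookup (hop m i j) k =
    Poly_Mapping.lookup m k - (if i = k then 1 else 0) + (if j = k then 1 else 0)"
  by (simp add: hop_def lookup_add lookup_minus lookup_evar)

lemma hop_in_monoms:
  assumes "m \<in> monoms n d" "Poly_Mapping.lookup m i > 0" "j < n"
  shows "hop m i j \<in> monoms n d"
proof (cases d)
  case 0
  have "i < n" using assms by (auto simp: monoms_iff in_keys_iff subset_iff)
  then have "Poly_Mapping.lookup m i = 0" using assms(1) 0 by (simp add: monoms_iff)
  then show ?thesis using assms(2) by simp
next
  case (Suc e)
  then show ?thesis
    unfolding hop_def using assms monoms_add_evar[OF monoms_diff_evar] by blast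
qed

text \<open>The action of the exclusion generator on the numbers \<open>p m = \<partial>\<^sup>m f\<close>.\<close>

definition flux :: "nat \<Rightarrow> (expvec \<Rightarrow> real) \<Rightarrow> nat \<Rightarrow> nat \<Rightarrow> expvec \<Rightarrow> real" where
  "flux d p i j m =
     real (Poly_Mapping.lookup m i) * (real d - real (Poly_Mapping.lookup m i) + 1) * p (hop m i j) -
     real (Poly_Mapping.lookup m i) * (real d - real (Poly_Mapping.lookup m j)) * p m"

definition exclusion_gen :: "nat \<Rightarrow> nat \<Rightarrow> (expvec \<Rightarrow> real) \<Rightarrow> expvec \<Rightarrow> real" where
  "exclusion_gen n d p m = (\<Sum>i<n. \<Sum>j<n. if i = j then 0 else flux d p i j m)"

definition kron :: "nat \<Rightarrow> nat \<Rightarrow> real" where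
  "kron i k = (if i = k then 1 else 0)"

text \<open>The Hessian of the flux is sorted into multiples of full Hessians, terms confined to one
  row or column, and single entries. On a kernel vector of \<open>hess p I\<close> the row and
  column terms will vanish.\<close>

lemma flux_expand:
  fixes I :: expvec
  assumes ij: "i \<noteq> j"
  shows "flux d p i j (I + evar k + evar l) =
    real (Poly_Mapping.lookup I i) * (real d - real (Poly_Mapping.lookup I i) + 1) * hess p (hop I i j) k l
    + kron i k * ((real d - 2 * real (Poly_Mapping.lookup I i)) * hess p I j l)
    + kron i l * ((real d - 2 * real (Poly_Mapping.lookup I i)) * hess p I j k)
    - 2 * (kron i k * kron i l * hess p I i j)
    - (real (Poly_Mapping.lookup I i) * (real d - real (Poly_Mapping.lookup I j)) * hess p I k l
       + kron i k * ((real d - real (Poly_Mapping.lookup I j)) * hess p I i l)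
       + kron i l * ((real d - real (Poly_Mapping.lookup I j)) * hess p I i k)
       - kron j k * (real (Poly_Mapping.lookup I i) * hess p I j l)
       - kron j l * (real (Poly_Mapping.lookup I i) * hess p I j k)
       - kron i k * kron j l * hess p I i j - kron j k * kron i l * hess p I i j)"
proof -
  let ?r = "real (Poly_Mapping.lookup I i)"
  let ?m = "I + evar k + evar l"
  have li: "real (Poly_Mapping.lookup ?m a) = real (Poly_Mapping.lookup I a) + kron a k + kron a l" for a
    by (auto simp: kron_def lookup_add lookup_evar)
  \<comment> \<open>An occupied site \<open>i\<close> is needed here, whereas in \<open>hop2\<close>
    and \<open>hop3\<close> the added \<open>evar k\<close> or \<open>evar l\<close> occupies
    it.\<close>
  have hop1: "p (hop ?m i j) = hess p (hop I i j) k l" if "Poly_Mapping.lookup I i > 0"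
    unfolding hess_def
    by (rule arg_cong[of _ _ p], rule poly_mapping_eqI)
       (use that ij in \<open>auto simp: lookup_hop lookup_add lookup_evar\<close>)
  have hop2: "p (hop ?m i j) = hess p I j l" if "k = i"
    unfolding hess_def
    by (rule arg_cong[of _ _ p], rule poly_mapping_eqI)
       (use that ij in \<open>auto simp: lookup_hop lookup_add lookup_evar\<close>)
  have hop3: "p (hop ?m i j) = hess p I j k" if "l = i"
    unfolding hess_def
    by (rule arg_cong[of _ _ p], rule poly_mapping_eqI)
       (use that ij in \<open>auto simp: lookup_hop lookup_add lookup_evar\<close>)
  \<comment> \<open>The quadratic \<open>r (d - r + 1)\<close> has first difference
    \<open>d - 2 r\<close> and second difference \<open>-2\<close>; these give the three correction
    terms for \<open>k = i\<close> and \<open>l = i\<close>.\<close>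
  have A: "(?r + kron i k + kron i l) * (real d - (?r + kron i k + kron i l) + 1) * p (hop ?m i j) =
    ?r * (real d - ?r + 1) * hess p (hop I i j) k l
    + kron i k * ((real d - 2 * ?r) * hess p I j l)
    + kron i l * ((real d - 2 * ?r) * hess p I j k)
    - 2 * (kron i k * kron i l * hess p I i j)"
  proof -
    consider "k \<noteq> i" "l \<noteq> i" | "k = i" "l \<noteq> i" | "k \<noteq> i" "l = i" | "k = i" "l = i" by blast
    then show ?thesis
    proof cases
      case 1
      then show ?thesis using hop1 by (cases "Poly_Mapping.lookup I i = 0") (auto simp: kron_def)
    next
      case 2
      have "?r * hess p (hop I i j) k l = ?r * hess p I j l"
        using hop1 hop2[OF 2(1)] by (cases "Poly_Mapping.lookup I i = 0") auto
      then have *: "?r * (real d - ?r + 1) * hess p (hop I i j) k l = (real d - ?r + 1) * (?r * hess p I j l)"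
        by (subst \<open>_ = ?r * hess p I j l\<close>[symmetric]) simp
      show ?thesis unfolding * hop2[OF 2(1)] using 2 by (simp add: kron_def algebra_simps)
    next
      case 3
      have "?r * hess p (hop I i j) k l = ?r * hess p I j k"
        using hop1 hop3[OF 3(2)] by (cases "Poly_Mapping.lookup I i = 0") auto
      then have *: "?r * (real d - ?r + 1) * hess p (hop I i j) k l = (real d - ?r + 1) * (?r * hess p I j k)"
        by (subst \<open>_ = ?r * hess p I j k\<close>[symmetric]) simp
      show ?thesis unfolding * hop3[OF 3(2)] using 3 by (simp add: kron_def algebra_simps)
    next
      case 4
      have "?r * hess p (hop I i j) k l = ?r * hess p I j k"
        using hop1 hop3[OF 4(2)] by (cases "Poly_Mapping.lookup I i = 0") auto
      then have *: "?r * (real d - ?r + 1) * hess p (hop I i j) k l = (real d - ?r + 1) * (?r * hess p I j k)"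
        by (subst \<open>_ = ?r * hess p I j k\<close>[symmetric]) simp
      show ?thesis unfolding * hop3[OF 4(2)] using 4
        by (simp add: kron_def algebra_simps hess_commute[of p I j i])
    qed
  qed
  have sq: "hess p I k l * (kron i k * kron j l) = kron i k * kron j l * hess p I i j"
    "hess p I k l * (kron j k * kron i l) = kron j k * kron i l * hess p I i j"
    "kron i k * hess p I k l = kron i k * hess p I i l" "kron i l * hess p I k l = kron i l * hess p I i k"
    "kron j k * hess p I k l = kron j k * hess p I j l" "kron j l * hess p I k l = kron j l * hess p I j k"
    "kron i k * kron j k = 0" "kron i l * kron j l = 0"
    using ij by (auto simp: kron_def hess_commute)
  have "(?r + kron i k + kron i l) * (real d - (real (Poly_Mapping.lookup I j) + kron j k + kron j l)) * hess p I k l =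
      ?r * (real d - real (Poly_Mapping.lookup I j)) * hess p I k l
      + (kron i k * hess p I k l) * (real d - real (Poly_Mapping.lookup I j))
      + (kron i l * hess p I k l) * (real d - real (Poly_Mapping.lookup I j))
      - (kron j k * hess p I k l) * ?r - (kron j l * hess p I k l) * ?r
      - hess p I k l * (kron i k * kron j l) - hess p I k l * (kron j k * kron i l)
      - (kron i k * kron j k) * hess p I k l - (kron i l * kron j l) * hess p I k l"
    by (simp add: algebra_simps)
  note B = this[unfolded sq]
  show ?thesis
    unfolding flux_def li A hess_def[of p I k l, symmetric] B by (simp add: algebra_simps)
qed

lemma quadratic_sum_delta:
  fixes x :: "nat \<Rightarrow> real"
  assumes "i < n" "j < n"
  shows "(\<Sum>k<n. \<Sum>l<n. kron i k * F l * x k * x l) = x i * (\<Sum>l<n. F l * x l)"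
    and "(\<Sum>k<n. \<Sum>l<n. kron i l * F k * x k * x l) = x i * (\<Sum>l<n. F l * x l)"
    and "(\<Sum>k<n. \<Sum>l<n. kron i k * kron j l * c * x k * x l) = x i * x j * c"
proof -
  show 1: "(\<Sum>k<n. \<Sum>l<n. kron i k * F l * x k * x l) = x i * (\<Sum>l<n. F l * x l)" for F
  proof -
    have "(\<Sum>k<n. \<Sum>l<n. kron i k * F l * x k * x l) = (\<Sum>k<n. if i = k then x k * (\<Sum>l<n. F l * x l) else 0)"
      by (intro sum.cong refl) (auto simp: kron_def sum_distrib_left mult_ac)
    then show ?thesis using assms by simp
  qed
  show "(\<Sum>k<n. \<Sum>l<n. kron i l * F k * x k * x l) = x i * (\<Sum>l<n. F l * x l)"
    by (subst sum.swap) (use 1[of F] in \<open>simp add: mult_ac\<close>)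
  have "(\<Sum>l<n. kron j l * c * x l) = (\<Sum>l<n. if j = l then c * x l else 0)"
    by (intro sum.cong) (auto simp: kron_def)
  then have "(\<Sum>l<n. kron j l * c * x l) = c * x j" using assms by simp
  with 1[of "\<lambda>l. kron j l * c"] show "(\<Sum>k<n. \<Sum>l<n. kron i k * kron j l * c * x k * x l) = x i * x j * c"
    by (simp add: mult_ac)
qed

text \<open>In \<open>flux_expand\<close> every row or column term contains a row of
  \<open>hess p I\<close> applied to \<open>x\<close>. Only the form at \<open>hop I i j\<close> and
  the single entries survive.\<close>

lemma flux_form_on_kernel:
  fixes x :: "nat \<Rightarrow> real"
  assumes ij: "i \<noteq> j" "i < n" "j < n"
    and ker: "\<And>k. k < n \<Longrightarrow> (\<Sum>l<n. hess p I k l * x l) = 0"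
  shows "bform n (hess (flux d p i j) I) x x =
    real (Poly_Mapping.lookup I i) * (real d - real (Poly_Mapping.lookup I i) + 1) *
      bform n (hess p (hop I i j)) x x
    - 2 * (x i * x i * hess p I i j) + 2 * (x i * x j * hess p I i j)"
proof -
  define S where "S F = (\<Sum>k<n. \<Sum>l<n. F k l * x k * x l)" for F
  have S_add: "S (\<lambda>k l. F k l + G k l) = S F + S G" for F G
    by (simp add: S_def distrib_right sum.distrib)
  have S_diff: "S (\<lambda>k l. F k l - G k l) = S F - S G" for F G
    by (simp add: S_def left_diff_distrib sum_subtractf)
  have S_scale: "S (\<lambda>k l. c * F k l) = c * S F" for c F
    by (simp add: S_def sum_distrib_left mult_ac)
  have ker': "(\<Sum>l<n. c * hess p I k l * x l) = 0" if "k < n" for c k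
    using ker[OF that] by (simp add: mult.assoc sum_distrib_left[symmetric])
  have Skl: "S (\<lambda>k l. hess p I k l) = 0"
    using ker by (simp add: S_def mult.commute[of _ "x _"] mult.left_commute sum_distrib_left[symmetric])
  have row1: "S (\<lambda>k l. kron a k * (c * hess p I b l)) = 0" if "a < n" "b < n" for a b c
    using quadratic_sum_delta(1)[of a n a "\<lambda>l. c * hess p I b l" x] ker'[OF that(2)] that
    by (simp add: S_def kron_def)
  have row2: "S (\<lambda>k l. kron a l * (c * hess p I b k)) = 0" if "a < n" "b < n" for a b c
    using quadratic_sum_delta(2)[of a n a "\<lambda>l. c * hess p I b l" x] ker'[OF that(2)] that
    by (simp add: S_def kron_def)
  have pt: "S (\<lambda>k l. kron a k * kron b l * c) = x a * x b * c" if "a < n" "b < n" for a b c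
    using quadratic_sum_delta(3)[of a n b c x] that by (simp add: S_def kron_def)
  have "bform n (hess (flux d p i j) I) x x = S (\<lambda>k l. flux d p i j (I + evar k + evar l))"
    by (simp add: S_def bform_def hess_def)
  also have "\<dots> = real (Poly_Mapping.lookup I i) * (real d - real (Poly_Mapping.lookup I i) + 1) *
      S (hess p (hop I i j))
    - 2 * (x i * x i * hess p I i j) + (x i * x j * hess p I i j + x j * x i * hess p I i j)"
    unfolding flux_expand[OF ij(1)] S_add S_diff S_scale
    using ij by (simp add: row1 row2 pt Skl)
  finally show ?thesis by (simp add: S_def bform_def mult_ac)
qed

text \<open>The forms at \<open>hop I i j\<close> are nonpositive at \<open>x\<close> by
  \<open>weak_orthogonal_nonpos\<close>. Symmetrising the single entries over \<open>i\<close> and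
  \<open>j\<close> leaves minus a sum of squares with positive coefficients, non-zero because
  \<open>x\<close> is not constant.\<close>

theorem exclusion_derivative_negative_on_kernel:
  fixes x :: "nat \<Rightarrow> real"
  assumes n: "n \<ge> 1" and d: "d \<ge> 2"
    and pos: "\<forall>m\<in>monoms n d. p m > 0"
    and weak: "\<forall>I\<in>monoms n (d - 2). \<forall>x. disc n (hess p I) x \<le> 0"
    and I: "I \<in> monoms n (d - 2)"
    and nonconst: "\<exists>k<n. \<exists>l<n. x k \<noteq> x l"
    and kernel: "\<And>y. bform n (hess p I) x y = 0"
  shows "bform n (hess (exclusion_gen n d p) I) x x < 0"
proof -
  have row: "(\<Sum>l<n. hess p I k l * x l) = 0" if "k < n" for k
  proof -
    have "bform n (hess p I) x (\<lambda>l. if l = k then 1 else 0) = bform n (hess p I) (\<lambda>l. if l = k then 1 else 0) x"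
      by (rule bform_commute) (rule hess_commute)
    also have "\<dots> = (\<Sum>l<n. hess p I k l * x l)"
      unfolding bform_eq_sum using that by (simp add: if_distrib[of "\<lambda>x. x * _"] cong: if_cong)
    finally show ?thesis using kernel by simp
  qed
  have P: "hess p I i j > 0" if "i < n" "j < n" for i j
    using pos hess_in_monoms[OF I d that] by (simp add: hess_def)
  have nonpos: "real (Poly_Mapping.lookup I i) * (real d - real (Poly_Mapping.lookup I i) + 1) *
      bform n (hess p (hop I i j)) x x \<le> 0" if ij: "i < n" "j < n" for i j
  proof (cases "Poly_Mapping.lookup I i = 0")
    case True
    then show ?thesis by simp
  next
    case False
    define J where "J = hop I i j"
    have J: "J \<in> monoms n (d - 2)" unfolding J_def using I ij False by (intro hop_in_monoms) auto
    interpret sym_form n "hess p J" by (rule sym_form_hess[OF n J d pos])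
    \<comment> \<open>The \<open>i\<close>-th unit vector. Since
      \<open>J + evar i = I + evar j\<close>, pairing it with \<open>x\<close> under
      \<open>hess p J\<close> gives row \<open>j\<close> of \<open>hess p I\<close> applied to
      \<open>x\<close>, which is zero.\<close>
    define y where "y = (\<lambda>l. if l = i then 1 else (0::real))"
    have JI: "hess p J k i = hess p I k j" for k
      unfolding hess_def J_def
      by (rule arg_cong[of _ _ p], rule poly_mapping_eqI)
         (use False in \<open>auto simp: lookup_hop lookup_add lookup_evar\<close>)
    have hy: "(\<Sum>l<n. hess p J k l * y l) = hess p J k i" for k
      unfolding y_def using ij(1) by (simp add: if_distrib[of "\<lambda>x. _ * x"] cong: if_cong)
    have "bform n (hess p J) x y = (\<Sum>k<n. x k * hess p I k j)"
      unfolding bform_eq_sum hy JI ..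
    also have "\<dots> = 0" using row[OF ij(2)] by (simp add: hess_commute[of p I _ j] mult.commute)
    finally have xy: "bform n (hess p J) x y = 0" .
    have "bform n (hess p J) y y = hess p J i i"
      unfolding bform_eq_sum hy unfolding y_def using ij(1)
      by (simp add: if_distrib[of "\<lambda>x. x * _"] cong: if_cong)
    also have "\<dots> > 0" using P[OF ij] by (simp add: JI)
    finally have "bform n (hess p J) x x \<le> 0"
      using weak J xy by (intro weak_orthogonal_nonpos) auto
    moreover have "Poly_Mapping.lookup I i \<le> d"
      using member_le_sum[of i "{..<n}" "Poly_Mapping.lookup I"] I ij by (auto simp: monoms_iff)
    ultimately show ?thesis unfolding J_def by (intro mult_nonneg_nonpos mult_nonneg_nonneg) auto
  qed
  have "bform n (hess (exclusion_gen n d p) I) x x =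
      (\<Sum>i<n. \<Sum>j<n. if i = j then 0 else bform n (hess (flux d p i j) I) x x)"
  proof -
    have "bform n (hess (exclusion_gen n d p) I) x x =
      (\<Sum>k<n. \<Sum>l<n. \<Sum>i<n. \<Sum>j<n. (if i = j then 0 else hess (flux d p i j) I k l * x k * x l))"
      by (simp add: bform_def hess_def exclusion_gen_def sum_distrib_right if_distrib[of "\<lambda>x. x * _"] cong: if_cong)
    also have "\<dots> = (\<Sum>k<n. \<Sum>i<n. \<Sum>l<n. \<Sum>j<n. (if i = j then 0 else hess (flux d p i j) I k l * x k * x l))"
      by (rule sum.cong[OF refl], rule sum.swap)
    also have "\<dots> = (\<Sum>k<n. \<Sum>i<n. \<Sum>j<n. \<Sum>l<n. (if i = j then 0 else hess (flux d p i j) I k l * x k * x l))"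
      by (rule sum.cong[OF refl], rule sum.cong[OF refl], rule sum.swap)
    also have "\<dots> = (\<Sum>i<n. \<Sum>k<n. \<Sum>j<n. \<Sum>l<n. (if i = j then 0 else hess (flux d p i j) I k l * x k * x l))"
      by (rule sum.swap)
    also have "\<dots> = (\<Sum>i<n. \<Sum>j<n. \<Sum>k<n. \<Sum>l<n. (if i = j then 0 else hess (flux d p i j) I k l * x k * x l))"
      by (rule sum.cong[OF refl], rule sum.swap)
    also have "\<dots> = (\<Sum>i<n. \<Sum>j<n. if i = j then 0 else bform n (hess (flux d p i j) I) x x)"
      by (intro sum.cong refl) (auto simp: bform_def)
    finally show ?thesis .
  qed
  \<comment> \<open>For \<open>i = j\<close> the right-hand summand is zero, so the bound may run
    over all pairs.\<close>
  also have "\<dots> \<le> (\<Sum>i<n. \<Sum>j<n. - 2 * (x i * x i * hess p I i j) + 2 * (x i * x j * hess p I i j))"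
  proof (intro sum_mono)
    fix i j assume "i \<in> {..<n}" "j \<in> {..<n}"
    then show "(if i = j then 0 else bform n (hess (flux d p i j) I) x x) \<le>
      - 2 * (x i * x i * hess p I i j) + 2 * (x i * x j * hess p I i j)"
      using flux_form_on_kernel[OF _ _ _ row, of i j d] nonpos[of i j] by (cases "i = j") auto
  qed
  also have "\<dots> = - (\<Sum>i<n. \<Sum>j<n. (x i - x j)\<^sup>2 * hess p I i j)"
  proof -
    have sw: "(\<Sum>i<n. \<Sum>j<n. x j * x j * hess p I i j) = (\<Sum>i<n. \<Sum>j<n. x i * x i * hess p I i j)"
      by (subst sum.swap) (simp add: hess_commute[of p I])
    have "(\<Sum>i<n. \<Sum>j<n. (x i - x j)\<^sup>2 * hess p I i j) =
      (\<Sum>i<n. \<Sum>j<n. x i * x i * hess p I i j) + (\<Sum>i<n. \<Sum>j<n. x j * x j * hess p I i j)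
      - (\<Sum>i<n. \<Sum>j<n. 2 * (x i * x j * hess p I i j))"
      by (simp add: sum.distrib[symmetric] sum_subtractf[symmetric] power2_eq_square algebra_simps)
    then show ?thesis
      unfolding sw by (simp add: sum.distrib sum_distrib_left[symmetric] sum_subtractf)
  qed
  also have "\<dots> < 0"
  proof -
    obtain k l where kl: "k < n" "l < n" "x k \<noteq> x l" using nonconst by blast
    have "0 < (x k - x l)\<^sup>2 * hess p I k l" using kl P by simp
    also have "\<dots> \<le> (\<Sum>j<n. (x k - x j)\<^sup>2 * hess p I k j)"
      by (rule member_le_sum) (use kl in \<open>auto intro!: mult_nonneg_nonneg less_imp_le[OF P]\<close>)
    also have "\<dots> \<le> (\<Sum>i<n. \<Sum>j<n. (x i - x j)\<^sup>2 * hess p I i j)"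
      by (rule member_le_sum) (use kl in \<open>auto intro!: sum_nonneg mult_nonneg_nonneg less_imp_le[OF P]\<close>)
    finally show ?thesis by simp
  qed
  finally show ?thesis .
qed

section \<open>Reversible Markov chains\<close>

text \<open>
  Irreducibility of the chain is stated as: a function that is constant along possible
  transitions is constant.
\<close>

locale reversible_chain =
  fixes \<Omega> :: "'a set" and w :: "'a \<Rightarrow> real" and R :: "'a \<Rightarrow> 'a \<Rightarrow> real"
  assumes fin: "finite \<Omega>" and nonempty: "\<Omega> \<noteq> {}"
    and w_pos: "a \<in> \<Omega> \<Longrightarrow> w a > 0"
    and R_nonneg: "a \<in> \<Omega> \<Longrightarrow> b \<in> \<Omega> \<Longrightarrow> R a b \<ge> 0"
    and balance: "a \<in> \<Omega> \<Longrightarrow> b \<in> \<Omega> \<Longrightarrow> w a * R a b = w b * R b a"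
    and irreducible: "(\<And>a b. a \<in> \<Omega> \<Longrightarrow> b \<in> \<Omega> \<Longrightarrow> R a b > 0 \<Longrightarrow> f a = f b) \<Longrightarrow>
      a \<in> \<Omega> \<Longrightarrow> b \<in> \<Omega> \<Longrightarrow> f a = (f b :: real)"
begin

definition gen :: "('a \<Rightarrow> real) \<Rightarrow> 'a \<Rightarrow> real" where
  "gen u a = (\<Sum>b\<in>\<Omega>. R a b * (u b - u a))"

text \<open>By detailed balance the double sum may be averaged with its transpose, which completes
  the square.\<close>

lemma dirichlet_form:
  "(\<Sum>a\<in>\<Omega>. w a * u a * gen u a) = - (\<Sum>a\<in>\<Omega>. \<Sum>b\<in>\<Omega>. w a * R a b * (u b - u a)\<^sup>2) / 2"
proof -
  define T where "T = (\<Sum>a\<in>\<Omega>. \<Sum>b\<in>\<Omega>. w a * R a b * (u a * (u b - u a)))"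
  have 1: "(\<Sum>a\<in>\<Omega>. w a * u a * gen u a) = T"
    by (simp add: T_def gen_def sum_distrib_left mult_ac)
  have "T = (\<Sum>b\<in>\<Omega>. \<Sum>a\<in>\<Omega>. w a * R a b * (u a * (u b - u a)))"
    unfolding T_def by (rule sum.swap)
  also have "\<dots> = (\<Sum>b\<in>\<Omega>. \<Sum>a\<in>\<Omega>. w b * R b a * (u a * (u b - u a)))"
    by (intro sum.cong refl) (simp add: balance)
  finally have "T + T = (\<Sum>a\<in>\<Omega>. \<Sum>b\<in>\<Omega>. w a * R a b * (u b * (u a - u b)) + w a * R a b * (u a * (u b - u a)))"
    by (simp add: T_def sum.distrib)
  also have "\<dots> = (\<Sum>a\<in>\<Omega>. \<Sum>b\<in>\<Omega>. - (w a * R a b * (u b - u a)\<^sup>2))"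
    by (intro sum.cong refl) (simp add: power2_eq_square algebra_simps)
  finally show ?thesis unfolding 1 by (simp add: sum_negf)
qed

lemma sum_weight_gen: "(\<Sum>a\<in>\<Omega>. w a * gen u a) = 0"
proof -
  have "(\<Sum>a\<in>\<Omega>. \<Sum>b\<in>\<Omega>. w a * R a b * u b) = (\<Sum>a\<in>\<Omega>. \<Sum>b\<in>\<Omega>. w a * R a b * u a)"
    by (subst sum.swap, intro sum.cong refl) (simp add: balance)
  then show ?thesis
    by (simp add: gen_def sum_distrib_left right_diff_distrib sum_subtractf mult_ac)
qed

text \<open>The eigenvalue of a normalised eigenvector is minus half a sum of nonnegative terms. If
  it is zero, \<open>u\<close> does not change along any transition, and irreducibility makes it
  constant.\<close>

lemma gen_eigenvalue:
  assumes eig: "\<And>a. a \<in> \<Omega> \<Longrightarrow> gen u a = l * u a" and norm: "(\<Sum>a\<in>\<Omega>. w a * u a * u a) = 1"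
  shows "l \<le> 0" and "l = 0 \<Longrightarrow> a \<in> \<Omega> \<Longrightarrow> b \<in> \<Omega> \<Longrightarrow> u a = u b"
proof -
  have "(\<Sum>a\<in>\<Omega>. w a * u a * gen u a) = (\<Sum>a\<in>\<Omega>. l * (w a * u a * u a))"
    by (intro sum.cong refl) (simp add: eig)
  also have "\<dots> = l" using norm by (simp add: sum_distrib_left[symmetric])
  finally have l: "l = - (\<Sum>a\<in>\<Omega>. \<Sum>b\<in>\<Omega>. w a * R a b * (u b - u a)\<^sup>2) / 2"
    by (simp add: dirichlet_form)
  have nn: "0 \<le> w a * R a b * (u b - u a)\<^sup>2" if "a \<in> \<Omega>" "b \<in> \<Omega>" for a b
    using w_pos[OF that(1)] R_nonneg[OF that] by simp
  show "l \<le> 0" unfolding l using nn by (simp add: sum_nonneg)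
  assume "l = 0" and ab: "a \<in> \<Omega>" "b \<in> \<Omega>"
  then have "(\<Sum>a\<in>\<Omega>. \<Sum>b\<in>\<Omega>. w a * R a b * (u b - u a)\<^sup>2) = 0" using l by simp
  then have "\<forall>a\<in>\<Omega>. (\<Sum>b\<in>\<Omega>. w a * R a b * (u b - u a)\<^sup>2) = 0"
    using fin by (subst (asm) sum_nonneg_eq_0_iff) (auto intro!: sum_nonneg nn)
  then have zero: "w a * R a b * (u b - u a)\<^sup>2 = 0" if "a \<in> \<Omega>" "b \<in> \<Omega>" for a b
  proof -
    have "(\<Sum>b\<in>\<Omega>. w a * R a b * (u b - u a)\<^sup>2) = 0"
      using \<open>\<forall>a\<in>\<Omega>. _ = 0\<close> that by blast
    then show ?thesis
      using fin nn that by (subst (asm) sum_nonneg_eq_0_iff) auto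
  qed
  show "u a = u b"
  proof (rule irreducible[OF _ ab])
    fix a b assume "a \<in> \<Omega>" "b \<in> \<Omega>" "R a b > 0"
    then show "u a = u b" using zero[of a b] w_pos[of a] by simp
  qed
qed

text \<open>Detailed balance says that conjugating the generator by the square root of the weight
  gives a symmetric matrix, to which \<open>real_spectral_theorem\<close> applies.\<close>

lemma gen_eigenbasis:
  obtains v :: "nat \<Rightarrow> 'a \<Rightarrow> real" and ev :: "nat \<Rightarrow> real" where
    "\<And>i j. i < card \<Omega> \<Longrightarrow> j < card \<Omega> \<Longrightarrow> (\<Sum>a\<in>\<Omega>. w a * v i a * v j a) = (if i = j then 1 else 0)"
    "\<And>a b. a \<in> \<Omega> \<Longrightarrow> b \<in> \<Omega> \<Longrightarrow> w b * (\<Sum>i<card \<Omega>. v i a * v i b) = (if a = b then 1 else 0)"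
    "\<And>i a. i < card \<Omega> \<Longrightarrow> a \<in> \<Omega> \<Longrightarrow> gen (v i) a = ev i * v i a"
proof -
  define s where "s a = sqrt (w a)" for a
  have s: "s a > 0" "s a * s a = w a" if "a \<in> \<Omega>" for a
    using w_pos[OF that] by (auto simp: s_def)
  define M where "M a b = R a b - (if a = b then \<Sum>c\<in>\<Omega>. R a c else 0)" for a b
  define A where "A a b = s a * M a b / s b" for a b
  have gen_M: "gen u a = (\<Sum>b\<in>\<Omega>. M a b * u b)" if "a \<in> \<Omega>" for u a
    using fin that
    by (simp add: gen_def M_def left_diff_distrib right_diff_distrib sum_subtractf
        if_distrib[of "\<lambda>x. x * _"] sum_distrib_right cong: if_cong)
  have A_sym: "A a b = A b a" if ab: "a \<in> \<Omega>" "b \<in> \<Omega>" for a b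
  proof (cases "a = b")
    case False
    then have "s a * s a * M a b = s b * s b * M b a"
      using ab by (simp add: s M_def balance)
    then show ?thesis using s(1)[OF ab(1)] s(1)[OF ab(2)] by (simp add: A_def field_simps)
  qed simp
  obtain v :: "nat \<Rightarrow> 'a \<Rightarrow> real" and ev where
    on: "\<And>i j. i < card \<Omega> \<Longrightarrow> j < card \<Omega> \<Longrightarrow> (\<Sum>a\<in>\<Omega>. v i a * v j a) = (if i = j then 1 else 0)" and
    co: "\<And>a b. a \<in> \<Omega> \<Longrightarrow> b \<in> \<Omega> \<Longrightarrow> (\<Sum>i<card \<Omega>. v i a * v i b) = (if a = b then 1 else 0)" and
    eig: "\<And>i a. i < card \<Omega> \<Longrightarrow> a \<in> \<Omega> \<Longrightarrow> (\<Sum>b\<in>\<Omega>. A a b * v i b) = ev i * v i a"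
    by (rule real_spectral_theorem[of \<Omega> A, OF fin A_sym]) (assumption, assumption, rule that)
  define u where "u i a = v i a / s a" for i a
  show ?thesis
  proof
    fix i j assume ij: "i < card \<Omega>" "j < card \<Omega>"
    have "(\<Sum>a\<in>\<Omega>. w a * u i a * u j a) = (\<Sum>a\<in>\<Omega>. v i a * v j a)"
    proof (intro sum.cong refl)
      fix a assume a: "a \<in> \<Omega>"
      show "w a * u i a * u j a = v i a * v j a"
        unfolding s(2)[OF a, symmetric] u_def using s(1)[OF a] by simp
    qed
    then show "(\<Sum>a\<in>\<Omega>. w a * u i a * u j a) = (if i = j then 1 else 0)" using on ij by simp
  next
    fix a b assume ab: "a \<in> \<Omega>" "b \<in> \<Omega>"
    have "w b * (\<Sum>i<card \<Omega>. u i a * u i b) = s b / s a * (\<Sum>i<card \<Omega>. v i a * v i b)"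
      unfolding s(2)[OF ab(2), symmetric] u_def sum_distrib_left
      using s(1)[OF ab(1)] s(1)[OF ab(2)] by (intro sum.cong refl) (simp add: field_simps)
    then show "w b * (\<Sum>i<card \<Omega>. u i a * u i b) = (if a = b then 1 else 0)"
      using co[OF ab] s(1)[OF ab(1)] by auto
  next
    fix i a assume i: "i < card \<Omega>" and a: "a \<in> \<Omega>"
    have "s a * gen (u i) a = (\<Sum>b\<in>\<Omega>. A a b * v i b)"
      unfolding gen_M[OF a] by (simp add: A_def u_def sum_distrib_left mult_ac)
    also have "\<dots> = s a * (ev i * u i a)" using eig[OF i a] s(1)[OF a] by (simp add: u_def)
    finally show "gen (u i) a = ev i * u i a" using s(1)[OF a] by simp
  qed
qed

text \<open>The eigenvalue 0 occurs exactly once, with constant eigenvector. Splitting it off leaves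
  \<open>card \<Omega> - 1\<close> decaying modes and turns its contribution to the expansion into
  the weighted mean.\<close>

theorem gen_spectral_decomposition:
  obtains v :: "nat \<Rightarrow> 'a \<Rightarrow> real" and \<mu> :: "nat \<Rightarrow> real" where
    "\<And>i. i < card \<Omega> - 1 \<Longrightarrow> \<mu> i > 0"
    "\<And>i a. i < card \<Omega> - 1 \<Longrightarrow> a \<in> \<Omega> \<Longrightarrow> gen (v i) a = - \<mu> i * v i a"
    "\<And>i j. i < card \<Omega> - 1 \<Longrightarrow> j < card \<Omega> - 1 \<Longrightarrow>
       (\<Sum>a\<in>\<Omega>. w a * v i a * v j a) = (if i = j then 1 else 0)"
    "\<And>i. i < card \<Omega> - 1 \<Longrightarrow> (\<Sum>a\<in>\<Omega>. w a * v i a) = 0"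
    "\<And>u a. a \<in> \<Omega> \<Longrightarrow>
       u a = (\<Sum>b\<in>\<Omega>. w b * u b) / (\<Sum>b\<in>\<Omega>. w b) + (\<Sum>i<card \<Omega> - 1. (\<Sum>b\<in>\<Omega>. w b * u b * v i b) * v i a)"
proof -
  let ?N = "card \<Omega>"
  obtain v :: "nat \<Rightarrow> 'a \<Rightarrow> real" and ev where
    on: "\<And>i j. i < ?N \<Longrightarrow> j < ?N \<Longrightarrow> (\<Sum>a\<in>\<Omega>. w a * v i a * v j a) = (if i = j then 1 else 0)" and
    co: "\<And>a b. a \<in> \<Omega> \<Longrightarrow> b \<in> \<Omega> \<Longrightarrow> w b * (\<Sum>i<?N. v i a * v i b) = (if a = b then 1 else 0)" and
    eig: "\<And>i a. i < ?N \<Longrightarrow> a \<in> \<Omega> \<Longrightarrow> gen (v i) a = ev i * v i a"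
    by (rule gen_eigenbasis) (rule that)
  have expand: "u a = (\<Sum>i<?N. (\<Sum>b\<in>\<Omega>. w b * u b * v i b) * v i a)" if a: "a \<in> \<Omega>" for u a
  proof -
    have "(\<Sum>i<?N. (\<Sum>b\<in>\<Omega>. w b * u b * v i b) * v i a) = (\<Sum>b\<in>\<Omega>. u b * (w b * (\<Sum>i<?N. v i a * v i b)))"
      unfolding sum_distrib_right sum_distrib_left by (subst sum.swap) (simp add: mult_ac)
    also have "\<dots> = (\<Sum>b\<in>\<Omega>. if a = b then u b else 0)"
      by (intro sum.cong refl) (simp add: co[OF a])
    finally show ?thesis using fin a by simp
  qed
  define W where "W = (\<Sum>b\<in>\<Omega>. w b)"
  have W: "W > 0" unfolding W_def using fin nonempty w_pos by (intro sum_pos) auto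
  obtain a0 where a0: "a0 \<in> \<Omega>" using nonempty by blast
  have mean: "ev i = 0 \<or> (\<Sum>a\<in>\<Omega>. w a * v i a) = 0" if "i < ?N" for i
  proof -
    have "ev i * (\<Sum>a\<in>\<Omega>. w a * v i a) = (\<Sum>a\<in>\<Omega>. w a * gen (v i) a)"
      by (simp add: sum_distrib_left eig[OF that] mult_ac)
    then show ?thesis by (simp add: sum_weight_gen)
  qed
  \<comment> \<open>Otherwise every eigenvector has weighted mean zero, and the constant function 1
    would have the zero expansion.\<close>
  have "\<exists>i<?N. ev i = 0"
  proof (rule ccontr)
    assume "\<not> ?thesis"
    then have "(\<Sum>a\<in>\<Omega>. w a * v i a) = 0" if "i < ?N" for i using mean that by blast
    then show False using expand[OF a0, of "\<lambda>_. 1"] by simp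
  qed
  then obtain z where z: "z < ?N" "ev z = 0" by blast
  have const: "v i a = v i a0" if "i < ?N" "ev i = 0" "a \<in> \<Omega>" for i a
    using gen_eigenvalue(2)[OF eig[OF that(1)] _ that(2,3) a0] on[OF that(1) that(1)] by simp
  have inner_const: "(\<Sum>a\<in>\<Omega>. w a * v i a * v j a) = v i a0 * v j a0 * W"
    if "i < ?N" "ev i = 0" "j < ?N" "ev j = 0" for i j
  proof -
    have "(\<Sum>a\<in>\<Omega>. w a * v i a * v j a) = (\<Sum>a\<in>\<Omega>. v i a0 * v j a0 * w a)"
    proof (rule sum.cong[OF refl])
      fix a assume "a \<in> \<Omega>"
      then show "w a * v i a * v j a = v i a0 * v j a0 * w a"
        using const[OF that(1,2), of a] const[OF that(3,4), of a] by simp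
    qed
    then show ?thesis by (simp add: W_def sum_distrib_left)
  qed
  have zz: "v z a0 * v z a0 * W = 1" using inner_const[OF z z] on[OF z(1) z(1)] by simp
  have ev_neg: "ev i < 0" if i: "i < ?N" "i \<noteq> z" for i
  proof -
    \<comment> \<open>Two normalised eigenvectors for 0 are non-zero constants and therefore cannot
      be orthogonal.\<close>
    have "ev i \<noteq> 0"
    proof
      assume ei: "ev i = 0"
      have "v i a0 * v i a0 * W = 1" using inner_const[OF i(1) ei i(1) ei] on[OF i(1) i(1)] by simp
      moreover have "v i a0 * v z a0 * W = 0" using inner_const[OF i(1) ei z] on[OF i(1) z(1)] i by simp
      ultimately show False using zz by auto
    qed
    moreover have "ev i \<le> 0"
      using gen_eigenvalue(1)[OF eig[OF i(1)]] on[OF i(1) i(1)] by simp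
    ultimately show ?thesis by simp
  qed
  \<comment> \<open>Enumerates the indices other than \<open>z\<close> without a gap.\<close>
  define h where "h i = (if i < z then i else Suc i)" for i
  have bij: "bij_betw h {..<?N - 1} ({..<?N} - {z})"
  proof (rule bij_betw_imageI)
    show "inj_on h {..<?N - 1}" by (auto simp: inj_on_def h_def split: if_splits)
    show "h ` {..<?N - 1} = {..<?N} - {z}"
    proof (intro equalityI subsetI)
      fix i assume "i \<in> {..<?N} - {z}"
      then show "i \<in> h ` {..<?N - 1}"
        using z(1) by (intro image_eqI[of _ _ "if i < z then i else i - 1"]) (auto simp: h_def)
    qed (use z in \<open>auto simp: h_def split: if_splits\<close>)
  qed
  have h: "h i < ?N" "h i \<noteq> z" if "i < ?N - 1" for i
    using bij that by (auto simp: bij_betw_def)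
  have h_inj: "h i = h j \<longleftrightarrow> i = j" for i j by (auto simp: h_def)
  show ?thesis
  proof (rule that[of "\<lambda>i. - ev (h i)" "\<lambda>i. v (h i)"])
    fix u :: "'a \<Rightarrow> real" and a assume a: "a \<in> \<Omega>"
    let ?c = "\<lambda>i. \<Sum>b\<in>\<Omega>. w b * u b * v i b"
    have "u a = (\<Sum>i<?N. ?c i * v i a)" by (rule expand[OF a])
    also have "\<dots> = ?c z * v z a + (\<Sum>i\<in>{..<?N} - {z}. ?c i * v i a)"
      using z by (intro sum.remove) auto
    also have "(\<Sum>i\<in>{..<?N} - {z}. ?c i * v i a) = (\<Sum>i<?N - 1. ?c (h i) * v (h i) a)"
      by (rule sum.reindex_bij_betw[OF bij, symmetric])
    also have "?c z * v z a = (\<Sum>b\<in>\<Omega>. w b * u b) / W"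
    proof -
      have "?c z = (\<Sum>b\<in>\<Omega>. w b * u b * v z a0)"
        by (rule sum.cong[OF refl]) (simp add: const[OF z])
      also have "\<dots> = (\<Sum>b\<in>\<Omega>. w b * u b) * v z a0" by (simp add: sum_distrib_right)
      finally have "?c z * v z a = (\<Sum>b\<in>\<Omega>. w b * u b) * (v z a0 * v z a0)"
        by (simp add: const[OF z a])
      also have "v z a0 * v z a0 = 1 / W" using zz W by (simp add: field_simps)
      finally show ?thesis by simp
    qed
    finally show "u a = (\<Sum>b\<in>\<Omega>. w b * u b) / (\<Sum>b\<in>\<Omega>. w b) + (\<Sum>i<?N - 1. ?c (h i) * v (h i) a)"
      by (simp add: W_def)
  next
    fix i assume i: "i < ?N - 1"
    then show "- ev (h i) > 0" using ev_neg[OF h[OF i]] by simp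
    show "(\<Sum>a\<in>\<Omega>. w a * v (h i) a) = 0"
      using mean[OF h(1)[OF i]] ev_neg[OF h[OF i]] by simp
    show "gen (v (h i)) a = - (- ev (h i)) * v (h i) a" if "a \<in> \<Omega>" for a
      using eig[OF h(1)[OF i] that] by simp
    show "(\<Sum>a\<in>\<Omega>. w a * v (h i) a * v (h j) a) = (if i = j then 1 else 0)" if "j < ?N - 1" for j
      using on[OF h(1)[OF i] h(1)[OF that]] by (simp add: h_inj)
  qed
qed

end

section \<open>Absorbing sets of contracting diagonal flows\<close>

locale diagonal_flow =
  fixes k :: nat and \<mu> :: "nat \<Rightarrow> real"
  assumes \<mu>_pos: "i < k \<Longrightarrow> \<mu> i > 0"
begin

text \<open>The Euclidean space of dimension \<open>k\<close> as sequences vanishing from index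
  \<open>k\<close> on, the same encoding as in \<open>Euclidean_space\<close>.\<close>

definition E :: "(nat \<Rightarrow> real) set" where "E = {x. \<forall>i\<ge>k. x i = 0}"

definition T :: "real \<Rightarrow> (nat \<Rightarrow> real) \<Rightarrow> nat \<Rightarrow> real" where
  "T t x = (\<lambda>i. exp (- \<mu> i * t) * x i)"

lemma T_T: "T s (T t x) = T (s + t) x"
  by (simp add: T_def fun_eq_iff mult_exp_exp algebra_simps exp_add[symmetric])

lemma T_0: "T 0 x = x" by (simp add: T_def)

lemma T_in_E: "x \<in> E \<Longrightarrow> T t x \<in> E" by (simp add: T_def E_def)

lemma T_eq_0_iff: "T t x = (\<lambda>_. 0) \<longleftrightarrow> x = (\<lambda>_. 0)" by (simp add: T_def fun_eq_iff)

lemma closed_E: "closed E"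
proof -
  have "E = (\<Inter>i\<in>{k..}. {x. x i = 0})" by (auto simp: E_def)
  also have "closed \<dots>"
    by (intro closed_INT ballI closed_Collect_eq continuous_intros)
  finally show ?thesis .
qed

lemma continuous_on_T:
  assumes "continuous_on S f" "continuous_on S g"
  shows "continuous_on S (\<lambda>x. T (f x) (g x))"
  unfolding T_def
  by (rule continuous_on_coordinatewise_then_product)
     (intro continuous_intros assms continuous_on_product_then_coordinatewise[OF assms(2)])

lemma continuous_on_T_time: "continuous_on S (\<lambda>t. T t x)"
  by (rule continuous_on_T[OF continuous_on_id continuous_on_const])

text \<open>\<open>U\<close> plays the role of the interior of \<open>K\<close> relative to the whole space.\<close>

definition absorbing :: "(nat \<Rightarrow> real) set \<Rightarrow> (nat \<Rightarrow> real) set \<Rightarrow> bool" where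
  "absorbing K U \<longleftrightarrow> compact K \<and> K \<subseteq> E \<and> (\<lambda>_. 0) \<in> K \<and> openin (top_of_set E) U \<and> U \<subseteq> K \<and>
     (\<forall>t>0. \<forall>x\<in>K. T t x \<in> U)"

text \<open>Negative times are included. At the fixed point the set is either empty or the whole
  line and the value of \<open>Inf\<close> is meaningless, but \<open>T\<close> fixes this point
  whatever the time.\<close>

definition entry :: "(nat \<Rightarrow> real) set \<Rightarrow> (nat \<Rightarrow> real) \<Rightarrow> real" where
  "entry K x = Inf {t. T t x \<in> K}"

lemma T_tendsto_0:
  assumes "x \<in> E"
  shows "((\<lambda>t. T t x) \<longlongrightarrow> (\<lambda>_. 0)) at_top"
proof -
  have "((\<lambda>t. T t x i) \<longlongrightarrow> 0) at_top" for i
  proof (cases "i < k")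
    case True
    have "filterlim (\<lambda>t. \<mu> i * t) at_top at_top"
      using \<mu>_pos[OF True] by (intro filterlim_tendsto_pos_mult_at_top[OF tendsto_const]) (auto simp: filterlim_ident)
    then have "((\<lambda>t. exp (- (\<mu> i * t))) \<longlongrightarrow> 0) at_top"
      by (intro filterlim_compose[OF exp_at_bot] filterlim_compose[OF filterlim_uminus_at_bot_at_top])
    then have "((\<lambda>t. exp (- (\<mu> i * t)) * x i) \<longlongrightarrow> 0 * x i) at_top"
      by (intro tendsto_mult tendsto_const)
    then show ?thesis by (simp add: T_def)
  next
    case False
    then show ?thesis using assms by (simp add: T_def E_def)
  qed
  then have "limitin (product_topology (\<lambda>i. euclidean) UNIV) (\<lambda>t. T t x) (\<lambda>_. 0) at_top"
    by (simp add: limitin_componentwise)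
  then show ?thesis by (simp add: euclidean_product_topology)
qed

lemma absorbing_bounded:
  fixes K :: "(nat \<Rightarrow> real) set"
  assumes "compact K"
  obtains C where "\<And>x. x \<in> K \<Longrightarrow> \<bar>x i\<bar> \<le> C"
proof -
  have "compact ((\<lambda>x. x i) ` K)"
    by (intro compact_continuous_image assms continuous_on_coordinate)
  then have "bounded ((\<lambda>x. x i) ` K)" by (rule compact_imp_bounded)
  then show ?thesis using that by (auto simp: bounded_iff)
qed

text \<open>The times spent in \<open>K\<close> form a closed half-line: the set is closed upwards
  by absorption, non-empty because the trajectory tends to 0, bounded below because a non-zero
  coordinate explodes backwards in time, and closed because \<open>K\<close> is.\<close>

lemma entry_iff:
  assumes K: "absorbing K U" and x: "x \<in> E" "x \<noteq> (\<lambda>_. 0)"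
  shows "T t x \<in> K \<longleftrightarrow> entry K x \<le> t"
proof -
  define S where "S = {t. T t x \<in> K}"
  have "compact K" using K by (simp add: absorbing_def)
  have zero: "(\<lambda>_. 0) \<in> U"
  proof -
    have "T 1 (\<lambda>_. 0) \<in> U" using K by (simp add: absorbing_def)
    then show ?thesis by (simp add: T_def)
  qed
  have up: "t \<in> S" if "s \<in> S" "s < t" for s t
  proof -
    have "T (t - s) (T s x) \<in> U" using K that by (simp add: absorbing_def S_def)
    then show ?thesis using K by (auto simp: T_T S_def absorbing_def)
  qed
  have "S \<noteq> {}"
  proof -
    obtain V where V: "open V" "U = E \<inter> V" using K by (auto simp: absorbing_def openin_open)
    with zero have "(\<lambda>_. 0) \<in> V" by simp
    then have "eventually (\<lambda>t. T t x \<in> V) at_top"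
      using T_tendsto_0[OF x(1)] V(1) by (auto simp: tendsto_def)
    then obtain t where "T t x \<in> V" by (auto simp: eventually_at_top_linorder)
    then have "T t x \<in> U" using V T_in_E[OF x(1)] by simp
    then show ?thesis using K by (auto simp: S_def absorbing_def)
  qed
  have bdd: "bdd_below S"
  proof -
    obtain i where xi: "x i \<noteq> 0" using x(2) by (auto simp: fun_eq_iff)
    then have i: "i < k" using x(1) by (auto simp: E_def not_less[symmetric])
    obtain C where C: "\<And>y. y \<in> K \<Longrightarrow> \<bar>y i\<bar> \<le> C" using absorbing_bounded[OF \<open>compact K\<close>, of i] by blast
    \<comment> \<open>At time \<open>- m / \<mu> i\<close> the \<open>i\<close>-th coordinate has
      modulus \<open>\<bar>C\<bar> + 1\<close>, too large for \<open>K\<close>; the summand 1 keeps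
      the argument of the logarithm positive.\<close>
    define m where "m = ln ((\<bar>C\<bar> + 1) / \<bar>x i\<bar>)"
    have "(- m) / \<mu> i \<le> t" if "t \<in> S" for t
    proof -
      have "exp (- \<mu> i * t) * \<bar>x i\<bar> \<le> C"
        using C[of "T t x"] that by (simp add: S_def T_def abs_mult)
      also have "\<dots> \<le> \<bar>C\<bar> + 1" by simp
      also have "\<dots> = exp m * \<bar>x i\<bar>" using xi by (simp add: m_def)
      finally have "- \<mu> i * t \<le> m" using xi by simp
      then have "- m \<le> t * \<mu> i" by (simp add: mult.commute)
      then show ?thesis using \<mu>_pos[OF i] by (simp only: pos_divide_le_eq)
    qed
    then show ?thesis by (auto simp: bdd_below_def)
  qed
  have "closed S"
  proof -
    have "closed ((\<lambda>t. T t x) -` K)"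
      by (rule closed_vimage[OF compact_imp_closed[OF \<open>compact K\<close>] continuous_on_T_time])
    then show ?thesis by (simp add: S_def vimage_def)
  qed
  then have "Inf S \<in> S" using \<open>S \<noteq> {}\<close> bdd by (intro closed_contains_Inf)
  moreover have "Inf S \<le> t" if "t \<in> S" for t using that bdd by (rule cInf_lower)
  ultimately have "t \<in> S \<longleftrightarrow> Inf S \<le> t" using up[of "Inf S" t] by (cases "Inf S = t") auto
  then show ?thesis by (simp add: S_def entry_def)
qed

text \<open>Since \<open>U\<close> is relatively open, a trajectory in \<open>U\<close> was already
  there slightly earlier. Conversely, any time elapsed after entering \<open>K\<close> leads into
  \<open>U\<close>.\<close>

lemma entry_less_iff:
  assumes K: "absorbing K U" and x: "x \<in> E" "x \<noteq> (\<lambda>_. 0)"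
  shows "T t x \<in> U \<longleftrightarrow> entry K x < t"
proof
  assume U: "T t x \<in> U"
  obtain V where V: "open V" "U = E \<inter> V" using K by (auto simp: absorbing_def openin_open)
  have "open ((\<lambda>t. T t x) -` V)"
    by (rule open_vimage[OF V(1) continuous_on_T_time])
  moreover have "t \<in> (\<lambda>t. T t x) -` V" using U V by simp
  ultimately obtain e where e: "e > 0" "ball t e \<subseteq> (\<lambda>t. T t x) -` V"
    unfolding open_contains_ball by blast
  have "t - e / 2 \<in> ball t e" using e by (simp add: dist_real_def)
  with e(2) have "T (t - e / 2) x \<in> V" by blast
  then have "T (t - e / 2) x \<in> U" using V T_in_E[OF x(1)] by auto
  then have "T (t - e / 2) x \<in> K" using K by (auto simp: absorbing_def)
  then show "entry K x < t" using e unfolding entry_iff[OF K x] by simp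
next
  assume less: "entry K x < t"
  have "T (entry K x) x \<in> K" by (simp add: entry_iff[OF K x])
  then have "T (t - entry K x) (T (entry K x) x) \<in> U" using K less by (simp add: absorbing_def)
  then show "T t x \<in> U" by (simp add: T_T)
qed

lemma entry_T:
  assumes K: "absorbing K U" and x: "x \<in> E" "x \<noteq> (\<lambda>_. 0)"
  shows "entry K (T s x) = entry K x - s"
proof -
  have *: "entry K (T s x) \<le> t \<longleftrightarrow> entry K x - s \<le> t" for t
    using entry_iff[OF K T_in_E[OF x(1)], of s t] entry_iff[OF K x, of "t + s"] x
    by (simp add: T_T T_eq_0_iff algebra_simps)
  show ?thesis using *[of "entry K (T s x)"] *[of "entry K x - s"] by simp
qed

text \<open>Strict sublevel sets are preimages of \<open>U\<close>, hence open, and weak ones are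
  preimages of \<open>K\<close>, hence closed; together these are both semicontinuities.\<close>

lemma continuous_on_entry:
  assumes K: "absorbing K U"
  shows "continuous_on (E - {\<lambda>_. 0}) (entry K)"
proof -
  let ?X = "E - {\<lambda>_. 0}"
  have cont: "continuous_on ?X (T a)" for a
    by (rule continuous_on_T) (auto intro: continuous_intros)
  have "continuous_map (top_of_set ?X) euclideanreal (entry K)"
    unfolding continuous_map_upper_lower_semicontinuous_lte
  proof (intro conjI allI)
    fix a
    have "openin (top_of_set ?X) (?X \<inter> T a -` U)"
      by (rule continuous_openin_preimage[OF cont, of _ E])
         (use K T_in_E in \<open>auto simp: absorbing_def\<close>)
    also have "?X \<inter> T a -` U = {x \<in> topspace (top_of_set ?X). entry K x < a}"
      using entry_less_iff[OF K] by auto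
    finally show "openin (top_of_set ?X) {x \<in> topspace (top_of_set ?X). entry K x < a}" .
    have "closedin (top_of_set ?X) (?X \<inter> T a -` K)"
      by (rule continuous_closedin_preimage[OF cont])
         (use K in \<open>auto simp: absorbing_def intro: compact_imp_closed\<close>)
    also have "?X \<inter> T a -` K = {x \<in> topspace (top_of_set ?X). entry K x \<le> a}"
      using entry_iff[OF K] by auto
    finally show "closedin (top_of_set ?X) {x \<in> topspace (top_of_set ?X). entry K x \<le> a}" .
  qed
  then show ?thesis by simp
qed

text \<open>For any fixed \<open>Z\<close>, the map \<open>T Z\<close> is continuous and fixes 0, so
  it sends all points of \<open>E\<close> close to 0 into \<open>U\<close>.\<close>

lemma entry_tendsto_at_bot:
  assumes K: "absorbing K U"
  shows "filterlim (entry K) at_bot (at (\<lambda>_. 0) within E)"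
  unfolding filterlim_at_bot
proof
  fix Z
  obtain V where V: "open V" "U = E \<inter> V" using K by (auto simp: absorbing_def openin_open)
  have cont: "continuous_on UNIV (T Z)" by (rule continuous_on_T) (auto intro: continuous_intros)
  have "T 1 (\<lambda>_. 0) \<in> U" using K by (simp add: absorbing_def)
  then have "T Z (\<lambda>_. 0) \<in> V" using V by (simp add: T_def)
  moreover have "open (T Z -` V)" using V(1) cont by (rule open_vimage)
  ultimately have "eventually (\<lambda>x. x \<in> T Z -` V) (nhds (\<lambda>_. 0))"
    by (intro eventually_nhds_in_open) auto
  then show "eventually (\<lambda>x. entry K x \<le> Z) (at (\<lambda>_. 0) within E)"
    unfolding eventually_at_filter
  proof eventually_elim
    case (elim x)
    then show ?case using entry_less_iff[OF K, of x Z] V T_in_E[of x Z] by auto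
  qed
qed

text \<open>The map \<open>\<phi>\<close> slides \<open>x\<close> along its trajectory until its
  entry time into \<open>L\<close> equals the entry time of \<open>x\<close> into \<open>K\<close>;
  exchanging \<open>K\<close> and \<open>L\<close> gives the inverse. As \<open>K\<close> is
  compact, continuity of \<open>\<phi>\<close> suffices, and only the fixed point needs a separate
  argument.\<close>

theorem absorbing_homeomorphic:
  assumes K: "absorbing K U" and L: "absorbing L V"
  shows "K homeomorphic L"
proof (rule homeomorphic_compact)
  define \<phi> where "\<phi> x = T (entry L x - entry K x) x" for x
  have \<phi>0: "\<phi> (\<lambda>_. 0) = (\<lambda>_. 0)" by (simp add: \<phi>_def T_def)
  show "compact K" using K by (simp add: absorbing_def)
  have nz: "\<phi> x \<in> E" "\<phi> x \<noteq> (\<lambda>_. 0)" if "x \<in> E" "x \<noteq> (\<lambda>_. 0)" for x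
    using that T_in_E by (auto simp: \<phi>_def T_eq_0_iff)
  have entry_\<phi>: "entry L (\<phi> x) = entry K x" "entry K (\<phi> x) = 2 * entry K x - entry L x"
    if "x \<in> E" "x \<noteq> (\<lambda>_. 0)" for x
    using entry_T[OF K that] entry_T[OF L that] by (auto simp: \<phi>_def)
  have inL: "x \<in> L \<longleftrightarrow> entry L x \<le> 0" and inK: "x \<in> K \<longleftrightarrow> entry K x \<le> 0"
    if "x \<in> E" "x \<noteq> (\<lambda>_. 0)" for x
    using entry_iff[OF K that, of 0] entry_iff[OF L that, of 0] by (simp_all add: T_0)
  have KE: "K \<subseteq> E" "(\<lambda>_. 0) \<in> K" and LE: "L \<subseteq> E" "(\<lambda>_. 0) \<in> L"
    using K L by (auto simp: absorbing_def)
  have inv: "T (entry K (\<phi> x) - entry L (\<phi> x)) (\<phi> x) = x" if "x \<in> E" for x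
  proof (cases "x = (\<lambda>_. 0)")
    case True
    then show ?thesis by (simp add: \<phi>_def T_def)
  next
    case False
    then show ?thesis using entry_\<phi>[OF that False] by (simp add: \<phi>_def T_T T_0)
  qed
  show "inj_on \<phi> K"
    by (rule inj_on_inverseI[of _ "\<lambda>y. T (entry K y - entry L y) y"]) (use inv KE in auto)
  show "\<phi> ` K = L"
  proof (intro equalityI subsetI)
    fix y assume "y \<in> \<phi> ` K"
    then obtain x where x: "x \<in> K" "y = \<phi> x" by blast
    show "y \<in> L"
    proof (cases "x = (\<lambda>_. 0)")
      case False
      with x KE have "x \<in> E" by auto
      then show ?thesis
        using x False nz[of x] entry_\<phi>(1)[of x] inK[of x] inL[of "\<phi> x"] by auto
    qed (use x LE \<phi>0 in auto)
  next
    fix y assume y: "y \<in> L"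
    then have yE: "y \<in> E" using LE by auto
    show "y \<in> \<phi> ` K"
    proof (cases "y = (\<lambda>_. 0)")
      case True
      then show ?thesis using KE \<phi>0 by (metis imageI)
    next
      case False
      define x where "x = T (entry K y - entry L y) y"
      have x: "x \<in> E" "x \<noteq> (\<lambda>_. 0)" using T_in_E[OF yE] False by (auto simp: x_def T_eq_0_iff)
      have e: "entry K x = entry L y" "entry L x = 2 * entry L y - entry K y"
        using entry_T[OF K yE False] entry_T[OF L yE False] by (auto simp: x_def)
      have "\<phi> x = y" unfolding \<phi>_def e by (simp add: x_def T_T T_0)
      moreover have "x \<in> K" using inK[OF x] inL[OF yE False] y e by simp
      ultimately show ?thesis by blast
    qed
  qed
  have cont1: "continuous_on (E - {\<lambda>_. 0}) \<phi>"
    unfolding \<phi>_def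
    by (intro continuous_on_T continuous_on_diff continuous_on_entry[OF K] continuous_on_entry[OF L] continuous_on_id)
  have lim0: "(\<phi> \<longlongrightarrow> (\<lambda>_. 0)) (at (\<lambda>_. 0) within E)"
  proof -
    have "((\<lambda>x. \<phi> x i) \<longlongrightarrow> 0) (at (\<lambda>_. 0) within E)" for i
    proof (cases "i < k")
      case True
      obtain C where C: "\<And>y. y \<in> L \<Longrightarrow> \<bar>y i\<bar> \<le> C"
        using absorbing_bounded[of L i] L by (auto simp: absorbing_def)
      have "filterlim (\<lambda>x. \<mu> i * entry K x) at_bot (at (\<lambda>_. 0) within E)"
        using \<mu>_pos[OF True]
        by (intro filterlim_tendsto_pos_mult_at_bot[OF tendsto_const] entry_tendsto_at_bot[OF K])
      then have "((\<lambda>x. exp (\<mu> i * entry K x)) \<longlongrightarrow> 0) (at (\<lambda>_. 0) within E)"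
        by (rule filterlim_compose[OF exp_at_bot])
      then have "((\<lambda>x. exp (\<mu> i * entry K x) * C) \<longlongrightarrow> 0 * C) (at (\<lambda>_. 0) within E)"
        by (intro tendsto_mult tendsto_const)
      then have lim: "((\<lambda>x. exp (\<mu> i * entry K x) * C) \<longlongrightarrow> 0) (at (\<lambda>_. 0) within E)" by simp
      show ?thesis
      proof (rule Lim_null_comparison[OF _ lim])
        show "eventually (\<lambda>x. norm (\<phi> x i) \<le> exp (\<mu> i * entry K x) * C) (at (\<lambda>_. 0) within E)"
          unfolding eventually_at_filter
        proof (intro always_eventually allI impI)
          fix x assume x: "x \<noteq> (\<lambda>_. 0)" "x \<in> E"
          \<comment> \<open>After time \<open>entry K x\<close> the point \<open>\<phi> x\<close>
            lies in \<open>L\<close>, where coordinate \<open>i\<close> is bounded by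
            \<open>C\<close>. Flowing back costs the factor
            \<open>exp (\<mu> i * entry K x)\<close>, which tends to 0 because the entry times tend
            to minus infinity.\<close>
          have "T (entry K x) (\<phi> x) \<in> L"
            using entry_iff[OF L nz[OF x(2,1)], of "entry K x"] entry_\<phi>(1)[OF x(2,1)] by simp
          from C[OF this] have "exp (- \<mu> i * entry K x) * \<bar>\<phi> x i\<bar> \<le> C"
            by (simp add: T_def abs_mult)
          then have "exp (\<mu> i * entry K x) * (exp (- \<mu> i * entry K x) * \<bar>\<phi> x i\<bar>) \<le> exp (\<mu> i * entry K x) * C"
            by (intro mult_left_mono) auto
          then show "norm (\<phi> x i) \<le> exp (\<mu> i * entry K x) * C"
            by (simp add: mult.assoc[symmetric] mult_exp_exp)
        qed
      qed
    next
      case False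
      have "eventually (\<lambda>x. \<phi> x i = 0) (at (\<lambda>_. 0) within E)"
        unfolding eventually_at_filter
        using nz(1) False by (intro always_eventually) (auto simp: E_def)
      then show ?thesis by (rule tendsto_eventually)
    qed
    then have "limitin (product_topology (\<lambda>i. euclidean) UNIV) \<phi> (\<lambda>_. 0) (at (\<lambda>_. 0) within E)"
      by (simp add: limitin_componentwise)
    then show ?thesis by (simp add: euclidean_product_topology)
  qed
  have "continuous_on E \<phi>"
    unfolding continuous_on_def
  proof
    fix x assume x: "x \<in> E"
    show "(\<phi> \<longlongrightarrow> \<phi> x) (at x within E)"
    proof (cases "x = (\<lambda>_. 0)")
      case True
      then show ?thesis using lim0 \<phi>0 by simp
    next
      case False
      have "(\<phi> \<longlongrightarrow> \<phi> x) (at x within (E - {\<lambda>_. 0}))"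
        using cont1 x False by (auto simp: continuous_on_def)
      moreover have "at x within (E - {\<lambda>_. 0}) = at x within E"
      proof -
        have "open (- {\<lambda>_. 0 :: real} :: (nat \<Rightarrow> real) set)" by (intro open_Compl closed_singleton)
        then show ?thesis using False by (intro at_within_nhd[of x "- {\<lambda>_. 0}"]) auto
      qed
      ultimately show ?thesis by simp
    qed
  qed
  then show "continuous_on K \<phi>" using KE(1) by (rule continuous_on_subset)
qed

section \<open>The closed unit ball as an absorbing set\<close>

definition cball_E :: "(nat \<Rightarrow> real) set" where
  "cball_E = {x \<in> E. (\<Sum>i<k. (x i)\<^sup>2) \<le> 1}"

text \<open>At positive times each coordinate factor is below 1, so the Euclidean norm of a non-zero
  vector strictly decreases.\<close>

lemma absorbing_cball: "absorbing cball_E {x \<in> E. (\<Sum>i<k. (x i)\<^sup>2) < 1}"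
proof -
  define B where "B = (\<lambda>i. if i < k then {-1..1::real} else {0})"
  have 1: "\<bar>x i\<bar> \<le> 1" if "(\<Sum>i<k. (x i)\<^sup>2) \<le> 1" "i < k" for x :: "nat \<Rightarrow> real" and i
  proof -
    have "(x i)\<^sup>2 \<le> (\<Sum>i<k. (x i)\<^sup>2)" by (rule member_le_sum) (use that in auto)
    also have "\<dots> \<le> 1" by (rule that(1))
    finally show ?thesis by (simp add: abs_square_le_1)
  qed
  have "cball_E = {x. \<forall>i. x i \<in> B i} \<inter> {x. (\<Sum>i<k. (x i)\<^sup>2) \<le> 1}"
    using 1 by (auto simp: cball_E_def E_def B_def abs_le_iff minus_le_iff split: if_splits)
  also have "compact \<dots>"
    by (intro compact_Int_closed compact_box_fun closed_Collect_le continuous_intros)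
       (auto simp: B_def)
  finally have "compact cball_E" .
  moreover have "openin (top_of_set E) {x \<in> E. (\<Sum>i<k. (x i)\<^sup>2) < 1}"
  proof -
    have "open {x :: nat \<Rightarrow> real. (\<Sum>i<k. (x i)\<^sup>2) < 1}"
      by (intro open_Collect_less continuous_intros)
    then have "openin (top_of_set E) (E \<inter> {x. (\<Sum>i<k. (x i)\<^sup>2) < 1})" by (rule openin_open_Int)
    also have "E \<inter> {x. (\<Sum>i<k. (x i)\<^sup>2) < 1} = {x \<in> E. (\<Sum>i<k. (x i)\<^sup>2) < 1}" by blast
    finally show ?thesis .
  qed
  moreover have "(\<Sum>i<k. (T t x i)\<^sup>2) < 1" if "t > 0" "(\<Sum>i<k. (x i)\<^sup>2) \<le> 1" for t x
  proof (cases "\<exists>i<k. x i \<noteq> 0")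
    case True
    then obtain j where j: "j < k" "x j \<noteq> 0" by blast
    have e: "(exp (- \<mu> i * t))\<^sup>2 < 1" if "i < k" for i
      using \<mu>_pos[OF that] \<open>t > 0\<close> by (simp add: power_less_one_iff abs_square_less_1)
    have "(\<Sum>i<k. (T t x i)\<^sup>2) < (\<Sum>i<k. (x i)\<^sup>2)"
    proof (rule sum_strict_mono_ex1)
      show "\<forall>i\<in>{..<k}. (T t x i)\<^sup>2 \<le> (x i)\<^sup>2"
      proof
        fix i assume "i \<in> {..<k}"
        then have "(exp (- \<mu> i * t))\<^sup>2 * (x i)\<^sup>2 \<le> 1 * (x i)\<^sup>2"
          using less_imp_le[OF e] by (intro mult_right_mono) auto
        then show "(T t x i)\<^sup>2 \<le> (x i)\<^sup>2" by (simp add: T_def power_mult_distrib)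
      qed
      have "(exp (- \<mu> j * t))\<^sup>2 * (x j)\<^sup>2 < 1 * (x j)\<^sup>2"
        using e[OF j(1)] j(2) by (intro mult_strict_right_mono) auto
      then show "\<exists>i\<in>{..<k}. (T t x i)\<^sup>2 < (x i)\<^sup>2"
        using j(1) by (intro bexI[of _ j]) (auto simp: T_def power_mult_distrib)
    qed simp
    with that show ?thesis by simp
  qed (simp add: T_def)
  ultimately show ?thesis
    unfolding absorbing_def using T_in_E by (auto simp: cball_E_def) (auto simp: E_def)
qed

end

section \<open>The symmetric exclusion process\<close>

definition ffall :: "nat \<Rightarrow> nat \<Rightarrow> real" where
  "ffall d k = (\<Prod>t<k. real d - real t)"

text \<open>Up to scale, the values of \<open>pcoef\<close> for the stationary polynomial, which is
  the part of degree \<open>d\<close> in the product of the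
  \<open>(1 + w\<^sub>i)^d\<close>.\<close>

definition rho :: "nat \<Rightarrow> nat \<Rightarrow> expvec \<Rightarrow> real" where
  "rho n d m = (\<Prod>i<n. ffall d (Poly_Mapping.lookup m i))"

text \<open>On monomials of degree \<open>d\<close> this is the product of the binomial coefficients of \<open>d\<close> over \<open>m\<^sub>i\<close>.\<close>

definition weight :: "nat \<Rightarrow> nat \<Rightarrow> expvec \<Rightarrow> real" where
  "weight n d m = rho n d m / mfact n m"

text \<open>Summing over all pairs of sites avoids selecting the pair that leads from
  \<open>a\<close> to \<open>b\<close>; pairs whose site \<open>i\<close> is empty contribute
  0.\<close>

definition rate :: "nat \<Rightarrow> nat \<Rightarrow> expvec \<Rightarrow> expvec \<Rightarrow> real" where
  "rate n d a b = (\<Sum>i<n. \<Sum>j<n. if i \<noteq> j \<and> hop a i j = b then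
     real (Poly_Mapping.lookup a i) * (real d - real (Poly_Mapping.lookup a j)) else 0)"

lemma rho_add_evar:
  "i < n \<Longrightarrow> rho n d (m + evar i) = (real d - real (Poly_Mapping.lookup m i)) * rho n d m"
  unfolding rho_def by (rule prod_update_evar) (auto simp: ffall_def)

lemma lookup_le_degree:
  assumes "m \<in> monoms n d"
  shows "Poly_Mapping.lookup m i \<le> d"
proof (cases "i < n")
  case True
  then show ?thesis
    using assms member_le_sum[of i "{..<n}" "Poly_Mapping.lookup m"] by (simp add: monoms_iff)
next
  case False
  then have "Poly_Mapping.lookup m i = 0" using assms by (meson in_keys_iff lessThan_iff monoms_iff subsetD)
  then show ?thesis by simp
qed

lemma rho_pos:
  assumes "m \<in> monoms n d"
  shows "rho n d m > 0"
  unfolding rho_def ffall_def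
proof (intro prod_pos)
  fix i t assume "t \<in> {..<Poly_Mapping.lookup m i}"
  then show "0 < real d - real t" using lookup_le_degree[OF assms, of i] by simp
qed

lemma weight_pos: "m \<in> monoms n d \<Longrightarrow> weight n d m > 0"
  by (simp add: weight_def rho_pos mfact_pos)

lemma rho_hop:
  assumes "i < n" "j < n" "i \<noteq> j"
  shows "real (Poly_Mapping.lookup m i) * (real d - real (Poly_Mapping.lookup m i) + 1) * rho n d (hop m i j) =
    real (Poly_Mapping.lookup m i) * (real d - real (Poly_Mapping.lookup m j)) * rho n d m"
proof (cases "Poly_Mapping.lookup m i = 0")
  case False
  define c where "c = m - evar i"
  have m: "m = c + evar i" using False by (simp add: c_def evar_cancel)
  have "rho n d (hop m i j) = (real d - real (Poly_Mapping.lookup c j)) * rho n d c"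
    unfolding hop_def c_def[symmetric] by (rule rho_add_evar[OF assms(2)])
  moreover have "rho n d m = (real d - real (Poly_Mapping.lookup c i)) * rho n d c"
    unfolding m by (rule rho_add_evar[OF assms(1)])
  moreover have "real (Poly_Mapping.lookup m j) = real (Poly_Mapping.lookup c j)"
    "real (Poly_Mapping.lookup m i) = real (Poly_Mapping.lookup c i) + 1"
    using assms by (simp_all add: m lookup_add lookup_evar)
  ultimately show ?thesis by simp
qed simp

text \<open>Detailed balance for a single jump: both configurations arise from the common remainder
  \<open>a - evar i\<close> by adding one particle, and the weights change by explicit
  factors.\<close>

lemma weight_hop:
  assumes "i < n" "j < n" "i \<noteq> j" "Poly_Mapping.lookup a i > 0"
  shows "weight n d a * (real (Poly_Mapping.lookup a i) * (real d - real (Poly_Mapping.lookup a j))) =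
    weight n d (hop a i j) * (real (Poly_Mapping.lookup (hop a i j) j) *
      (real d - real (Poly_Mapping.lookup (hop a i j) i)))"
proof -
  define c where "c = a - evar i"
  have a: "a = c + evar i" using assms by (simp add: c_def evar_cancel)
  have b: "hop a i j = c + evar j" by (simp add: hop_def c_def)
  show ?thesis
    using assms(1-3) mfact_pos[of n c]
    unfolding weight_def b unfolding a rho_add_evar[OF assms(1)] rho_add_evar[OF assms(2)]
      mfact_add_evar[OF assms(1)] mfact_add_evar[OF assms(2)]
    by (simp add: lookup_add lookup_evar)
qed

lemma hop_hop: "Poly_Mapping.lookup a i > 0 \<Longrightarrow> hop (hop a i j) j i = a"
  by (simp add: hop_def evar_cancel)

lemma rate_balance: "weight n d a * rate n d a b = weight n d b * rate n d b a"
proof -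
  \<comment> \<open>The jump from \<open>i\<close> to \<open>j\<close> is matched with its reversal
    from \<open>j\<close> to \<open>i\<close>. If neither jump is possible, both sides are
    0.\<close>
  have 1: "weight n d a * (if i \<noteq> j \<and> hop a i j = b then
      real (Poly_Mapping.lookup a i) * (real d - real (Poly_Mapping.lookup a j)) else 0) =
    weight n d b * (if j \<noteq> i \<and> hop b j i = a then
      real (Poly_Mapping.lookup b j) * (real d - real (Poly_Mapping.lookup b i)) else 0)"
    (is "?L a b i j = ?L b a j i") if ij: "i < n" "j < n" for i j
  proof -
    have imp: "?L a b i j = ?L b a j i"
      if "i < n" "j < n" "i \<noteq> j" "hop a i j = b" "Poly_Mapping.lookup a i > 0" for a b i j
      using weight_hop[OF that(1,2,3,5), of d] hop_hop[OF that(5), of j] that(3,4) by auto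
    show ?thesis
    proof (cases "i \<noteq> j \<and> hop a i j = b \<and> Poly_Mapping.lookup a i > 0")
      case True
      then show ?thesis using imp ij by blast
    next
      case left: False
      show ?thesis
      proof (cases "i \<noteq> j \<and> hop b j i = a \<and> Poly_Mapping.lookup b j > 0")
        case True
        then show ?thesis using imp[of j i b a] ij by simp
      next
        case False
        with left show ?thesis by auto
      qed
    qed
  qed
  have "weight n d a * rate n d a b = (\<Sum>i<n. \<Sum>j<n. weight n d a * (if i \<noteq> j \<and> hop a i j = b then
      real (Poly_Mapping.lookup a i) * (real d - real (Poly_Mapping.lookup a j)) else 0))"
    by (simp only: rate_def sum_distrib_left)
  also have "\<dots> = (\<Sum>i<n. \<Sum>j<n. weight n d b * (if j \<noteq> i \<and> hop b j i = a then
      real (Poly_Mapping.lookup b j) * (real d - real (Poly_Mapping.lookup b i)) else 0))"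
    by (intro sum.cong refl 1) auto
  also have "\<dots> = weight n d b * rate n d b a"
    by (subst sum.swap) (simp only: rate_def sum_distrib_left)
  finally show ?thesis .
qed

lemma rate_nonneg:
  assumes "a \<in> monoms n d"
  shows "rate n d a b \<ge> 0"
  unfolding rate_def using lookup_le_degree[OF assms] by (intro sum_nonneg) auto

text \<open>There are \<open>d\<close> particles in all and one of them sits at \<open>i\<close>, so
  site \<open>j\<close> is not full.\<close>

lemma rate_hop_pos:
  assumes a: "a \<in> monoms n d" and ij: "i < n" "j < n" "i \<noteq> j" "Poly_Mapping.lookup a i > 0"
  shows "rate n d a (hop a i j) > 0"
proof -
  let ?f = "\<lambda>i' j'. if i' \<noteq> j' \<and> hop a i' j' = hop a i j then
     real (Poly_Mapping.lookup a i') * (real d - real (Poly_Mapping.lookup a j')) else 0"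
  have nn: "?f i' j' \<ge> 0" for i' j' using lookup_le_degree[OF a] by simp
  have "Poly_Mapping.lookup a i + Poly_Mapping.lookup a j = sum (Poly_Mapping.lookup a) {i, j}"
    using ij by simp
  also have "\<dots> \<le> sum (Poly_Mapping.lookup a) {..<n}" by (rule sum_mono2) (use ij in auto)
  also have "\<dots> = d" using a by (simp add: monoms_iff)
  finally have "0 < ?f i j" using ij by simp
  also have "\<dots> \<le> (\<Sum>j<n. ?f i j)" by (rule member_le_sum) (use ij nn in auto)
  also have "\<dots> \<le> (\<Sum>i<n. \<Sum>j<n. ?f i j)"
    by (rule member_le_sum[of i _ "\<lambda>i. \<Sum>j<n. ?f i j"]) (use ij nn in \<open>auto intro!: sum_nonneg\<close>)
  finally show ?thesis by (simp add: rate_def)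
qed

text \<open>Every configuration can be moved, particle by particle, to the one with all particles at site 0.\<close>

lemma constant_along_hops:
  assumes n: "n \<ge> 1"
    and f: "\<And>m i. m \<in> monoms n d \<Longrightarrow> i < n \<Longrightarrow> i \<noteq> 0 \<Longrightarrow> Poly_Mapping.lookup m i > 0 \<Longrightarrow> f (hop m i 0) = f m"
    and m: "m \<in> monoms n d"
  shows "f m = f (Poly_Mapping.single 0 d)"
  using m
proof (induction "d - Poly_Mapping.lookup m 0" arbitrary: m)
  case 0
  have "Poly_Mapping.lookup m 0 = d" using lookup_le_degree[OF "0.prems", of 0] 0 by simp
  moreover have "(\<Sum>i<n. Poly_Mapping.lookup m i) = Poly_Mapping.lookup m 0 + (\<Sum>i\<in>{..<n} - {0}. Poly_Mapping.lookup m i)"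
    using n by (intro sum.remove) auto
  ultimately have zero: "(\<Sum>i\<in>{..<n} - {0}. Poly_Mapping.lookup m i) = 0"
    using "0.prems" by (simp add: monoms_iff)
  have "Poly_Mapping.lookup m i = 0" if "i \<noteq> 0" for i
  proof (cases "i < n")
    case True
    then show ?thesis using zero that by simp
  next
    case False
    then show ?thesis using "0.prems" by (meson in_keys_iff lessThan_iff monoms_iff subsetD)
  qed
  then have "m = Poly_Mapping.single 0 d"
    using \<open>Poly_Mapping.lookup m 0 = d\<close>
    by (intro poly_mapping_eqI) (simp add: lookup_single when_def)
  then show ?case by simp
next
  case (Suc k)
  have "\<exists>i<n. i \<noteq> 0 \<and> Poly_Mapping.lookup m i > 0"
  proof (rule ccontr)
    assume *: "\<not> ?thesis"
    have "(\<Sum>i<n. Poly_Mapping.lookup m i) = Poly_Mapping.lookup m 0 + (\<Sum>i\<in>{..<n} - {0}. Poly_Mapping.lookup m i)"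
      using n by (intro sum.remove) auto
    also have "(\<Sum>i\<in>{..<n} - {0}. Poly_Mapping.lookup m i) = 0" using * by (intro sum.neutral) auto
    finally show False using Suc.prems Suc.hyps(2) by (simp add: monoms_iff)
  qed
  then obtain i where i: "i < n" "i \<noteq> 0" "Poly_Mapping.lookup m i > 0" by blast
  have "f (hop m i 0) = f (Poly_Mapping.single 0 d)"
    by (rule Suc.hyps(1)) (use i n Suc.hyps(2) Suc.prems in \<open>auto simp: lookup_hop intro: hop_in_monoms\<close>)
  then show ?case using f[OF Suc.prems i] by simp
qed

lemma exclusion_chain:
  assumes n: "n \<ge> 1"
  shows "reversible_chain (monoms n d) (weight n d) (rate n d)"
proof
  show "finite (monoms n d)" by (rule finite_monoms)
  have "Poly_Mapping.single 0 d \<in> monoms n d"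
    using n by (auto simp: monoms_iff lookup_single when_def in_keys_iff split: if_splits)
  then show "monoms n d \<noteq> {}" by blast
  show "weight n d a > 0" if "a \<in> monoms n d" for a using that by (rule weight_pos)
  show "rate n d a b \<ge> 0" if "a \<in> monoms n d" for a b using that by (rule rate_nonneg)
  show "weight n d a * rate n d a b = weight n d b * rate n d b a" for a b by (rule rate_balance)
  fix f :: "expvec \<Rightarrow> real" and a b
  assume f: "\<And>a b. a \<in> monoms n d \<Longrightarrow> b \<in> monoms n d \<Longrightarrow> rate n d a b > 0 \<Longrightarrow> f a = f b"
    and ab: "a \<in> monoms n d" "b \<in> monoms n d"
  have step: "f (hop m i 0) = f m" if "m \<in> monoms n d" "i < n" "i \<noteq> 0" "Poly_Mapping.lookup m i > 0" for m i
    using f[OF that(1) hop_in_monoms[OF that(1,4)], of 0] rate_hop_pos[OF that(1,2) _ that(3,4)] n by simp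
  have "f m = f (Poly_Mapping.single 0 d)" if "m \<in> monoms n d" for m
    by (rule constant_along_hops[OF n step that])
  then show "f a = f b" using ab by simp
qed

text \<open>Dividing the normalised coefficients by \<open>rho\<close> conjugates
  \<open>exclusion_gen\<close> into the generator of the chain; \<open>rho_hop\<close> is this
  identity for one jump.\<close>

lemma exclusion_gen_rho:
  assumes n: "n \<ge> 1" and m: "m \<in> monoms n d"
  shows "exclusion_gen n d (\<lambda>m. rho n d m * u m) m =
    rho n d m * reversible_chain.gen (monoms n d) (rate n d) u m"
proof -
  interpret reversible_chain "monoms n d" "weight n d" "rate n d" by (rule exclusion_chain[OF n])
  let ?c = "\<lambda>i j. real (Poly_Mapping.lookup m i) * (real d - real (Poly_Mapping.lookup m j))"
  have inner: "(\<Sum>b\<in>monoms n d. (if i \<noteq> j \<and> hop m i j = b then ?c i j else 0) * (u b - u m)) =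
    (if i = j then 0 else ?c i j * (u (hop m i j) - u m))" if "i < n" "j < n" for i j
  proof (cases "i = j \<or> Poly_Mapping.lookup m i = 0")
    case True
    then show ?thesis by (auto intro!: sum.neutral)
  next
    case False
    then have "hop m i j \<in> monoms n d" using hop_in_monoms[OF m] that by auto
    then have "(\<Sum>b\<in>monoms n d. if hop m i j = b then ?c i j * (u b - u m) else 0) = ?c i j * (u (hop m i j) - u m)"
      using fin by simp
    moreover have "(\<Sum>b\<in>monoms n d. (if i \<noteq> j \<and> hop m i j = b then ?c i j else 0) * (u b - u m)) =
      (\<Sum>b\<in>monoms n d. if hop m i j = b then ?c i j * (u b - u m) else 0)"
      using False by (intro sum.cong) auto
    ultimately show ?thesis using False by simp
  qed
  have "gen u m = (\<Sum>b\<in>monoms n d. \<Sum>i<n. \<Sum>j<n. (if i \<noteq> j \<and> hop m i j = b then ?c i j else 0) * (u b - u m))"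
    unfolding gen_def rate_def sum_distrib_right ..
  also have "\<dots> = (\<Sum>i<n. \<Sum>b\<in>monoms n d. \<Sum>j<n. (if i \<noteq> j \<and> hop m i j = b then ?c i j else 0) * (u b - u m))"
    by (rule sum.swap)
  also have "\<dots> = (\<Sum>i<n. \<Sum>j<n. \<Sum>b\<in>monoms n d. (if i \<noteq> j \<and> hop m i j = b then ?c i j else 0) * (u b - u m))"
    by (rule sum.cong[OF refl], rule sum.swap)
  also have "\<dots> = (\<Sum>i<n. \<Sum>j<n. if i = j then 0 else ?c i j * (u (hop m i j) - u m))"
    by (intro sum.cong refl inner) auto
  finally have gen: "gen u m = (\<Sum>i<n. \<Sum>j<n. if i = j then 0 else ?c i j * (u (hop m i j) - u m))" .
  show ?thesis
    unfolding gen exclusion_gen_def sum_distrib_left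
  proof (intro sum.cong refl)
    fix i j assume "i \<in> {..<n}" "j \<in> {..<n}"
    then have ij: "i < n" "j < n" by auto
    show "(if i = j then 0 else flux d (\<lambda>m. rho n d m * u m) i j m) =
      rho n d m * (if i = j then 0 else ?c i j * (u (hop m i j) - u m))"
    proof (cases "i = j")
      case False
      have "flux d (\<lambda>m. rho n d m * u m) i j m =
        real (Poly_Mapping.lookup m i) * (real d - real (Poly_Mapping.lookup m i) + 1) * rho n d (hop m i j) * u (hop m i j)
        - ?c i j * (rho n d m * u m)"
        by (simp add: flux_def)
      then show ?thesis
        using False unfolding rho_hop[OF ij False] by (simp add: algebra_simps)
    qed simp
  qed
qed

text \<open>The fixed point is strictly Lorentzian. Its Hessian is a positive multiple of
  \<open>v v^T - diag v\<close> with all \<open>v k \<ge> 2\<close>, so orthogonality to the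
  all-ones vector forces \<open>\<Sum> v k * x k = 0\<close>, and what remains of the form is
  negative.\<close>

lemma strict_lor_rho:
  assumes n: "n \<ge> 1" and c: "c > 0"
  shows "strict_lor n d (\<lambda>m. rho n d m * c)"
  unfolding strict_lor_def
proof (intro conjI ballI impI)
  show "rho n d m * c > 0" if "m \<in> monoms n d" for m using rho_pos[OF that] c by simp
next
  fix I and z :: "nat \<Rightarrow> real" assume d: "2 \<le> d" and I: "I \<in> monoms n (d - 2)" and z: "z \<in> centred_sphere n"
  let ?p = "\<lambda>m. rho n d m * c"
  define v where "v k = real d - real (Poly_Mapping.lookup I k)" for k
  define g where "g = rho n d I * c"
  have v2: "v k \<ge> 2" for k using lookup_le_degree[OF I, of k] d by (simp add: v_def)
  have p_pos: "\<forall>m\<in>monoms n d. ?p m > 0" using rho_pos c by simp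
  interpret sym_form n "hess ?p I" by (rule sym_form_hess[OF n I d p_pos])
  have hess: "hess ?p I k l = g * (v k * v l - (if k = l then v k else 0))" if "k < n" "l < n" for k l
    unfolding hess_def rho_add_evar[OF that(2)] rho_add_evar[OF that(1)]
    by (auto simp: lookup_add lookup_evar g_def v_def algebra_simps)
  have form: "bform n (hess ?p I) x y = g * ((\<Sum>k<n. v k * x k) * (\<Sum>k<n. v k * y k) - (\<Sum>k<n. v k * x k * y k))" for x y
  proof -
    have "bform n (hess ?p I) x y = (\<Sum>k<n. \<Sum>l<n. g * ((v k * x k) * (v l * y l)) - (if k = l then g * (v k * x k * y k) else 0))"
      unfolding bform_def
    proof (intro sum.cong refl)
      fix k l assume "k \<in> {..<n}" "l \<in> {..<n}"
      then have kl: "k < n" "l < n" by auto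
      show "hess ?p I k l * x k * y l = g * ((v k * x k) * (v l * y l)) - (if k = l then g * (v k * x k * y k) else 0)"
        unfolding hess[OF kl] by (simp add: algebra_simps)
    qed
    also have "\<dots> = g * ((\<Sum>k<n. v k * x k) * (\<Sum>k<n. v k * y k)) - g * (\<Sum>k<n. v k * x k * y k)"
      unfolding sum_subtractf sum_product by (simp add: sum_distrib_left)
    finally show ?thesis by (simp add: algebra_simps)
  qed
  have "v 0 \<le> (\<Sum>k<n. v k)" using v2 n by (intro member_le_sum) (auto intro: order_trans[of 0 2])
  then have V: "(\<Sum>k<n. v k) \<ge> 2" using v2[of 0] by simp
  \<comment> \<open>\<open>rho_pos\<close> concerns monomials of degree \<open>d\<close>, while
    \<open>I\<close> has degree \<open>d - 2\<close>; positivity of \<open>g\<close> is read off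
    from one entry of the Hessian.\<close>
  have g: "g > 0"
  proof -
    have "I + evar 0 + evar 0 \<in> monoms n d" using hess_in_monoms[OF I d] n by simp
    then have "0 < hess ?p I 0 0" unfolding hess_def using p_pos by blast
    also have "\<dots> = g * (v 0 * (v 0 - 1))" using n by (subst hess) (auto simp: algebra_simps)
    finally have "0 < g * (v 0 * (v 0 - 1))" .
    moreover have "0 < v 0 * (v 0 - 1)" using v2[of 0] by (intro mult_pos_pos) auto
    ultimately show ?thesis by (meson less_asym zero_less_mult_iff)
  qed
  have "bform n (hess ?p I) x x < 0" if x: "k < n" "x k \<noteq> 0" "bform n (hess ?p I) x (\<lambda>_. 1) = 0" for x k
  proof -
    have "g * ((\<Sum>k<n. v k * x k) * ((\<Sum>k<n. v k) - 1)) = 0"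
      using x(3) unfolding form by (simp add: algebra_simps)
    then have vx: "(\<Sum>k<n. v k * x k) = 0" using g V by simp
    have "0 < (\<Sum>k<n. v k * x k * x k)"
    proof (rule sum_pos2[of _ k])
      show "0 < v k * x k * x k" using v2[of k] x(2) by (auto simp: mult.assoc zero_less_mult_iff linorder_neq_iff)
      show "0 \<le> v i * x i * x i" for i using v2[of i] by (simp add: mult.assoc)
    qed (use x in auto)
    then show ?thesis unfolding form vx using g by simp
  qed
  then show "disc n (hess ?p I) z < 0"
    using perp_iff_nonconst nonconst_iff_centred_sphere z by blast
qed

section \<open>The flow on Lorentzian polynomials\<close>

text \<open>The tube lemma makes a strict inequality over a compact parameter set an open
  condition.\<close>

lemma open_Collect_ball_compact:
  fixes g :: "'a::topological_space \<Rightarrow> 'b::topological_space \<Rightarrow> real"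
  assumes "compact Z" and cont: "continuous_on UNIV (\<lambda>(x, z). g x z)"
  shows "open {x. \<forall>z\<in>Z. g x z < 0}"
proof (subst open_subopen, intro ballI)
  fix x assume x: "x \<in> {x. \<forall>z\<in>Z. g x z < 0}"
  define Y where "Y = {y. (\<lambda>(x, z). g x z) y < 0}"
  have "open Y" unfolding Y_def by (intro open_Collect_less cont continuous_on_const)
  moreover have "{x} \<times> Z \<subseteq> Y" using x by (auto simp: Y_def)
  ultimately obtain X where "x \<in> X" "open X" "X \<times> Z \<subseteq> Y"
    using Elementary_Topology.tube_lemma[OF \<open>compact Z\<close>, of Y x] by blast
  moreover from this(3) have "X \<subseteq> {x. \<forall>z\<in>Z. g x z < 0}" by (auto simp: Y_def)
  ultimately show "\<exists>X. open X \<and> x \<in> X \<and> X \<subseteq> {x. \<forall>z\<in>Z. g x z < 0}" by blast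
qed

text \<open>With a negative derivative \<open>f\<close> would be positive just before
  \<open>s\<close>.\<close>

lemma derivative_nonneg_if_nonpos_before_zero:
  fixes f :: "real \<Rightarrow> real"
  assumes der: "(f has_real_derivative l) (at s)" and s: "s > 0" "f s = 0"
    and nonpos: "\<And>r. 0 \<le> r \<Longrightarrow> r \<le> s \<Longrightarrow> f r \<le> 0"
  shows "l \<ge> 0"
proof (rule ccontr)
  assume "\<not> l \<ge> 0"
  then obtain e where e: "e > 0" "\<And>h. 0 < h \<Longrightarrow> h < e \<Longrightarrow> f s < f (s - h)"
    using DERIV_neg_dec_left[OF der] by auto
  define h where "h = min (e / 2) s"
  have "0 < h" "h < e" "h \<le> s" using e s by (auto simp: h_def)
  then show False using e(2)[of h] nonpos[of "s - h"] s by simp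
qed

lemma bform_has_derivative:
  assumes "\<And>k l. k < n \<Longrightarrow> l < n \<Longrightarrow> ((\<lambda>t. A t k l) has_real_derivative A' k l) (at s)"
  shows "((\<lambda>t. bform n (A t) x y) has_real_derivative bform n A' x y) (at s)"
  unfolding bform_def by (intro DERIV_sum DERIV_cmult_right assms) auto

text \<open>Packages the output of \<open>gen_spectral_decomposition\<close>; \<open>dim\<close>
  counts the decaying modes.\<close>

locale exclusion_coordinates =
  fixes n d dim :: nat and v :: "nat \<Rightarrow> expvec \<Rightarrow> real" and \<mu> :: "nat \<Rightarrow> real"
  assumes n: "n \<ge> 1"
    and \<mu>_positive: "i < dim \<Longrightarrow> \<mu> i > 0"
    and eigen: "i < dim \<Longrightarrow> m \<in> monoms n d \<Longrightarrow>
      reversible_chain.gen (monoms n d) (rate n d) (v i) m = - \<mu> i * v i m"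
    and orthonormal: "i < dim \<Longrightarrow> j < dim \<Longrightarrow>
      (\<Sum>m\<in>monoms n d. weight n d m * v i m * v j m) = (if i = j then 1 else 0)"
    and mean_zero: "i < dim \<Longrightarrow> (\<Sum>m\<in>monoms n d. weight n d m * v i m) = 0"
    and expansion: "m \<in> monoms n d \<Longrightarrow>
       u m = (\<Sum>b\<in>monoms n d. weight n d b * u b) / (\<Sum>b\<in>monoms n d. weight n d b) +
         (\<Sum>i<dim. (\<Sum>b\<in>monoms n d. weight n d b * u b * v i b) * v i m)"
begin

abbreviation \<Omega> :: "expvec set" where "\<Omega> \<equiv> monoms n d"

sublocale chain: reversible_chain \<Omega> "weight n d" "rate n d"
  by (rule exclusion_chain[OF n])

sublocale diagonal_flow dim \<mu>
  by unfold_locales (rule \<mu>_positive)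

section \<open>Densities in spectral coordinates and their evolution\<close>

definition W :: real where "W = (\<Sum>m\<in>\<Omega>. weight n d m)"

lemma W_pos: "W > 0"
  unfolding W_def using chain.fin chain.nonempty by (intro sum_pos weight_pos) auto

text \<open>The density with respect to \<open>weight\<close> of a polynomial with coefficient sum
  1. The term \<open>1 / W\<close> is the stationary density, so the fixed point has coordinates
  0.\<close>

definition dens :: "(nat \<Rightarrow> real) \<Rightarrow> expvec \<Rightarrow> real" where
  "dens x m = 1 / W + (\<Sum>i<dim. x i * v i m)"

definition P :: "(nat \<Rightarrow> real) \<Rightarrow> expvec \<Rightarrow> real" where
  "P x m = rho n d m * dens x m"

lemma continuous_on_dens [continuous_intros]:
  assumes "continuous_on S f"
  shows "continuous_on S (\<lambda>x. dens (f x) m)"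
  unfolding dens_def
  by (intro continuous_on_add continuous_on_const continuous_on_sum continuous_on_mult
      continuous_on_product_then_coordinatewise[OF assms])

lemma continuous_on_P [continuous_intros]:
  "continuous_on S f \<Longrightarrow> continuous_on S (\<lambda>x. P (f x) m)"
  unfolding P_def by (intro continuous_on_mult continuous_on_const continuous_on_dens)

lemma sum_weight_dens: "(\<Sum>m\<in>\<Omega>. weight n d m * dens x m) = 1"
proof -
  have "(\<Sum>m\<in>\<Omega>. weight n d m * (\<Sum>i<dim. x i * v i m)) = (\<Sum>i<dim. x i * (\<Sum>m\<in>\<Omega>. weight n d m * v i m))"
    unfolding sum_distrib_left by (subst sum.swap) (simp add: mult_ac)
  also have "\<dots> = 0" by (simp add: mean_zero)
  finally show ?thesis
    using W_pos by (simp add: dens_def distrib_left sum.distrib sum_divide_distrib[symmetric] W_def[symmetric])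
qed

lemma dens_coordinate:
  assumes "j < dim"
  shows "(\<Sum>m\<in>\<Omega>. weight n d m * dens x m * v j m) = x j"
proof -
  have "(\<Sum>m\<in>\<Omega>. weight n d m * (\<Sum>i<dim. x i * v i m) * v j m) =
    (\<Sum>i<dim. x i * (\<Sum>m\<in>\<Omega>. weight n d m * v i m * v j m))"
    unfolding sum_distrib_left sum_distrib_right by (subst sum.swap) (simp add: mult_ac)
  also have "\<dots> = (\<Sum>i<dim. if i = j then x i else 0)"
    by (intro sum.cong refl) (auto simp: orthonormal assms)
  also have "\<dots> = x j" using assms by simp
  finally have 1: "(\<Sum>m\<in>\<Omega>. weight n d m * (\<Sum>i<dim. x i * v i m) * v j m) = x j" .
  have "(\<Sum>m\<in>\<Omega>. weight n d m * dens x m * v j m) =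
    (\<Sum>m\<in>\<Omega>. weight n d m * v j m) / W + (\<Sum>m\<in>\<Omega>. weight n d m * (\<Sum>i<dim. x i * v i m) * v j m)"
    by (simp add: dens_def distrib_left distrib_right sum.distrib sum_divide_distrib)
  then show ?thesis using 1 mean_zero[OF assms] by simp
qed

lemma gen_dens:
  assumes "m \<in> \<Omega>"
  shows "chain.gen (dens x) m = (\<Sum>i<dim. - \<mu> i * x i * v i m)"
proof -
  have "chain.gen (dens x) m = (\<Sum>b\<in>\<Omega>. \<Sum>i<dim. x i * (rate n d m b * (v i b - v i m)))"
    unfolding chain.gen_def dens_def
    by (intro sum.cong refl) (simp add: sum_distrib_left algebra_simps sum_subtractf)
  also have "\<dots> = (\<Sum>i<dim. x i * chain.gen (v i) m)"
    unfolding chain.gen_def sum_distrib_left by (rule sum.swap)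
  also have "\<dots> = (\<Sum>i<dim. - \<mu> i * x i * v i m)"
    by (intro sum.cong refl) (simp add: eigen assms)
  finally show ?thesis .
qed

lemma dens_T_has_derivative:
  assumes "m \<in> \<Omega>"
  shows "((\<lambda>t. dens (T t x) m) has_real_derivative chain.gen (dens (T s x)) m) (at s)"
  unfolding gen_dens[OF assms] unfolding dens_def T_def
  by (auto intro!: derivative_eq_intros sum.cong simp: mult_ac sum_negf[symmetric])

lemma P_T_has_derivative:
  assumes "m \<in> \<Omega>"
  shows "((\<lambda>t. P (T t x) m) has_real_derivative exclusion_gen n d (P (T s x)) m) (at s)"
proof -
  have "exclusion_gen n d (P (T s x)) m = rho n d m * chain.gen (dens (T s x)) m"
    using exclusion_gen_rho[OF n assms, of "dens (T s x)"] unfolding P_def[abs_def] .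
  then show ?thesis
    unfolding P_def[of "T _ x"] using DERIV_cmult[OF dens_T_has_derivative[OF assms]] by simp
qed

text \<open>A strong minimum principle. At a zero of the density the generator is a sum of
  nonnegative terms, while nonnegativity before time \<open>s\<close> makes the derivative
  nonpositive. So the zero spreads to all neighbours and, by irreducibility, everywhere, against
  total mass 1.\<close>

lemma positivity_improving:
  assumes s: "s > 0" and nonneg: "\<And>r m. 0 \<le> r \<Longrightarrow> r \<le> s \<Longrightarrow> m \<in> \<Omega> \<Longrightarrow> dens (T r x) m \<ge> 0"
    and m: "m \<in> \<Omega>"
  shows "dens (T s x) m > 0"
proof (rule ccontr)
  let ?u = "dens (T s x)"
  assume "\<not> ?u m > 0"
  then have m0: "?u m = 0" using nonneg[of s m] s m by simp
  have spread: "?u b = 0" if a: "a \<in> \<Omega>" "?u a = 0" and b: "b \<in> \<Omega>" "rate n d a b > 0" for a b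
  proof -
    have "((\<lambda>t. - dens (T t x) a) has_real_derivative - chain.gen ?u a) (at s)"
      by (intro DERIV_minus dens_T_has_derivative a)
    then have "- chain.gen ?u a \<ge> 0"
      by (rule derivative_nonneg_if_nonpos_before_zero) (use s nonneg a in auto)
    moreover have "chain.gen ?u a = (\<Sum>b\<in>\<Omega>. rate n d a b * ?u b)" by (simp add: chain.gen_def a)
    moreover have nn: "rate n d a b * ?u b \<ge> 0" if "b \<in> \<Omega>" for b
      using rate_nonneg[OF a(1)] nonneg[of s b] s that by simp
    ultimately have "(\<Sum>b\<in>\<Omega>. rate n d a b * ?u b) = 0"
      using sum_nonneg[of \<Omega> "\<lambda>b. rate n d a b * ?u b"] by simp
    then have "\<forall>b\<in>\<Omega>. rate n d a b * ?u b = 0"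
      using nn chain.fin by (subst (asm) sum_nonneg_eq_0_iff) auto
    then have "rate n d a b * ?u b = 0" using b by blast
    with b show ?thesis by simp
  qed
  \<comment> \<open>Irreducibility is formulated for real functions, so it is applied to the
    indicator of the zero set; detailed balance lets zeros spread in both directions.\<close>
  have "(if ?u a = 0 then 1 else 0) = (if ?u b = 0 then 1 else (0::real))" if "a \<in> \<Omega>" "b \<in> \<Omega>" for a b
  proof (rule chain.irreducible[of "\<lambda>a. if ?u a = 0 then 1 else 0", OF _ that])
    fix a b assume ab: "a \<in> \<Omega>" "b \<in> \<Omega>" "rate n d a b > 0"
    have "weight n d b * rate n d b a > 0"
      unfolding rate_balance[of n d a b, symmetric] by (intro mult_pos_pos weight_pos ab)
    then have "rate n d b a > 0"
      using weight_pos[OF ab(2)] by (meson less_asym zero_less_mult_iff)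
    then have "?u a = 0 \<longleftrightarrow> ?u b = 0" using spread ab by blast
    then show "(if ?u a = 0 then 1 else 0) = (if ?u b = 0 then 1 else (0::real))" by simp
  qed
  from this[OF m] m0 have "?u b = 0" if "b \<in> \<Omega>" for b
    using that by (metis zero_neq_one)
  then have "(\<Sum>m\<in>\<Omega>. weight n d m * ?u m) = 0" by simp
  then show False using sum_weight_dens[of "T s x"] by simp
qed

lemma weak_lor_P_dens: "weak_lor n d (P x) \<Longrightarrow> m \<in> \<Omega> \<Longrightarrow> dens x m \<ge> 0"
  using rho_pos[of m n d] by (fastforce simp: weak_lor_def P_def zero_le_mult_iff)

text \<open>If strictness fails at time \<open>s\<close>, there is a non-constant kernel vector
  \<open>y\<close>. With \<open>y\<close> frozen, \<open>disc\<close> is nonpositive up to time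
  \<open>s\<close> and vanishes there, so its derivative is nonnegative, against
  \<open>exclusion_derivative_negative_on_kernel\<close>.\<close>

theorem weak_flow_becomes_strict:
  assumes s: "s > 0" and weak: "\<And>r. 0 \<le> r \<Longrightarrow> r \<le> s \<Longrightarrow> weak_lor n d (P (T r x))"
  shows "strict_lor n d (P (T s x))"
proof -
  let ?p = "P (T s x)"
  have p_pos: "\<forall>m\<in>\<Omega>. ?p m > 0"
  proof
    fix m assume m: "m \<in> \<Omega>"
    have "dens (T s x) m > 0"
      by (rule positivity_improving[OF s _ m]) (rule weak_lor_P_dens[OF weak])
    then show "?p m > 0" using rho_pos[OF m] by (simp add: P_def)
  qed
  show ?thesis
    unfolding strict_lor_def
  proof (intro conjI impI p_pos, rule ballI)
    fix I assume d: "d \<ge> 2" and I: "I \<in> monoms n (d - 2)"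
    let ?A = "\<lambda>t. hess (P (T t x)) I" and ?B = "hess (exclusion_gen n d ?p) I"
    interpret sym_form n "?A s" by (rule sym_form_hess[OF n I d p_pos])
    have weak_s: "\<forall>I\<in>monoms n (d - 2). \<forall>z. disc n (hess ?p I) z \<le> 0"
      using weak[of s] s d by (auto simp: weak_lor_def)
    have "disc n (?A s) z < 0" if z: "\<exists>k<n. \<exists>l<n. z k \<noteq> z l" for z
    proof (rule ccontr)
      assume "\<not> disc n (?A s) z < 0"
      then obtain y where y: "\<exists>k<n. \<exists>l<n. y k \<noteq> y l" and ker: "\<And>z. bform n (?A s) y z = 0"
        using weak_not_strict_kernel[OF _ z] weak_s I by blast
      have der: "((\<lambda>t. bform n (?A t) a b) has_real_derivative bform n ?B a b) (at s)" for a b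
        unfolding hess_def[of "P (T _ x)"] hess_def[of "exclusion_gen n d ?p"]
        by (intro bform_has_derivative P_T_has_derivative hess_in_monoms[OF I d])
      \<comment> \<open>All other terms of the product rule contain the form at time
        \<open>s\<close> with \<open>y\<close> in one argument and vanish.\<close>
      have "((\<lambda>t. disc n (?A t) y) has_real_derivative
          bform n ?B y y * bform n (?A s) (\<lambda>_. 1) (\<lambda>_. 1)) (at s)"
        unfolding disc_def by (auto intro!: derivative_eq_intros der simp: ker)
      moreover have "disc n (?A s) y = 0" by (simp add: disc_def ker)
      moreover have "disc n (?A r) y \<le> 0" if "0 \<le> r" "r \<le> s" for r
        using weak[OF that] d I by (auto simp: weak_lor_def)
      ultimately have "0 \<le> bform n ?B y y * bform n (?A s) (\<lambda>_. 1) (\<lambda>_. 1)"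
        using derivative_nonneg_if_nonpos_before_zero[of "\<lambda>t. disc n (?A t) y", OF _ s] by blast
      moreover have "bform n ?B y y < 0"
        by (rule exclusion_derivative_negative_on_kernel[OF n d p_pos weak_s I y ker])
      ultimately show False using pos by (simp add: zero_le_mult_iff)
    qed
    then show "\<forall>z\<in>centred_sphere n. disc n (?A s) z < 0"
      using nonconst_iff_centred_sphere by blast
  qed
qed

text \<open>Only constant vectors are not covered by strictness, and \<open>disc\<close> vanishes on
  them.\<close>

lemma strict_lor_imp_weak_lor: "strict_lor n d p \<Longrightarrow> weak_lor n d p"
proof -
  assume p: "strict_lor n d p"
  show "weak_lor n d p"
    unfolding weak_lor_def
  proof (intro conjI impI ballI allI)
    show "p m \<ge> 0" if "m \<in> \<Omega>" for m using p that by (auto simp: strict_lor_def less_imp_le)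
  next
    fix I x assume d: "2 \<le> d" and I: "I \<in> monoms n (d - 2)"
    interpret sym_form n "hess p I"
      by (rule sym_form_hess[OF n I d]) (use p in \<open>auto simp: strict_lor_def\<close>)
    have strict: "\<forall>x. (\<exists>k<n. \<exists>l<n. x k \<noteq> x l) \<longrightarrow> disc n (hess p I) x < 0"
      unfolding nonconst_iff_centred_sphere using p d I by (auto simp: strict_lor_def)
    show "disc n (hess p I) x \<le> 0"
    proof (cases "\<exists>k<n. \<exists>l<n. x k \<noteq> x l")
      case True
      then show ?thesis using strict by (simp add: less_imp_le)
    next
      case False
      define c where "c = x 0"
      have xc: "x k = c * 1" if "k < n" for k
        using False that n unfolding c_def by (metis One_nat_def Suc_le_lessD mult.right_neutral)
      have "bform n (hess p I) x y = bform n (hess p I) (\<lambda>_. c * 1) y" for y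
        by (rule bform_cong) (auto simp: xc)
      moreover have "bform n (hess p I) y x = bform n (hess p I) y (\<lambda>_. c * 1)" for y
        by (rule bform_cong) (auto simp: xc)
      ultimately have "disc n (hess p I) x = disc n (hess p I) (\<lambda>_. c * 1)"
        by (simp add: disc_def)
      also have "\<dots> = 0" unfolding disc_def bform_linear by (simp add: power2_eq_square)
      finally show ?thesis by simp
    qed
  qed
qed

section \<open>Strict and weak points and their behaviour under the flow\<close>

definition strict_set :: "(nat \<Rightarrow> real) set" where
  "strict_set = {x \<in> E. strict_lor n d (P x)}"

definition weak_set :: "(nat \<Rightarrow> real) set" where
  "weak_set = {x. weak_lor n d (P x)}"

lemma continuous_on_bform_P:
  assumes "continuous_on S f" "\<And>k. continuous_on S (\<lambda>x. g x k)" "\<And>k. continuous_on S (\<lambda>x. h x k)"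
  shows "continuous_on S (\<lambda>x. bform n (hess (P (f x)) I) (g x) (h x))"
  unfolding bform_def hess_def by (intro continuous_intros assms)

lemma continuous_on_disc_P:
  assumes "continuous_on S f" "continuous_on S g"
  shows "continuous_on S (\<lambda>x. disc n (hess (P (f x)) I) (g x))"
  unfolding disc_def
  by (intro continuous_intros continuous_on_bform_P assms continuous_on_product_then_coordinatewise[OF assms(2)])

lemma open_strict_set: "openin (top_of_set E) strict_set"
proof -
  have "open {x. strict_lor n d (P x)}"
  proof -
    have "{x. strict_lor n d (P x)} = (\<Inter>m\<in>\<Omega>. {x. 0 < P x m}) \<inter>
      (\<Inter>I\<in>(if d \<ge> 2 then monoms n (d - 2) else {}). {x. \<forall>z\<in>centred_sphere n. disc n (hess (P x) I) z < 0})"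
      by (auto simp: strict_lor_def)
    also have "open \<dots>"
    proof (intro open_Int open_INT ballI open_Collect_ball_compact compact_centred_sphere)
      show "open {x. 0 < P x m}" for m
        by (intro open_Collect_less continuous_intros)
      show "continuous_on UNIV (\<lambda>(x, z). disc n (hess (P x) I) z)" for I
        unfolding case_prod_unfold by (intro continuous_on_disc_P continuous_intros)
    qed (auto simp: finite_monoms)
    finally show ?thesis .
  qed
  then have "openin (top_of_set E) (E \<inter> {x. strict_lor n d (P x)})" by (rule openin_open_Int)
  also have "E \<inter> {x. strict_lor n d (P x)} = strict_set" by (auto simp: strict_set_def)
  finally show ?thesis .
qed

lemma closed_weak_set: "closed weak_set"
proof -
  have "weak_set = (\<Inter>m\<in>\<Omega>. {x. 0 \<le> P x m}) \<inter>
    (\<Inter>I\<in>(if d \<ge> 2 then monoms n (d - 2) else {}). \<Inter>z. {x. disc n (hess (P x) I) z \<le> 0})"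
    by (auto simp: weak_set_def weak_lor_def)
  also have "closed \<dots>"
    by (intro closed_Int closed_INT ballI closed_Collect_le continuous_intros continuous_on_disc_P)
  finally show ?thesis .
qed

lemma strict_subset_weak: "strict_set \<subseteq> weak_set"
  using strict_lor_imp_weak_lor by (auto simp: strict_set_def weak_set_def)

text \<open>At the first exit time \<open>s\<close> the trajectory would not be strict, since
  \<open>strict_set\<close> is relatively open. But up to and including \<open>s\<close> it is weak,
  so \<open>weak_flow_becomes_strict\<close> makes it strict at \<open>s\<close>.\<close>

lemma strict_set_invariant:
  assumes x: "x \<in> strict_set" and t: "t \<ge> 0"
  shows "T t x \<in> strict_set"
proof (rule ccontr)
  assume bad: "T t x \<notin> strict_set"
  have xE: "x \<in> E" using x by (simp add: strict_set_def)
  obtain V where V: "open V" "strict_set = E \<inter> V"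
    using open_strict_set by (auto simp: openin_open)
  define B where "B = {0..} \<inter> (\<lambda>t. T t x) -` (- V)"
  have B_iff: "r \<in> B \<longleftrightarrow> 0 \<le> r \<and> T r x \<notin> strict_set" for r
    using T_in_E[OF xE] V(2) by (auto simp: B_def)
  have "closed B"
    unfolding B_def using V(1) by (intro closed_Int closed_vimage continuous_on_T_time) auto
  moreover have "B \<noteq> {}" using bad t B_iff by blast
  moreover have "bdd_below B" by (auto simp: B_def)
  ultimately have "Inf B \<in> B" by (intro closed_contains_Inf)
  define s where "s = Inf B"
  have sB: "s \<in> B" using \<open>Inf B \<in> B\<close> by (simp add: s_def)
  have "0 \<notin> B" using x by (simp add: B_iff T_0)
  then have s: "s > 0" using sB by (cases "s = 0") (auto simp: B_iff)
  have before: "T r x \<in> weak_set" if "0 \<le> r" "r < s" for r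
    using that cInf_lower[OF _ \<open>bdd_below B\<close>, of r] B_iff[of r] strict_subset_weak unfolding s_def[symmetric]
    by force
  \<comment> \<open>Closedness of \<open>weak_set\<close> includes the exit time itself.\<close>
  have "closure {0..<s} \<subseteq> (\<lambda>t. T t x) -` weak_set"
    by (intro closure_minimal closed_vimage closed_weak_set continuous_on_T_time) (auto intro: before)
  then have "weak_lor n d (P (T r x))" if "0 \<le> r" "r \<le> s" for r
    using that s by (auto simp: closure_atLeastLessThan weak_set_def)
  then have "strict_lor n d (P (T s x))" using weak_flow_becomes_strict[OF s] by blast
  then show False using sB T_in_E[OF xE] by (auto simp: B_iff strict_set_def)
qed

text \<open>Forward trajectories of limits of strict points stay weak, by continuity of
  \<open>T r\<close> and closedness of \<open>weak_set\<close>; then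
  \<open>weak_flow_becomes_strict\<close> applies.\<close>

lemma closure_strict_set_improves:
  assumes x: "x \<in> closure strict_set" and t: "t > 0"
  shows "T t x \<in> strict_set"
proof -
  have "closure strict_set \<subseteq> E"
    by (rule closure_minimal) (auto simp: strict_set_def closed_E)
  then have xE: "x \<in> E" using x by blast
  have "T r x \<in> weak_set" if "r \<ge> 0" for r
  proof -
    have "closed (T r -` weak_set)"
      by (intro closed_vimage closed_weak_set continuous_on_T continuous_on_const continuous_on_id)
    moreover have "strict_set \<subseteq> T r -` weak_set"
      using strict_set_invariant[OF _ that] strict_subset_weak by blast
    ultimately show ?thesis using x closure_minimal by blast
  qed
  then have "strict_lor n d (P (T t x))"
    using weak_flow_becomes_strict[OF t] by (auto simp: weak_set_def)
  then show ?thesis using T_in_E[OF xE] by (simp add: strict_set_def)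
qed

lemma zero_in_strict_set: "(\<lambda>_. 0) \<in> strict_set"
proof -
  have "P (\<lambda>_. 0) = (\<lambda>m. rho n d m * (1 / W))" by (simp add: P_def dens_def fun_eq_iff)
  then show ?thesis
    using strict_lor_rho[OF n, of "1 / W" d] W_pos by (simp add: strict_set_def E_def)
qed

text \<open>For a strict point the numbers \<open>weight n d m * dens x m\<close> are nonnegative
  with sum 1, which bounds each coordinate by \<open>C i\<close>.\<close>

lemma compact_closure_strict_set: "compact (closure strict_set)"
proof -
  define C where "C i = (\<Sum>m\<in>\<Omega>. \<bar>v i m\<bar>)" for i
  define B where "B i = (if i < dim then {- C i..C i} else {0})" for i
  have "x i \<in> B i" if x: "x \<in> strict_set" for x i
  proof (cases "i < dim")
    case True
    have nn: "weight n d m * dens x m \<ge> 0" if "m \<in> \<Omega>" for m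
      using weak_lor_P_dens[of x m] weight_pos[OF that] x that strict_subset_weak
      by (auto simp: weak_set_def)
    have le1: "\<bar>weight n d m * dens x m\<bar> \<le> 1" if "m \<in> \<Omega>" for m
      using member_le_sum[of m \<Omega> "\<lambda>m. weight n d m * dens x m", OF that] nn chain.fin that
      by (simp add: sum_weight_dens)
    have "\<bar>x i\<bar> = \<bar>\<Sum>m\<in>\<Omega>. weight n d m * dens x m * v i m\<bar>" by (simp add: dens_coordinate[OF True])
    also have "\<dots> \<le> (\<Sum>m\<in>\<Omega>. \<bar>weight n d m * dens x m * v i m\<bar>)" by (rule sum_abs)
    also have "\<dots> \<le> C i"
      unfolding C_def
    proof (rule sum_mono)
      fix m assume "m \<in> \<Omega>"
      then show "\<bar>weight n d m * dens x m * v i m\<bar> \<le> \<bar>v i m\<bar>"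
        using le1 unfolding abs_mult[of "weight n d m * dens x m"] by (intro mult_left_le_one_le) auto
    qed
    finally show ?thesis using True by (auto simp: B_def abs_le_iff)
  next
    case False
    then show ?thesis using x by (simp add: B_def strict_set_def E_def)
  qed
  then have "strict_set \<subseteq> {x. \<forall>i. x i \<in> B i}" by blast
  moreover have box: "compact {x. \<forall>i. x i \<in> B i}"
    by (intro compact_box_fun) (auto simp: B_def)
  ultimately have "closure strict_set \<subseteq> {x. \<forall>i. x i \<in> B i}"
    by (intro closure_minimal compact_imp_closed)
  then have "closure strict_set = {x. \<forall>i. x i \<in> B i} \<inter> closure strict_set" by blast
  then show ?thesis using compact_Int_closed[OF box closed_closure, of strict_set] by simp
qed

lemma absorbing_closure_strict_set: "absorbing (closure strict_set) strict_set"
  unfolding absorbing_def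
proof (intro conjI allI impI ballI)
  show "closure strict_set \<subseteq> E"
    by (rule closure_minimal) (auto simp: strict_set_def closed_E)
  show "(\<lambda>_. 0) \<in> closure strict_set" using zero_in_strict_set closure_subset by blast
qed (use compact_closure_strict_set open_strict_set closure_subset closure_strict_set_improves in auto)

end

section \<open>Coordinates on the space of polynomials\<close>

lemma strict_lor_scale:
  assumes "strict_lor n d p" "c > 0"
  shows "strict_lor n d (\<lambda>m. c * p m)"
proof -
  have "hess (\<lambda>m. c * p m) I = (\<lambda>k l. c * hess p I k l)" for I
    by (simp add: hess_def fun_eq_iff)
  then have "disc n (hess (\<lambda>m. c * p m) I) x = c\<^sup>2 * disc n (hess p I) x" for I x
    by (simp add: disc_def bform_scale_matrix power2_eq_square algebra_simps)
  then show ?thesis using assms by (auto simp: strict_lor_def mult_less_0_iff)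
qed

lemma strict_lor_cong:
  assumes "\<And>m. m \<in> monoms n d \<Longrightarrow> p m = q m"
  shows "strict_lor n d p \<longleftrightarrow> strict_lor n d q"
proof -
  have "disc n (hess p I) x = disc n (hess q I) x" if "d \<ge> 2" "I \<in> monoms n (d - 2)" for I x
  proof -
    have "bform n (hess p I) y z = bform n (hess q I) y z" for y z
      by (rule bform_cong) (auto simp: hess_def intro!: assms hess_in_monoms that)
    then show ?thesis by (simp add: disc_def)
  qed
  then show ?thesis using assms by (auto simp: strict_lor_def)
qed

lemma continuous_map_Htop_lookup:
  assumes "m \<in> monoms n d"
  shows "continuous_map (Htop n d) euclideanreal (\<lambda>f. Poly_Mapping.lookup f m)"
proof -
  have "continuous_map (Htop n d) euclideanreal
      ((\<lambda>g. g m) \<circ> (\<lambda>f. restrict (Poly_Mapping.lookup f) (monoms n d)))"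
    unfolding Htop_def by (intro continuous_map_pullback continuous_map_product_projection assms)
  then show ?thesis using assms by (simp add: o_def)
qed

lemma continuous_map_into_Htop:
  assumes "\<And>x. x \<in> topspace X \<Longrightarrow> F x \<in> Hpoly n d"
    and "\<And>m. m \<in> monoms n d \<Longrightarrow> continuous_map X euclideanreal (\<lambda>x. Poly_Mapping.lookup (F x) m)"
  shows "continuous_map X (Htop n d) F"
  unfolding Htop_def
proof (rule continuous_map_pullback')
  show "continuous_map X (powertop_real (monoms n d)) ((\<lambda>f. restrict (Poly_Mapping.lookup f) (monoms n d)) \<circ> F)"
    unfolding continuous_map_componentwise using assms(2) by (auto simp: o_def)
qed (use assms(1) in auto)

lemma mpeval_one:
  assumes "f \<in> Hpoly n d"
  shows "mpeval f (\<lambda>_. 1) = (\<Sum>m\<in>monoms n d. Poly_Mapping.lookup f m)"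
  unfolding mpeval_def using assms
  by (auto simp: Hpoly_def in_keys_iff intro!: sum.mono_neutral_left finite_monoms)

section \<open>Identification of coordinates with polynomials of coefficient sum 1\<close>

context exclusion_coordinates
begin

definition to_poly :: "(nat \<Rightarrow> real) \<Rightarrow> real_mpoly" where
  "to_poly x = Abs_poly_mapping (\<lambda>m. if m \<in> \<Omega> then weight n d m * dens x m else 0)"

text \<open>The weighted inner product of the density with \<open>v i\<close>; the weight is already
  contained in the coefficients of \<open>f\<close>.\<close>

definition coords :: "real_mpoly \<Rightarrow> nat \<Rightarrow> real" where
  "coords f i = (if i < dim then \<Sum>m\<in>\<Omega>. Poly_Mapping.lookup f m * v i m else 0)"

lemma lookup_to_poly:
  "Poly_Mapping.lookup (to_poly x) m = (if m \<in> \<Omega> then weight n d m * dens x m else 0)"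
proof -
  have "finite {m. (if m \<in> \<Omega> then weight n d m * dens x m else 0) \<noteq> 0}"
    by (rule finite_subset[OF _ finite_monoms[of n d]]) auto
  then show ?thesis unfolding to_poly_def by (simp add: Abs_poly_mapping_inverse)
qed

lemma to_poly_in_Hpoly: "to_poly x \<in> Hpoly n d"
  by (auto simp: Hpoly_def in_keys_iff lookup_to_poly split: if_splits)

lemma mpeval_to_poly: "mpeval (to_poly x) (\<lambda>_. 1) = 1"
  by (simp add: mpeval_one[OF to_poly_in_Hpoly] lookup_to_poly sum_weight_dens)

lemma coords_in_E: "coords f \<in> E"
  by (simp add: coords_def E_def)

lemma coords_to_poly: "x \<in> E \<Longrightarrow> coords (to_poly x) = x"
  by (auto simp: coords_def lookup_to_poly dens_coordinate E_def fun_eq_iff)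

lemma dens_coords:
  assumes "(\<Sum>m\<in>\<Omega>. Poly_Mapping.lookup f m) = 1" "m \<in> \<Omega>"
  shows "weight n d m * dens (coords f) m = Poly_Mapping.lookup f m"
proof -
  let ?u = "\<lambda>m. Poly_Mapping.lookup f m / weight n d m"
  have cancel: "weight n d b * ?u b = Poly_Mapping.lookup f b" if "b \<in> \<Omega>" for b
    using weight_pos[OF that] by simp
  have "?u m = (\<Sum>b\<in>\<Omega>. weight n d b * ?u b) / (\<Sum>b\<in>\<Omega>. weight n d b) +
      (\<Sum>i<dim. (\<Sum>b\<in>\<Omega>. weight n d b * ?u b * v i b) * v i m)"
    by (rule expansion[OF assms(2)])
  also have "(\<Sum>b\<in>\<Omega>. weight n d b * ?u b) = 1"
    unfolding assms(1)[symmetric] by (intro sum.cong refl cancel)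
  also have "(\<Sum>i<dim. (\<Sum>b\<in>\<Omega>. weight n d b * ?u b * v i b) * v i m) = (\<Sum>i<dim. coords f i * v i m)"
  proof (intro sum.cong refl arg_cong2[of _ _ _ _ "(*)"])
    fix i assume "i \<in> {..<dim}"
    moreover have "(\<Sum>b\<in>\<Omega>. weight n d b * ?u b * v i b) = (\<Sum>b\<in>\<Omega>. Poly_Mapping.lookup f b * v i b)"
      by (intro sum.cong refl) (simp only: cancel)
    ultimately show "(\<Sum>b\<in>\<Omega>. weight n d b * ?u b * v i b) = coords f i" by (simp add: coords_def)
  qed
  finally have "?u m = dens (coords f) m" by (simp add: dens_def W_def)
  then show ?thesis using cancel[OF assms(2)] by simp
qed

lemma to_poly_coords:
  assumes "f \<in> Hpoly n d" "(\<Sum>m\<in>\<Omega>. Poly_Mapping.lookup f m) = 1"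
  shows "to_poly (coords f) = f"
proof (rule poly_mapping_eqI)
  fix m
  show "Poly_Mapping.lookup (to_poly (coords f)) m = Poly_Mapping.lookup f m"
    using assms(1) dens_coords[OF assms(2)]
    by (auto simp: lookup_to_poly Hpoly_def in_keys_iff)
qed

lemma pcoef_to_poly: "m \<in> \<Omega> \<Longrightarrow> pcoef n (to_poly x) m = P x m"
  using mfact_pos[of n m] by (simp add: pcoef_def lookup_to_poly P_def weight_def)

lemma strictly_lorentzian_to_poly: "strictly_lorentzian n d (to_poly x) \<longleftrightarrow> strict_lor n d (P x)"
  unfolding strictly_lorentzian_iff[OF n] using to_poly_in_Hpoly strict_lor_cong[OF pcoef_to_poly] by simp

lemma continuous_map_to_poly: "continuous_map (top_of_set S) (Htop n d) to_poly"
proof (rule continuous_map_into_Htop)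
  fix m assume "m \<in> \<Omega>"
  then show "continuous_map (top_of_set S) euclideanreal (\<lambda>x. Poly_Mapping.lookup (to_poly x) m)"
    by (simp add: lookup_to_poly) (intro continuous_intros)
qed (rule to_poly_in_Hpoly)

lemma continuous_map_coords: "continuous_map (Htop n d) euclidean coords"
proof -
  have "continuous_map (Htop n d) (product_topology (\<lambda>i. euclidean) UNIV) coords"
    unfolding continuous_map_componentwise_UNIV
  proof
    fix i
    show "continuous_map (Htop n d) euclideanreal (\<lambda>f. coords f i)"
      by (cases "i < dim")
         (auto simp: coords_def intro!: continuous_map_sum continuous_map_real_mult continuous_map_Htop_lookup finite_monoms)
  qed
  then show ?thesis by (simp add: euclidean_product_topology)
qed

lemma PL_iff_closure:
  assumes x: "x \<in> E"
  shows "to_poly x \<in> PL n d \<longleftrightarrow> x \<in> closure strict_set"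
proof
  assume "to_poly x \<in> PL n d"
  then obtain F where F: "\<And>k. strictly_lorentzian n d (F k)" "limitin (Htop n d) F (to_poly x) sequentially"
    by (auto simp: PL_def lorentzian_def)
  \<comment> \<open>The approximating polynomials need not take the value 1 at the all-ones point,
    so they are rescaled by their coefficient sums, which tend to 1.\<close>
  define c where "c k = (\<Sum>m\<in>\<Omega>. Poly_Mapping.lookup (F k) m)" for k
  define y where "y k = (\<lambda>i. coords (F k) i / c k)" for k
  have lim: "(\<lambda>k. Poly_Mapping.lookup (F k) m) \<longlonglongrightarrow> Poly_Mapping.lookup (to_poly x) m" if "m \<in> \<Omega>" for m
    using continuous_map_limit[OF continuous_map_Htop_lookup[OF that] F(2)] by (simp add: o_def)
  have "c \<longlonglongrightarrow> (\<Sum>m\<in>\<Omega>. Poly_Mapping.lookup (to_poly x) m)"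
    unfolding c_def by (intro tendsto_sum lim)
  then have c1: "c \<longlonglongrightarrow> 1" using mpeval_to_poly[of x] by (simp add: mpeval_one[OF to_poly_in_Hpoly])
  have cpos: "c k > 0" for k
    unfolding c_def using F(1)[of k] chain.fin chain.nonempty
    by (intro sum_pos) (auto simp: strictly_lorentzian_def)
  have "y k \<in> strict_set" for k
  proof -
    define f where "f = Abs_poly_mapping (\<lambda>m. Poly_Mapping.lookup (F k) m / c k)"
    have lf: "Poly_Mapping.lookup f m = Poly_Mapping.lookup (F k) m / c k" for m
    proof -
      have "finite {m. Poly_Mapping.lookup (F k) m / c k \<noteq> 0}"
        by (rule finite_subset[OF _ finite_lookup[of "F k"]]) auto
      then show ?thesis by (simp add: f_def Abs_poly_mapping_inverse)
    qed
    have fH: "f \<in> Hpoly n d"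
      using F(1)[of k] by (auto simp: strictly_lorentzian_def Hpoly_def in_keys_iff lf subset_iff)
    have fsum: "(\<Sum>m\<in>\<Omega>. Poly_Mapping.lookup f m) = 1"
      using cpos[of k] by (simp add: lf sum_divide_distrib[symmetric] c_def[symmetric])
    have "coords f = y k"
      by (auto simp: coords_def y_def lf fun_eq_iff sum_divide_distrib)
    then have fy: "to_poly (y k) = f" using to_poly_coords[OF fH fsum] by simp
    have "strict_lor n d (pcoef n (F k))" using F(1)[of k] by (simp add: strictly_lorentzian_iff[OF n])
    then have "strict_lor n d (\<lambda>m. 1 / c k * pcoef n (F k) m)" using cpos[of k] by (intro strict_lor_scale) auto
    also have "(\<lambda>m. 1 / c k * pcoef n (F k) m) = pcoef n f" by (simp add: pcoef_def lf fun_eq_iff)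
    finally have "strictly_lorentzian n d (to_poly (y k))"
      using fH fy by (simp add: strictly_lorentzian_iff[OF n])
    moreover have "y k \<in> E" using coords_in_E[of "F k"] by (simp add: y_def E_def)
    ultimately show ?thesis by (simp add: strict_set_def strictly_lorentzian_to_poly)
  qed
  moreover have "y \<longlonglongrightarrow> x"
  proof -
    have "(\<lambda>k. coords (F k)) \<longlonglongrightarrow> coords (to_poly x)"
      using continuous_map_limit[OF continuous_map_coords F(2)] by (simp add: o_def)
    then have "limitin (product_topology (\<lambda>i. euclidean) UNIV) (\<lambda>k. coords (F k)) x sequentially"
      using x by (simp add: coords_to_poly euclidean_product_topology)
    then have "(\<lambda>k. coords (F k) i) \<longlonglongrightarrow> x i" for i by (simp add: limitin_componentwise)
    then have "(\<lambda>k. coords (F k) i / c k) \<longlonglongrightarrow> x i / 1" for i by (intro tendsto_divide c1) auto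
    then have "limitin (product_topology (\<lambda>i. euclidean) UNIV) y x sequentially"
      by (simp add: limitin_componentwise y_def)
    then show ?thesis by (simp add: euclidean_product_topology)
  qed
  ultimately show "x \<in> closure strict_set" unfolding closure_sequential by blast
next
  assume "x \<in> closure strict_set"
  then obtain y where y: "\<And>k. y k \<in> strict_set" "y \<longlonglongrightarrow> x" unfolding closure_sequential by blast
  have "limitin (Htop n d) (to_poly \<circ> y) (to_poly x) sequentially"
    by (rule continuous_map_limit[of euclidean])
       (use continuous_map_to_poly[of UNIV] y(2) in simp_all)
  moreover have "strictly_lorentzian n d ((to_poly \<circ> y) k)" for k
    using y(1)[of k] by (simp add: strictly_lorentzian_to_poly strict_set_def)
  ultimately have "lorentzian n d (to_poly x)" unfolding lorentzian_def by blast
  then show "to_poly x \<in> PL n d" by (simp add: PL_def to_poly_in_Hpoly mpeval_to_poly)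
qed

lemma PL_homeomorphic_closure:
  "subtopology (Htop n d) (PL n d) homeomorphic_space top_of_set (closure strict_set)"
proof -
  have PL: "to_poly (coords f) = f" "coords f \<in> closure strict_set" if "f \<in> PL n d" for f
  proof -
    have "f \<in> Hpoly n d" "(\<Sum>m\<in>\<Omega>. Poly_Mapping.lookup f m) = 1"
      using that mpeval_one[of f n d] by (auto simp: PL_def)
    then show 1: "to_poly (coords f) = f" by (rule to_poly_coords)
    then show "coords f \<in> closure strict_set"
      using that by (simp flip: PL_iff_closure[OF coords_in_E])
  qed
  have sub: "closure strict_set \<subseteq> E"
    using absorbing_closure_strict_set by (simp add: absorbing_def)
  have "homeomorphic_maps (subtopology (Htop n d) (PL n d)) (top_of_set (closure strict_set)) coords to_poly"
    unfolding homeomorphic_maps_def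
  proof (intro conjI ballI)
    show "continuous_map (subtopology (Htop n d) (PL n d)) (top_of_set (closure strict_set)) coords"
      unfolding continuous_map_in_subtopology
      using PL continuous_map_from_subtopology[OF continuous_map_coords] by auto
    show "continuous_map (top_of_set (closure strict_set)) (subtopology (Htop n d) (PL n d)) to_poly"
      unfolding continuous_map_in_subtopology
      using continuous_map_to_poly PL_iff_closure sub by auto
  qed (use PL sub coords_to_poly in auto)
  then show ?thesis unfolding homeomorphic_space_def by blast
qed

lemma closed_ball_space_eq: "closed_ball_space dim = top_of_set cball_E"
proof -
  have "{x. \<forall>i\<ge>dim. x i = 0} \<inter> {x. (\<Sum>i<dim. (x i)\<^sup>2) \<le> 1} = cball_E"
    by (auto simp: cball_E_def E_def)
  then show ?thesis
    by (simp add: closed_ball_space_def Euclidean_space_def euclidean_product_topology subtopology_subtopology)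
qed

lemma PL_homeomorphic_ball:
  "subtopology (Htop n d) (PL n d) homeomorphic_space closed_ball_space dim"
proof -
  obtain f g where fg: "homeomorphism (closure strict_set) cball_E f g"
    using absorbing_homeomorphic[OF absorbing_closure_strict_set absorbing_cball]
    by (auto simp: homeomorphic_def)
  then have "homeomorphic_maps (top_of_set (closure strict_set)) (top_of_set cball_E) f g"
    by (auto simp: homeomorphism_def homeomorphic_maps_def)
  then have "top_of_set (closure strict_set) homeomorphic_space closed_ball_space dim"
    unfolding closed_ball_space_eq homeomorphic_space_def by blast
  with PL_homeomorphic_closure show ?thesis by (rule homeomorphic_space_trans)
qed

end

theorem theorem3p4:
  fixes n d :: nat
  assumes "n \<ge> 1"
  shows "\<exists>k. subtopology (Htop n d) (PL n d) homeomorphic_space closed_ball_space k"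
proof -
  \<comment> \<open>The ball has one dimension less than the number of monomials, because the
    normalisation fixes the coefficient sum.\<close>
  obtain v :: "nat \<Rightarrow> expvec \<Rightarrow> real" and \<mu> where
    "exclusion_coordinates n d (card (monoms n d) - 1) v \<mu>"
    by (rule reversible_chain.gen_spectral_decomposition[OF exclusion_chain[OF assms, of d]])
       (rule that, unfold_locales, use assms in blast)
  then show ?thesis using exclusion_coordinates.PL_homeomorphic_ball by blast
qed

end
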